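(* Let $1<p<\infty$, let $\Omega\subset\mathbb{R}^d$ be open and let $u,v\in W^{1,p}(\Omega)$. Let $v_\varepsilon\in W^p_{\nu_\varepsilon}(\Omega)$, $\varepsilon>0$, be such that $v_\varepsilon\to v$ in $L^p_{\mathrm{loc}}(\Omega)$ as $\varepsilon\to0$ and $$\sup_{\varepsilon>0}\big(\|v_\varepsilon\|_{L^p(\Omega)}^p+\mathcal{E}^\varepsilon_\Omega(v_\varepsilon,v_\varepsilon)\big)<\infty.$$ If $u\in W^{1,p}_0(\Omega)$ or $\Omega$ is a $W^{1,p}$-extension domain, then $$\lim_{\varepsilon\to0}\mathcal{E}^\varepsilon_\Omega(u,v_\varepsilon)=K_{d,p}\,\mathcal{E}^0(u,v).$$
   Context: Kernels: $(\nu_\varepsilon)_{\varepsilon>0}$ is a family of radial measurable functions $\nu_\varepsilon:\mathbb{R}^d\setminus\{0\}\to[0,\infty)$, $d\ge1$, with $\int_{\mathbb{R}^d}(1\wedge|h|^p)\nu_\varepsilon(h)\,dh=1$ and $\lim_{\varepsilon\to0}\int_{|h|>\delta}\nu_\varepsilon(h)\,dh=0$ for every $\delta>0$. $K_{d,p}=\frac{1}{|\mathbb{S}^{d-1}|}\int_{\mathbb{S}^{d-1}}|w_d|^p\,d\sigma_{d-1}(w)$. $\mathcal{E}^\varepsilon_\Omega(u,v)=\iint_{\Omega\times\Omega}|u(x)-u(y)|^{p-2}(u(x)-u(y))(v(x)-v(y))\nu_\varepsilon(x-y)\,dy\,dx$; $\mathcal{E}^0(u,v)=\int_\Omega|\nabla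 u|^{p-2}\nabla u\cdot\nabla v\,dx$; $W^p_{\nu_\varepsilon}(\Omega)=\{u\in L^p(\Omega):\mathcal{E}^\varepsilon_\Omega(u,u)<\infty\}$. An open set $\Omega$ is a $W^{1,p}$-extension domain if there is a bounded linear operator $E:W^{1,p}(\Omega)\to W^{1,p}(\mathbb{R}^d)$ with $Eu|_\Omega=u$. *)

theory Defs
  imports "HOL-Analysis.Analysis"
begin

text \<open>
  Function spaces consist of representatives: a real function on a subset \<open>\<Omega>\<close> of Euclidean space is a
  total function of which only the values on \<open>\<Omega>\<close>, up to null sets, matter.
\<close>

section \<open>Lebesgue spaces\<close>

definition Lp_space :: "real \<Rightarrow> 'a::euclidean_space set \<Rightarrow> ('a \<Rightarrow> 'b::euclidean_space) set" where
  "Lp_space p \<Omega> = {f. f \<in> borel_measurable (lebesgue_on \<Omega>) \<and>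
                     integrable (lebesgue_on \<Omega>) (\<lambda>x. norm (f x) powr p)}"

definition Lp_norm :: "real \<Rightarrow> 'a::euclidean_space set \<Rightarrow> ('a \<Rightarrow> 'b::euclidean_space) \<Rightarrow> real" where
  "Lp_norm p \<Omega> f = (\<integral>x. norm (f x) powr p \<partial>lebesgue_on \<Omega>) powr (1 / p)"

definition locally_integrable :: "'a::euclidean_space set \<Rightarrow> ('a \<Rightarrow> 'b::euclidean_space) \<Rightarrow> bool" where
  "locally_integrable \<Omega> f \<longleftrightarrow> (\<forall>K. compact K \<and> K \<subseteq> \<Omega> \<longrightarrow> integrable (lebesgue_on K) f)"

text \<open>To be used for functions in \<open>L\<^sup>p\<close> of each compact subset of \<open>\<Omega>\<close>.\<close>

definition tendsto_Lp_loc ::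
  "real \<Rightarrow> 'a::euclidean_space set \<Rightarrow> ('i \<Rightarrow> 'a \<Rightarrow> real) \<Rightarrow> ('a \<Rightarrow> real) \<Rightarrow> 'i filter \<Rightarrow> bool" where
  "tendsto_Lp_loc p \<Omega> f g F \<longleftrightarrow>
     (\<forall>K. compact K \<and> K \<subseteq> \<Omega> \<longrightarrow> ((\<lambda>i. Lp_norm p K (\<lambda>x. f i x - g x)) \<longlongrightarrow> 0) F)"

section \<open>Test functions and Sobolev spaces\<close>

primrec Ck :: "nat \<Rightarrow> ('a::euclidean_space \<Rightarrow> real) \<Rightarrow> bool" where
  "Ck 0 f \<longleftrightarrow> continuous_on UNIV f"
| "Ck (Suc k) f \<longleftrightarrow> (\<forall>x. f differentiable (at x)) \<and>
                   (\<forall>b\<in>Basis. Ck k (\<lambda>x. frechet_derivative f (at x) b))"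

text \<open>\<open>C\<^sub>c\<^sup>\<infinity>(\<Omega>)\<close>, with its elements extended by zero to the whole space.\<close>

definition test_functions :: "'a::euclidean_space set \<Rightarrow> ('a \<Rightarrow> real) set" where
  "test_functions \<Omega> = {\<phi>. (\<forall>k. Ck k \<phi>) \<and> compact (closure {x. \<phi> x \<noteq> 0}) \<and> closure {x. \<phi> x \<noteq> 0} \<subseteq> \<Omega>}"

definition has_weak_grad ::
  "'a::euclidean_space set \<Rightarrow> ('a \<Rightarrow> real) \<Rightarrow> ('a \<Rightarrow> 'a) \<Rightarrow> bool" where
  "has_weak_grad \<Omega> u G \<longleftrightarrow> locally_integrable \<Omega> u \<and> locally_integrable \<Omega> G \<and>
     (\<forall>\<phi>\<in>test_functions \<Omega>. \<forall>b\<in>Basis.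
        (\<integral>x. u x * frechet_derivative \<phi> (at x) b \<partial>lebesgue_on \<Omega>) =
        - (\<integral>x. (G x \<bullet> b) * \<phi> x \<partial>lebesgue_on \<Omega>))"

text \<open>On an open set a weak gradient is unique up to null sets, so the choice of representative is harmless.\<close>

definition weak_grad :: "'a::euclidean_space set \<Rightarrow> ('a \<Rightarrow> real) \<Rightarrow> 'a \<Rightarrow> 'a" where
  "weak_grad \<Omega> u = (SOME G. has_weak_grad \<Omega> u G)"

definition W1p :: "real \<Rightarrow> 'a::euclidean_space set \<Rightarrow> ('a \<Rightarrow> real) set" where
  "W1p p \<Omega> = {u \<in> Lp_space p \<Omega>. \<exists>G \<in> Lp_space p \<Omega>. has_weak_grad \<Omega> u G}"

definition W1p_norm :: "real \<Rightarrow> 'a::euclidean_space set \<Rightarrow> ('a \<Rightarrow> real) \<Rightarrow> real" where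
  "W1p_norm p \<Omega> u = (Lp_norm p \<Omega> u powr p + Lp_norm p \<Omega> (weak_grad \<Omega> u) powr p) powr (1 / p)"

definition W1p_0 :: "real \<Rightarrow> 'a::euclidean_space set \<Rightarrow> ('a \<Rightarrow> real) set" where
  "W1p_0 p \<Omega> = {u \<in> W1p p \<Omega>. \<exists>\<phi>. (\<forall>n::nat. \<phi> n \<in> test_functions \<Omega>) \<and>
                   (\<lambda>n. W1p_norm p \<Omega> (\<lambda>x. \<phi> n x - u x)) \<longlonglongrightarrow> 0}"

text \<open>
  Linearity and the extension property are required almost everywhere, since the operator acts on
  representatives. That it respects equality almost everywhere then follows from linearity and
  boundedness.
\<close>

definition W1p_extension_domain :: "real \<Rightarrow> 'a::euclidean_space set \<Rightarrow> bool" where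
  "W1p_extension_domain p \<Omega> \<longleftrightarrow> open \<Omega> \<and>
     (\<exists>(E :: ('a \<Rightarrow> real) \<Rightarrow> ('a \<Rightarrow> real)) C.
        (\<forall>u\<in>W1p p \<Omega>. E u \<in> W1p p UNIV) \<and>
        (\<forall>u\<in>W1p p \<Omega>. \<forall>v\<in>W1p p \<Omega>. AE x in lebesgue. E (\<lambda>y. u y + v y) x = E u x + E v x) \<and>
        (\<forall>u\<in>W1p p \<Omega>. \<forall>c. AE x in lebesgue. E (\<lambda>y. c * u y) x = c * E u x) \<and>
        (\<forall>u\<in>W1p p \<Omega>. W1p_norm p UNIV (E u) \<le> C * W1p_norm p \<Omega> u) \<and>
        (\<forall>u\<in>W1p p \<Omega>. AE x in lebesgue_on \<Omega>. E u x = u x))"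

section \<open>Kernels and nonlocal forms\<close>

definition kernel_family :: "real \<Rightarrow> (real \<Rightarrow> 'a::euclidean_space \<Rightarrow> real) \<Rightarrow> bool" where
  "kernel_family p \<nu> \<longleftrightarrow>
     (\<forall>\<epsilon>>0. \<nu> \<epsilon> \<in> borel_measurable (lebesgue_on (- {0})) \<and>
        (\<forall>h. h \<noteq> 0 \<longrightarrow> \<nu> \<epsilon> h \<ge> 0) \<and>
        (\<forall>h k. h \<noteq> 0 \<and> k \<noteq> 0 \<and> norm h = norm k \<longrightarrow> \<nu> \<epsilon> h = \<nu> \<epsilon> k) \<and>
        has_bochner_integral (lebesgue_on (- {0})) (\<lambda>h. min 1 (norm h powr p) * \<nu> \<epsilon> h) 1) \<and>
     (\<forall>\<delta>>0. ((\<lambda>\<epsilon>. \<integral>h. \<nu> \<epsilon> h \<partial>lebesgue_on {h. norm h > \<delta>}) \<longlongrightarrow> 0) (at_right 0))"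

text \<open>
  For \<open>p < 2\<close> the expression \<open>\<bar>t\<bar>\<^sup>p\<^sup>-\<^sup>2 t\<close> is read as \<open>0\<close> at \<open>t = 0\<close>, in line
  with \<open>0 powr a = 0\<close>; in particular the value of \<open>\<nu>\<close> at the origin never contributes.
\<close>

definition nonlocal_integrand ::
  "real \<Rightarrow> ('a::euclidean_space \<Rightarrow> real) \<Rightarrow> ('a \<Rightarrow> real) \<Rightarrow> ('a \<Rightarrow> real) \<Rightarrow> 'a \<times> 'a \<Rightarrow> real" where
  "nonlocal_integrand p \<nu> u v =
     (\<lambda>(x, y). \<bar>u x - u y\<bar> powr (p - 2) * (u x - u y) * (v x - v y) * \<nu> (x - y))"

definition nonlocal_form ::
  "real \<Rightarrow> ('a::euclidean_space \<Rightarrow> real) \<Rightarrow> 'a set \<Rightarrow> ('a \<Rightarrow> real) \<Rightarrow> ('a \<Rightarrow> real) \<Rightarrow> real" where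
  "nonlocal_form p \<nu> \<Omega> u v = (\<integral>z. nonlocal_integrand p \<nu> u v z \<partial>lebesgue_on (\<Omega> \<times> \<Omega>))"

text \<open>
  The integrand of \<open>nonlocal_form p \<nu> \<Omega> u u\<close> is nonnegative, so finiteness of the form means
  integrability; it has to be stated so because non-integrable functions have integral zero.
\<close>

definition Wp_nonlocal :: "real \<Rightarrow> ('a::euclidean_space \<Rightarrow> real) \<Rightarrow> 'a set \<Rightarrow> ('a \<Rightarrow> real) set" where
  "Wp_nonlocal p \<nu> \<Omega> =
     {u \<in> Lp_space p \<Omega>. integrable (lebesgue_on (\<Omega> \<times> \<Omega>)) (nonlocal_integrand p \<nu> u u)}"

definition local_form ::
  "real \<Rightarrow> 'a::euclidean_space set \<Rightarrow> ('a \<Rightarrow> real) \<Rightarrow> ('a \<Rightarrow> real) \<Rightarrow> real" where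
  "local_form p \<Omega> u v =
     (\<integral>x. norm (weak_grad \<Omega> u x) powr (p - 2) * (weak_grad \<Omega> u x \<bullet> weak_grad \<Omega> v x) \<partial>lebesgue_on \<Omega>)"

section \<open>Surface measure of the unit sphere\<close>

text \<open>
  The polar-coordinates definition: \<open>\<sigma>(A)\<close> is \<open>d\<close> times the volume of the cone over \<open>A\<close> with apex \<open>0\<close>.
  For \<open>d = 1\<close> this is the counting measure on \<open>{-1, 1}\<close>.
\<close>

definition sphere_measure :: "'a::euclidean_space measure" where
  "sphere_measure = scale_measure (ennreal (real DIM('a)))
     (distr (restrict_space lborel (ball 0 1 - {0})) (restrict_space borel (sphere 0 1)) sgn)"

lemma emeasure_sphere_measure:
  fixes A :: "'a::euclidean_space set"
  assumes "A \<in> sets borel" "A \<subseteq> sphere 0 1"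
  shows "emeasure sphere_measure A =
           ennreal (real DIM('a)) * emeasure lborel {r *\<^sub>R w |r w. 0 < r \<and> r < 1 \<and> w \<in> A}"
proof -
  let ?M = "restrict_space lborel (ball (0::'a) 1 - {0})"
  let ?S = "restrict_space borel (sphere (0::'a) 1)"
  have "sgn \<in> borel_measurable ?M"
    unfolding sgn_div_norm by (rule measurable_restrict_space1) simp
  then have meas: "sgn \<in> measurable ?M ?S"
    by (intro measurable_restrict_space2)
       (auto simp: space_restrict_space norm_sgn split: if_splits)
  have A: "A \<in> sets ?S"
    using assms by (auto simp: sets_restrict_space)
  have cone: "sgn -` A \<inter> space ?M = {r *\<^sub>R w |r w. 0 < r \<and> r < 1 \<and> w \<in> A}" (is "?L = ?R")
  proof
    show "?L \<subseteq> ?R"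
    proof
      fix x assume x: "x \<in> ?L"
      then have "x = norm x *\<^sub>R sgn x" "0 < norm x" "norm x < 1" "sgn x \<in> A"
        by (auto simp: sgn_div_norm space_restrict_space)
      then show "x \<in> ?R" by blast
    qed
    show "?R \<subseteq> ?L"
    proof
      fix x assume "x \<in> ?R"
      then obtain r w where x: "x = r *\<^sub>R w" "0 < r" "r < 1" "w \<in> A" by blast
      moreover have "norm w = 1" using x assms(2) by auto
      ultimately show "x \<in> ?L"
        by (auto simp: sgn_div_norm space_restrict_space)
    qed
  qed
  have "emeasure sphere_measure A = ennreal (real DIM('a)) * emeasure ?M (sgn -` A \<inter> space ?M)"
    unfolding sphere_measure_def using emeasure_distr[OF meas A] by simp
  also have "emeasure ?M (sgn -` A \<inter> space ?M) = emeasure lborel (sgn -` A \<inter> space ?M)"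
    by (rule emeasure_restrict_space) (auto simp: space_restrict_space)
  finally show ?thesis unfolding cone .
qed

text \<open>
  \<open>K\<^bsub>d,p\<^esub>\<close>, with the basis vector \<open>e\<close> playing the role of the last coordinate direction, so that
  \<open>w \<bullet> e\<close> is \<open>w\<^sub>d\<close>.
\<close>

definition K_const :: "'a::euclidean_space \<Rightarrow> real \<Rightarrow> real" where
  "K_const e p =
     1 / measure sphere_measure (sphere (0::'a) 1) * (\<integral>w. \<bar>w \<bullet> e\<bar> powr p \<partial>sphere_measure)"

end

theory Submission
  imports Defs
begin

text \<open>
  The form is read as a pairing of increments. With \<open>h = x - y\<close> it is the integral of \<open>pflux p (u(x) - u(x - h))\<close> times
  the increment \<open>v\<^sub>\<epsilon>(x) - v\<^sub>\<epsilon>(x - h)\<close>, both points in \<open>\<Omega>\<close>, against \<open>\<nu>\<^sub>\<epsilon>(h) dh dx\<close>, where \<open>pflux p a = \<bar>a\<bar>\<^sup>p\<^sup>-\<^sup>2 a\<close>. The energy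
  bound says that these increments are bounded in \<open>L\<^sup>p\<close> of that measure. By the inequality \<open>pflux_diff_absorb\<close> the pairing
  changes little, uniformly in \<open>\<epsilon>\<close>, when its first argument changes little in \<open>L\<^sup>p\<close>, and so the increments of \<open>u\<close> may be
  replaced successively by simpler functions.
  
  Either assumption on \<open>u\<close> and \<open>\<Omega>\<close> yields a Sobolev function on the whole space that agrees with \<open>u\<close> on \<open>\<Omega>\<close>
  (\<open>whole_space_extension\<close>). Its increment differs from \<open>grad u(x) \<bullet> h\<close> by \<open>o(\<bar>h\<bar>)\<close> in \<open>L\<^sup>p\<close> (\<open>difference_quotient_Lp\<close>), and
  since the kernels concentrate at the origin the form is asymptotically the pairing with \<open>pflux p (grad u(x) \<bullet> h)\<close>. Here
  \<open>grad u\<close> is replaced by a simple function, hence the coefficient by sums of products \<open>B(x) pflux p (c \<bullet> h)\<close> with an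
  indicator \<open>B\<close>, and finally \<open>B\<close> by a test function \<open>\<psi>\<close>.
  
  For a product \<open>\<psi>(x) pflux p (c \<bullet> h)\<close> the limit is computed directly (\<open>test_pairing_near_diagonal\<close>): a translation in \<open>x\<close>
  moves the increment of \<open>v\<^sub>\<epsilon>\<close> onto \<open>\<psi>\<close>, where it becomes \<open>- grad \<psi> \<bullet> h\<close> up to \<open>o(\<bar>h\<bar>)\<close>. What remains is the moment
  \<open>\<integral> pflux p (c \<bullet> h) h \<nu>\<^sub>\<epsilon>(h) dh\<close>, taken over a small ball. By symmetry it is \<open>K\<^bsub>d,p\<^esub> pflux p c\<close> times \<open>\<integral> \<bar>h\<bar>\<^sup>p \<nu>\<^sub>\<epsilon>(h) dh\<close>, which tends
  to \<open>1\<close> (\<open>radial_flux_integral\<close>), and \<open>v\<^sub>\<epsilon>\<close> now appears undifferentiated against a fixed function with compact support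
  in \<open>\<Omega>\<close>, so that local convergence and the definition of the weak gradient of \<open>v\<close> give \<open>K\<^bsub>d,p\<^esub> \<integral> \<psi> (pflux p c \<bullet> grad v)\<close>. Undoing
  the approximations gives \<open>K\<^bsub>d,p\<^esub> \<integral> pflux p (grad u) \<bullet> grad v\<close> over \<open>\<Omega>\<close>.
\<close>

section \<open>The flux and its elementary inequalities\<close>

text \<open>The gradient of \<open>\<bar>a\<bar>\<^sup>p / p\<close>.\<close>

definition pflux :: "real \<Rightarrow> 'b::real_normed_vector \<Rightarrow> 'b" where
  "pflux p a = norm a powr (p - 2) *\<^sub>R a"

lemma pflux_zero [simp]: "pflux p 0 = 0"
  by (simp add: pflux_def)

lemma powr_mult_self: "0 \<le> (s::real) \<Longrightarrow> s powr a * s = s powr (a + 1)"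
  by (cases "s = 0") (auto simp: powr_add)

lemma norm_pflux [simp]: "norm (pflux p a) = norm a powr (p - 1)"
  using powr_mult_self[of "norm a" "p - 2"] by (simp add: pflux_def)

lemma pflux_borel_measurable [measurable]:
  fixes f :: "'c \<Rightarrow> 'b::euclidean_space"
  assumes [measurable]: "f \<in> borel_measurable M"
  shows "(\<lambda>x. pflux p (f x)) \<in> borel_measurable M"
  unfolding pflux_def by measurable

lemma small_multiple:
  fixes e m :: real
  assumes "0 < e" "0 \<le> m"
  obtains \<eta> where "0 < \<eta>" "\<eta> * m \<le> e"
proof
  show "0 < e / (m + 1)" using assms by simp
  have "e * m \<le> e * (m + 1)" using assms by simp
  then show "e / (m + 1) * m \<le> e" using assms by (simp add: divide_le_eq)
qed

lemma powr_sum_le: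
  assumes "0 \<le> (a::real)" "0 \<le> b" "0 < p"
  shows "(a + b) powr p \<le> 2 powr p * (a powr p + b powr p)"
proof -
  have "(a + b) powr p \<le> (2 * max a b) powr p"
    using assms by (intro powr_mono2) auto
  also have "\<dots> = 2 powr p * max a b powr p"
    using assms by (simp add: powr_mult)
  also have "max a b powr p \<le> a powr p + b powr p"
    by (simp add: max_def)
  finally show ?thesis by simp
qed

lemma norm_add_powr_le:
  fixes a b :: "'b::real_normed_vector"
  assumes "0 < p"
  shows "norm (a + b) powr p \<le> 2 powr p * (norm a powr p + norm b powr p)"
proof -
  have "norm (a + b) powr p \<le> (norm a + norm b) powr p"
    using assms by (intro powr_mono2 norm_triangle_ineq) auto
  also have "\<dots> \<le> 2 powr p * (norm a powr p + norm b powr p)"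
    using assms by (intro powr_sum_le) auto
  finally show ?thesis .
qed

text \<open>
  Integrated over a set of finite measure, this bounds an \<open>L\<^sup>1\<close> norm by an \<open>L\<^sup>p\<close> norm, with a remainder that is as
  small as desired.
\<close>

lemma le_scale_plus_powr:
  fixes t \<eta> p :: real
  assumes "1 < p" "0 < \<eta>" "0 \<le> t"
  shows "t \<le> \<eta> + \<eta> powr (1 - p) * t powr p"
proof (cases "t \<le> \<eta>")
  case True
  then show ?thesis by (smt (verit) powr_ge_zero mult_nonneg_nonneg)
next
  case False
  have "t = t powr (1 - p) * t powr p"
    using False assms by (simp add: powr_add[symmetric])
  also have "\<dots> \<le> \<eta> powr (1 - p) * t powr p"
    using False assms by (intro mult_right_mono powr_mono2') auto
  finally show ?thesis using assms by linarith
qed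

text \<open>
  This is Young's inequality in the form that the approximation steps need: the weight \<open>\<alpha>\<close> survives to the first
  power, so that an \<open>L\<^sup>1\<close>-small \<open>\<alpha>\<close> makes the last term small.
\<close>

lemma weighted_powr_absorb:
  fixes p \<eta> A :: real
  assumes "1 < p" "0 < \<eta>" "0 \<le> A"
  obtains D where "0 \<le> D"
    "\<And>\<alpha> s t. 0 \<le> \<alpha> \<Longrightarrow> \<alpha> \<le> A \<Longrightarrow> 0 \<le> s \<Longrightarrow> 0 \<le> t \<Longrightarrow>
       \<alpha> * s powr (p - 1) * t \<le> \<eta> * t powr p + D * \<alpha> * s powr p"
proof
  define D where "D = (A / \<eta>) powr (1 / (p - 1))"
  show "0 \<le> D" by (simp add: D_def)
  fix \<alpha> s t :: real
  assume *: "0 \<le> \<alpha>" "\<alpha> \<le> A" "0 \<le> s" "0 \<le> t"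
  show "\<alpha> * s powr (p - 1) * t \<le> \<eta> * t powr p + D * \<alpha> * s powr p"
  proof (cases "\<alpha> * s powr (p - 1) \<le> \<eta> * t powr (p - 1)")
    case True
    then have "\<alpha> * s powr (p - 1) * t \<le> \<eta> * t powr (p - 1) * t"
      using * by (intro mult_right_mono) auto
    also have "\<dots> = \<eta> * t powr p"
      using powr_mult_self[of t "p - 1"] * by simp
    finally show ?thesis
      using * \<open>0 \<le> D\<close> by (smt (verit) powr_ge_zero mult_nonneg_nonneg)
  next
    case False
    have "\<eta> * t powr (p - 1) \<le> A * s powr (p - 1)"
      using False * by (smt (verit) mult_right_mono powr_ge_zero)
    then have "t powr (p - 1) \<le> A / \<eta> * s powr (p - 1)"
      using assms by (simp add: field_simps)
    then have "(t powr (p - 1)) powr (1 / (p - 1)) \<le> (A / \<eta> * s powr (p - 1)) powr (1 / (p - 1))"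
      using assms by (intro powr_mono2) auto
    also have "(t powr (p - 1)) powr (1 / (p - 1)) = t"
      using assms * by (simp add: powr_powr)
    also have "(A / \<eta> * s powr (p - 1)) powr (1 / (p - 1)) = D * s"
      using assms * by (subst powr_mult) (auto simp: powr_powr D_def)
    finally have "t \<le> D * s" .
    then have "\<alpha> * s powr (p - 1) * t \<le> \<alpha> * s powr (p - 1) * (D * s)"
      using * by (intro mult_left_mono) auto
    also have "\<dots> = D * \<alpha> * (s powr (p - 1) * s)" by simp
    also have "\<dots> = D * \<alpha> * s powr p"
      using powr_mult_self[of s "p - 1"] * by simp
    finally show ?thesis using assms by (smt (verit) powr_ge_zero mult_nonneg_nonneg)
  qed
qed

text \<open>By homogeneity this only expresses continuity of \<open>s \<mapsto> s\<^sup>p\<^sup>-\<^sup>2\<close> at \<open>1\<close>.\<close>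

lemma pflux_relative_continuity:
  fixes p \<eta> :: real
  assumes "0 < \<eta>"
  obtains \<tau> where "0 < \<tau>"
    "\<And>a b :: 'b::real_normed_vector. norm (a - b) \<le> \<tau> * norm b \<Longrightarrow>
       norm (pflux p a - pflux p b) \<le> \<eta> * norm b powr (p - 1)"
proof -
  have "continuous (at (1::real)) (\<lambda>s. s powr (p - 2))"
    by (intro continuous_intros) auto
  then obtain d where d: "d > 0" "\<And>s. dist s 1 < d \<Longrightarrow> dist (s powr (p - 2)) 1 < \<eta> / 4"
    using assms unfolding continuous_at_eps_delta
    by (metis divide_pos_pos powr_one_eq_one zero_less_numeral)
  define \<tau> where "\<tau> = Min {d / 2, 1 / 2, \<eta> / 4}"
  have \<tau>: "0 < \<tau>" "\<tau> < d" "\<tau> \<le> 1 / 2" "\<tau> \<le> \<eta> / 4"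
    using assms d(1) by (auto simp: \<tau>_def)
  show thesis
  proof
    show "0 < \<tau>" by (fact \<tau>)
    fix a b :: 'b
    assume ab: "norm (a - b) \<le> \<tau> * norm b"
    show "norm (pflux p a - pflux p b) \<le> \<eta> * norm b powr (p - 1)"
    proof (cases "b = 0")
      case True
      then show ?thesis using ab by simp
    next
      case False
      define \<beta> where "\<beta> = norm b"
      define s where "s = norm a / \<beta>"
      have \<beta>: "\<beta> > 0" using False by (simp add: \<beta>_def)
      have "\<bar>norm a - \<beta>\<bar> \<le> \<tau> * \<beta>"
        using ab norm_triangle_ineq3[of a b] by (simp add: \<beta>_def)
      then have s1: "\<bar>s - 1\<bar> \<le> \<tau>"
        using \<beta> by (simp add: s_def field_simps abs_le_iff)
      then have "dist s 1 < d" using \<tau> by (simp add: dist_real_def)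
      from d(2)[OF this] have sp: "\<bar>s powr (p - 2) - 1\<bar> \<le> \<eta> / 4"
        by (simp add: dist_real_def)
      have na: "norm a = \<beta> * s" using \<beta> by (simp add: s_def)
      have s0: "0 \<le> s" using \<beta> by (simp add: s_def)
      have pa: "norm a powr (p - 2) = \<beta> powr (p - 2) * s powr (p - 2)"
        using na \<beta> s0 by (simp add: powr_mult)
      have "pflux p a - pflux p b = \<beta> powr (p - 2) *\<^sub>R ((s powr (p - 2) - 1) *\<^sub>R a + (a - b))"
        unfolding pflux_def pa by (simp add: \<beta>_def algebra_simps)
      then have "norm (pflux p a - pflux p b) = \<beta> powr (p - 2) * norm ((s powr (p - 2) - 1) *\<^sub>R a + (a - b))"
        by simp
      also have "\<dots> \<le> \<beta> powr (p - 2) * (\<eta> / 4 * (3 / 2 * \<beta>) + \<eta> / 4 * \<beta>)"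
      proof (intro mult_left_mono order_trans[OF norm_triangle_ineq] add_mono)
        have "s * \<beta> \<le> 3 / 2 * \<beta>" using s1 \<tau> \<beta> by (intro mult_right_mono) auto
        then have "norm a \<le> 3 / 2 * \<beta>" by (simp add: na mult_ac)
        then show "norm ((s powr (p - 2) - 1) *\<^sub>R a) \<le> \<eta> / 4 * (3 / 2 * \<beta>)"
          using sp assms \<beta> unfolding norm_scaleR by (intro mult_mono) auto
        have "\<tau> * \<beta> \<le> \<eta> / 4 * \<beta>" using \<tau> \<beta> by (intro mult_right_mono) auto
        with ab show "norm (a - b) \<le> \<eta> / 4 * \<beta>" by (simp add: \<beta>_def)
      qed auto
      also have "\<dots> \<le> \<eta> * (\<beta> powr (p - 2) * \<beta>)"
        using assms \<beta> by (simp add: algebra_simps)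
      also have "\<dots> = \<eta> * norm b powr (p - 1)"
        using powr_mult_self[of \<beta> "p - 2"] \<beta> by (simp add: \<beta>_def)
      finally show ?thesis .
    qed
  qed
qed

text \<open>
  All comparisons of forms rest on this inequality. If \<open>a\<close> is close to \<open>b\<close> relative to \<open>b\<close>, the first
  term on the right wins; otherwise \<open>a\<close> and \<open>b\<close> are both controlled by \<open>a - b\<close>.
\<close>

lemma pflux_diff_absorb:
  fixes p \<eta> :: real
  assumes "1 < p" "0 < \<eta>"
  obtains C where "0 \<le> C"
    "\<And>(a::'b::real_normed_vector) b t. 0 \<le> t \<Longrightarrow>
       norm (pflux p a - pflux p b) * t \<le> \<eta> * (t powr p + norm b powr p) + C * norm (a - b) powr p"
proof -
  obtain \<tau> where \<tau>: "0 < \<tau>" "\<And>a b :: 'b. norm (a - b) \<le> \<tau> * norm b \<Longrightarrow>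
       norm (pflux p a - pflux p b) \<le> \<eta> * norm b powr (p - 1)"
    by (rule pflux_relative_continuity[OF assms(2)]) blast
  define A where "A = (1 + 1 / \<tau>) powr (p - 1) + (1 / \<tau>) powr (p - 1)"
  have A: "0 \<le> A" by (simp add: A_def)
  obtain D where D: "0 \<le> D" "\<And>\<alpha> s t. 0 \<le> \<alpha> \<Longrightarrow> \<alpha> \<le> A \<Longrightarrow> 0 \<le> s \<Longrightarrow> 0 \<le> t \<Longrightarrow>
       \<alpha> * s powr (p - 1) * t \<le> \<eta> * t powr p + D * \<alpha> * s powr p"
    by (rule weighted_powr_absorb[OF assms A]) blast
  show thesis
  proof
    show "0 \<le> D * A" using D A by simp
    fix a b :: 'b and t :: real
    assume t: "0 \<le> t"
    show "norm (pflux p a - pflux p b) * t \<le> \<eta> * (t powr p + norm b powr p) + D * A * norm (a - b) powr p"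
    proof (cases "norm (a - b) \<le> \<tau> * norm b")
      case True
      have "norm (pflux p a - pflux p b) * t \<le> \<eta> * (norm b powr (p - 1) * t)"
        using mult_right_mono[OF \<tau>(2)[OF True] t] by simp
      also have "norm b powr (p - 1) * t \<le> max (norm b) t powr (p - 1) * max (norm b) t"
        using t assms by (intro mult_mono powr_mono2) auto
      also have "\<dots> = max (norm b) t powr p"
        using powr_mult_self[of "max (norm b) t" "p - 1"] t by simp
      also have "\<dots> \<le> t powr p + norm b powr p" by (simp add: max_def)
      finally show ?thesis
        using assms D A by (smt (verit) mult_nonneg_nonneg powr_ge_zero mult_left_mono)
    next
      case False
      define d where "d = norm (a - b)"
      have d0: "0 \<le> d" by (simp add: d_def)
      have nb: "norm b \<le> 1 / \<tau> * d" using False \<tau>(1) by (simp add: d_def field_simps)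
      have "norm a \<le> d + norm b" unfolding d_def using norm_triangle_sub[of a b] by simp
      then have na: "norm a \<le> (1 + 1 / \<tau>) * d" using nb by (simp add: algebra_simps)
      have "norm (pflux p a - pflux p b) \<le> norm a powr (p - 1) + norm b powr (p - 1)"
        using norm_triangle_ineq4[of "pflux p a" "pflux p b"] by simp
      also have "\<dots> \<le> ((1 + 1 / \<tau>) * d) powr (p - 1) + (1 / \<tau> * d) powr (p - 1)"
        using na nb assms by (intro add_mono powr_mono2) auto
      also have "\<dots> = A * d powr (p - 1)"
        using \<tau>(1) d0 by (subst (1 2) powr_mult) (auto simp: A_def algebra_simps)
      finally have "norm (pflux p a - pflux p b) * t \<le> A * d powr (p - 1) * t"
        by (rule mult_right_mono) (fact t)
      also have "\<dots> \<le> \<eta> * t powr p + D * A * d powr p"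
        using D(2)[of A d t] A d0 t by simp
      finally show ?thesis
        using assms by (smt (verit) d_def mult_left_mono powr_ge_zero)
    qed
  qed
qed

section \<open>Smooth functions\<close>

lemma Ck_Suc_imp_Ck: "Ck (Suc k) f \<Longrightarrow> Ck k f"
proof (induction k arbitrary: f)
  case 0
  then show ?case
    by (auto intro!: continuous_at_imp_continuous_on differentiable_imp_continuous_within)
next
  case (Suc k)
  then show ?case by (metis Ck.simps(2))
qed

lemma Ck_SucI:
  assumes "\<And>x. (f has_derivative f' x) (at x)" "\<And>b. b \<in> Basis \<Longrightarrow> Ck k (\<lambda>x. f' x b)"
  shows "Ck (Suc k) f"
proof -
  have "frechet_derivative f (at x) = f' x" for x
    using frechet_derivative_at[OF assms(1)] by simp
  then show ?thesis using assms by (auto simp: differentiable_def)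
qed

lemma Ck_SucD:
  assumes "Ck (Suc k) f"
  shows "(f has_derivative frechet_derivative f (at x)) (at x)"
    and "b \<in> Basis \<Longrightarrow> Ck k (\<lambda>x. frechet_derivative f (at x) b)"
  using assms by (auto simp: frechet_derivative_works)

lemma Ck_const [simp]: "Ck k (\<lambda>x. c)"
proof (induction k arbitrary: c)
  case (Suc k)
  show ?case by (rule Ck_SucI[where f' = "\<lambda>_ _. 0"]) (auto intro: Suc)
qed simp

lemma Ck_inner_const [simp]: "Ck k (\<lambda>x. x \<bullet> a)"
proof (cases k)
  case (Suc j)
  show ?thesis unfolding Suc
    by (rule Ck_SucI[where f' = "\<lambda>x h. h \<bullet> a"]) (auto intro!: derivative_eq_intros)
qed (auto intro!: continuous_intros)

lemma Ck_add: "Ck k f \<Longrightarrow> Ck k g \<Longrightarrow> Ck k (\<lambda>x. f x + g x)"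
proof (induction k arbitrary: f g)
  case (Suc k)
  show ?case
    by (rule Ck_SucI[OF has_derivative_add[OF Ck_SucD(1)[OF Suc.prems(1)] Ck_SucD(1)[OF Suc.prems(2)]]])
       (rule Suc.IH[OF Ck_SucD(2)[OF Suc.prems(1)] Ck_SucD(2)[OF Suc.prems(2)]])
qed (simp add: continuous_on_add)

lemma Ck_mult: "Ck k f \<Longrightarrow> Ck k g \<Longrightarrow> Ck k (\<lambda>x. f x * g x)"
proof (induction k arbitrary: f g)
  case (Suc k)
  show ?case
    by (rule Ck_SucI[OF has_derivative_mult[OF Ck_SucD(1)[OF Suc.prems(1)] Ck_SucD(1)[OF Suc.prems(2)]]])
       (rule Ck_add; rule Suc.IH; rule Ck_SucD(2)[OF Suc.prems(1)] Ck_SucD(2)[OF Suc.prems(2)]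
          Ck_Suc_imp_Ck[OF Suc.prems(1)] Ck_Suc_imp_Ck[OF Suc.prems(2)]; assumption)
qed (simp add: continuous_on_mult)

lemma Ck_sum: "(\<And>i. i \<in> I \<Longrightarrow> Ck k (f i)) \<Longrightarrow> Ck k (\<lambda>x. \<Sum>i\<in>I. f i x)"
  by (induction I rule: infinite_finite_induct) (auto intro: Ck_add)

lemma Ck_translate: "Ck k f \<Longrightarrow> Ck k (\<lambda>x. f (x + a))"
proof (induction k arbitrary: f)
  case 0
  then show ?case by (auto intro!: continuous_intros elim: continuous_on_compose2)
next
  case (Suc k)
  have "((\<lambda>x. f (x + a)) has_derivative frechet_derivative f (at (x + a))) (at x)" for x
  proof -
    have "((\<lambda>x. x + a) has_derivative (\<lambda>h. h)) (at x)" by (auto intro!: derivative_eq_intros)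
    from has_derivative_compose[OF this Ck_SucD(1)[OF Suc.prems]] show ?thesis by simp
  qed
  then show ?case
    by (rule Ck_SucI) (rule Suc.IH, rule Ck_SucD(2)[OF Suc.prems])
qed

text \<open>
  The whole sequence of derivatives is required at once, because the induction that proves the chain rule for \<open>Ck\<close>
  passes from one derivative of the outer function to the next.
\<close>

definition smooth_real :: "(real \<Rightarrow> real) \<Rightarrow> bool" where
  "smooth_real g \<longleftrightarrow> (\<exists>D. D 0 = g \<and> (\<forall>n x. (D n has_real_derivative D (Suc n) x) (at x)))"

lemma Ck_compose_smooth:
  assumes "smooth_real g" "Ck k f"
  shows "Ck k (\<lambda>x. g (f x))"
proof -
  obtain D where D: "D 0 = g" "\<And>n x. (D n has_real_derivative D (Suc n) x) (at x)"
    using assms(1) unfolding smooth_real_def by blast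
  have "Ck k f \<Longrightarrow> Ck k (\<lambda>x. D n (f x))" for n k
  proof (induction k arbitrary: n)
    case 0
    have "continuous_on UNIV (D n)"
      using D(2) by (meson DERIV_continuous_on)
    then show ?case using 0 by (auto intro: continuous_on_compose2)
  next
    case (Suc k)
    have "((\<lambda>x. D n (f x)) has_derivative (\<lambda>h. D (Suc n) (f x) * frechet_derivative f (at x) h)) (at x)" for x
    proof -
      have "(D n has_derivative (\<lambda>y. D (Suc n) (f x) * y)) (at (f x))"
        using D(2) by (simp add: has_field_derivative_def)
      from has_derivative_compose[OF Ck_SucD(1)[OF Suc.prems] this] show ?thesis by simp
    qed
    then show ?case
      by (rule Ck_SucI)
         (rule Ck_mult[OF Suc.IH[OF Ck_Suc_imp_Ck[OF Suc.prems]] Ck_SucD(2)[OF Suc.prems]])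
  qed
  from this[OF assms(2), of 0] show ?thesis by (simp add: D(1))
qed

lemma smooth_realI:
  fixes D :: "nat \<Rightarrow> real \<Rightarrow> real"
  shows "(\<And>n x. (D n has_real_derivative D (Suc n) x) (at x)) \<Longrightarrow> smooth_real (D 0)"
  unfolding smooth_real_def by blast

lemma smooth_real_one_minus_exp: "smooth_real (\<lambda>x. 1 - exp (- x))"
proof -
  define D where "D n = (case n of 0 \<Rightarrow> \<lambda>x::real. 1 - exp (- x) | Suc m \<Rightarrow> \<lambda>x. (- 1) ^ m * exp (- x))"
    for n
  have "(D n has_real_derivative D (Suc n) x) (at x)" for n x
    by (cases n) (auto simp: D_def intro!: derivative_eq_intros)
  from smooth_realI[of D, OF this] show ?thesis by (simp add: D_def)
qed

text \<open>
  The function \<open>exp (-1 / t)\<close>, extended by zero to \<open>t \<le> 0\<close>, and all its derivatives have this form for suitable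
  polynomials \<open>P\<close>.
\<close>

definition flat_bump :: "real poly \<Rightarrow> real \<Rightarrow> real" where
  "flat_bump P t = (if t > 0 then poly P (1 / t) * exp (- (1 / t)) else 0)"

lemma poly_times_exp_minus_tendsto_0: "((\<lambda>s. poly P s * exp (- s)) \<longlongrightarrow> 0) at_top" for P :: "real poly"
proof -
  have "((\<lambda>s. \<Sum>i\<le>degree P. coeff P i * (s ^ i / exp s)) \<longlongrightarrow> (\<Sum>i\<le>degree P. coeff P i * 0)) at_top"
    by (intro tendsto_sum tendsto_mult tendsto_const tendsto_power_div_exp_0)
  then show ?thesis
    by (simp add: poly_altdef sum_distrib_right exp_minus divide_inverse mult.assoc)
qed

lemma flat_bump_tendsto_0: "(flat_bump P \<longlongrightarrow> 0) (at 0)"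
proof (rule filterlim_split_at)
  have "eventually (\<lambda>t. flat_bump P t = 0) (at_left 0)"
    by (auto simp: eventually_at_left_field flat_bump_def intro: exI[of _ "-1"])
  then show "(flat_bump P \<longlongrightarrow> 0) (at_left 0)"
    by (simp add: tendsto_eventually)
  have "((\<lambda>t. poly P (inverse t) * exp (- (inverse t))) \<longlongrightarrow> 0) (at_right 0)"
    by (rule filterlim_compose[OF poly_times_exp_minus_tendsto_0 filterlim_inverse_at_top_right])
  moreover have "eventually (\<lambda>t. poly P (inverse t) * exp (- (inverse t)) = flat_bump P t) (at_right 0)"
    by (auto simp: eventually_at_right_field flat_bump_def inverse_eq_divide intro: exI[of _ 1])
  ultimately show "(flat_bump P \<longlongrightarrow> 0) (at_right 0)"
    by (rule Lim_transform_eventually)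
qed

lemma flat_bump_has_derivative:
  "(flat_bump P has_real_derivative flat_bump ([:0, 0, 1:] * (P - pderiv P)) t) (at t)"
proof -
  consider "t < 0" | "t = 0" | "t > 0" by linarith
  then show ?thesis
  proof cases
    case 1
    have "((\<lambda>t. 0) has_real_derivative 0) (at t)" by simp
    moreover have "eventually (\<lambda>s. 0 = flat_bump P s) (nhds t)"
      using 1 eventually_nhds_in_open[of "{..<0}" t]
      by (auto simp: flat_bump_def elim: eventually_mono)
    ultimately have "(flat_bump P has_real_derivative 0) (at t)"
      using DERIV_cong_ev by fastforce
    then show ?thesis using 1 by (simp add: flat_bump_def)
  next
    case 2
    have "flat_bump P s / s = flat_bump ([:0, 1:] * P) s" for s
      by (simp add: flat_bump_def)
    then have "((\<lambda>s. (flat_bump P s - flat_bump P 0) / (s - 0)) \<longlongrightarrow> 0) (at 0)"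
      using flat_bump_tendsto_0[of "[:0, 1:] * P"] by (simp add: flat_bump_def[of P 0])
    then have "(flat_bump P has_real_derivative 0) (at 0)"
      by (simp add: has_field_derivative_iff)
    then show ?thesis using 2 by (simp add: flat_bump_def)
  next
    case 3
    have d: "((\<lambda>t. poly P (1 / t) * exp (- (1 / t))) has_real_derivative
           flat_bump ([:0, 0, 1:] * (P - pderiv P)) t) (at t)"
      using 3 by (auto intro!: derivative_eq_intros DERIV_chain2[OF poly_DERIV]
          simp: flat_bump_def power2_eq_square algebra_simps)
    have ev: "eventually (\<lambda>s. poly P (1 / s) * exp (- (1 / s)) = flat_bump P s) (nhds t)"
      using 3 eventually_nhds_in_open[of "{0<..}" t]
      by (auto simp: flat_bump_def elim: eventually_mono)
    show ?thesis by (rule iffD1[OF DERIV_cong_ev[OF refl ev refl] d])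
  qed
qed

lemma smooth_real_flat_bump: "smooth_real (flat_bump P)"
proof -
  define Q where "Q n = ((\<lambda>Q. [:0, 0, 1:] * (Q - pderiv Q)) ^^ n) P" for n
  have "Q (Suc n) = [:0, 0, 1:] * (Q n - pderiv (Q n))" for n
    by (simp only: Q_def funpow.simps o_apply)
  then have "(flat_bump (Q n) has_real_derivative flat_bump (Q (Suc n)) x) (at x)" for n x
    using flat_bump_has_derivative by metis
  from smooth_realI[of "\<lambda>n. flat_bump (Q n)", OF this] show ?thesis
    by (simp add: Q_def)
qed

section \<open>Test functions\<close>

definition tgrad :: "('a::euclidean_space \<Rightarrow> real) \<Rightarrow> 'a \<Rightarrow> 'a" where
  "tgrad \<psi> x = (\<Sum>b\<in>Basis. frechet_derivative \<psi> (at x) b *\<^sub>R b)"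

definition csupp :: "('a::euclidean_space \<Rightarrow> real) \<Rightarrow> 'a set" where
  "csupp \<psi> = closure {x. \<psi> x \<noteq> 0}"

lemma test_function_Ck: "\<psi> \<in> test_functions \<Omega> \<Longrightarrow> Ck k \<psi>"
  and compact_csupp: "\<psi> \<in> test_functions \<Omega> \<Longrightarrow> compact (csupp \<psi>)"
  and csupp_subset: "\<psi> \<in> test_functions \<Omega> \<Longrightarrow> csupp \<psi> \<subseteq> \<Omega>"
  by (auto simp: test_functions_def csupp_def)

lemma zero_outside_csupp: "x \<notin> csupp \<psi> \<Longrightarrow> \<psi> x = 0"
  unfolding csupp_def using closure_subset[of "{x. \<psi> x \<noteq> 0}"] by auto

lemma test_functions_mono: "\<psi> \<in> test_functions \<Omega> \<Longrightarrow> \<Omega> \<subseteq> \<Omega>' \<Longrightarrow> \<psi> \<in> test_functions \<Omega>'"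
  by (auto simp: test_functions_def)

lemma test_function_has_derivative:
  assumes "\<psi> \<in> test_functions \<Omega>"
  shows "(\<psi> has_derivative (\<lambda>h. tgrad \<psi> x \<bullet> h)) (at x)"
proof -
  note * = Ck_SucD(1)[OF test_function_Ck[OF assms, of "Suc 0"], of x]
  then interpret bounded_linear "frechet_derivative \<psi> (at x)" by (rule has_derivative_bounded_linear)
  have "frechet_derivative \<psi> (at x) h = tgrad \<psi> x \<bullet> h" for h
  proof -
    have "frechet_derivative \<psi> (at x) (\<Sum>b\<in>Basis. (h \<bullet> b) *\<^sub>R b) =
          (\<Sum>b\<in>Basis. (h \<bullet> b) * frechet_derivative \<psi> (at x) b)"
      by (simp add: sum scaleR)
    then have "frechet_derivative \<psi> (at x) h = (\<Sum>b\<in>Basis. (h \<bullet> b) * frechet_derivative \<psi> (at x) b)"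
      by (simp only: euclidean_representation)
    then show ?thesis
      unfolding tgrad_def inner_sum_left inner_scaleR_left by (simp add: inner_commute mult.commute)
  qed
  then have "frechet_derivative \<psi> (at x) = (\<lambda>h. tgrad \<psi> x \<bullet> h)" by (rule ext)
  with * show ?thesis by simp
qed

lemma frechet_derivative_test_function:
  assumes "\<psi> \<in> test_functions \<Omega>"
  shows "frechet_derivative \<psi> (at x) h = tgrad \<psi> x \<bullet> h"
  using frechet_derivative_at[OF test_function_has_derivative[OF assms], of x] by metis

lemma continuous_on_test_function: "\<psi> \<in> test_functions \<Omega> \<Longrightarrow> continuous_on UNIV \<psi>"
  using test_function_Ck[of \<psi> \<Omega> 0] by simp

lemma continuous_on_tgrad: "\<psi> \<in> test_functions \<Omega> \<Longrightarrow> continuous_on UNIV (tgrad \<psi>)"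
  unfolding tgrad_def[abs_def] using test_function_Ck[of \<psi> \<Omega> "Suc 0"]
  by (intro continuous_intros) auto

lemma gradient_zero_outside_support:
  assumes "(\<psi> has_derivative (\<lambda>h. g \<bullet> h)) (at (x::'a::euclidean_space))"
    and "closed S" "\<And>y. y \<notin> S \<Longrightarrow> \<psi> y = (0::real)" "x \<notin> S"
  shows "g = 0"
proof -
  have "((\<lambda>_. 0::real) has_derivative (\<lambda>h. g \<bullet> h)) (at x)"
    by (rule has_derivative_transform_within_open[OF assms(1), of "- S"]) (use assms in auto)
  then have "(\<lambda>h. g \<bullet> h) = (\<lambda>h. 0)"
    using has_derivative_unique[OF _ has_derivative_const] by blast
  then show ?thesis by (metis inner_eq_zero_iff)
qed

lemma tgrad_zero_outside_csupp:
  assumes "\<psi> \<in> test_functions \<Omega>" "x \<notin> csupp \<psi>"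
  shows "tgrad \<psi> x = 0"
  by (rule gradient_zero_outside_support[OF test_function_has_derivative[OF assms(1)] _ _ assms(2)])
     (auto simp: csupp_def intro: zero_outside_csupp[unfolded csupp_def])

lemma test_function_translate:
  assumes "\<psi> \<in> test_functions UNIV"
  shows "(\<lambda>x. \<psi> (x + a)) \<in> test_functions UNIV" and "tgrad (\<lambda>x. \<psi> (x + a)) x = tgrad \<psi> (x + a)"
proof -
  have "{x. \<psi> (x + a) \<noteq> 0} = (\<lambda>x. - a + x) ` {x. \<psi> x \<noteq> 0}"
    by (auto simp: image_iff) (metis add.commute add_diff_cancel uminus_add_conv_diff)
  then have "closure {x. \<psi> (x + a) \<noteq> 0} = (\<lambda>x. - a + x) ` csupp \<psi>"
    by (simp only: closure_translation csupp_def)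
  then show *: "(\<lambda>x. \<psi> (x + a)) \<in> test_functions UNIV"
    using compact_translation[OF compact_csupp[OF assms]] Ck_translate[OF test_function_Ck[OF assms]]
    unfolding test_functions_def mem_Collect_eq by (metis subset_UNIV)
  have "((\<lambda>x. x + a) has_derivative (\<lambda>h. h)) (at x)" by (auto intro!: derivative_eq_intros)
  from has_derivative_compose[OF this test_function_has_derivative[OF assms]]
  have "((\<lambda>x. \<psi> (x + a)) has_derivative (\<lambda>h. tgrad \<psi> (x + a) \<bullet> h)) (at x)" .
  from has_derivative_unique[OF this test_function_has_derivative[OF *]]
  have "tgrad \<psi> (x + a) \<bullet> h = tgrad (\<lambda>x. \<psi> (x + a)) x \<bullet> h" for h by meson
  then show "tgrad (\<lambda>x. \<psi> (x + a)) x = tgrad \<psi> (x + a)"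
    by (metis vector_eq_rdot)
qed

subsection \<open>Compactly supported functions of class \<open>C\<^sup>1\<close>\<close>

definition unit_nbhd :: "'a::euclidean_space set \<Rightarrow> 'a set" where
  "unit_nbhd S = {x + y |x y. x \<in> S \<and> y \<in> cball 0 1}"

lemma compact_unit_nbhd: "compact S \<Longrightarrow> compact (unit_nbhd S)"
  unfolding unit_nbhd_def by (rule compact_sums) auto

lemma unit_nbhdI: "x + h \<in> S \<Longrightarrow> norm h \<le> 1 \<Longrightarrow> x \<in> unit_nbhd S"
  unfolding unit_nbhd_def by (rule CollectI, rule exI[of _ "x + h"], rule exI[of _ "- h"]) auto

lemma uniform_continuity_of_compact_support:
  fixes g :: "'a::euclidean_space \<Rightarrow> 'b::real_normed_vector"
  assumes "continuous_on UNIV g" "compact S" "\<And>x. x \<notin> S \<Longrightarrow> g x = 0" "0 < \<eta>"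
  obtains \<delta> where "0 < \<delta>" "\<delta> \<le> 1" "\<And>x h. norm h \<le> \<delta> \<Longrightarrow> norm (g (x + h) - g x) \<le> \<eta>"
proof -
  let ?K = "unit_nbhd S"
  have "uniformly_continuous_on ?K g"
    by (rule compact_uniformly_continuous[OF continuous_on_subset[OF assms(1)] compact_unit_nbhd[OF assms(2)]]) simp
  then obtain d where d: "d > 0" "\<And>x y. x \<in> ?K \<Longrightarrow> y \<in> ?K \<Longrightarrow> dist y x < d \<Longrightarrow> dist (g y) (g x) < \<eta>"
    using \<open>0 < \<eta>\<close> unfolding uniformly_continuous_on_def by meson
  show thesis
  proof
    show "0 < min (d / 2) 1" "min (d / 2) 1 \<le> 1" using d by auto
    fix x h :: 'a
    assume h: "norm h \<le> min (d / 2) 1"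
    show "norm (g (x + h) - g x) \<le> \<eta>"
    proof (cases "x \<in> S \<or> x + h \<in> S")
      case True
      have "x \<in> ?K" "x + h \<in> ?K"
        using True h unit_nbhdI[of x 0 S] unit_nbhdI[of x h S] unit_nbhdI[of "x + h" 0 S]
          unit_nbhdI[of "x + h" "- h" S] by auto
      from d(2)[OF this] h d(1) show ?thesis by (auto simp: dist_norm less_imp_le)
    next
      case False
      then show ?thesis using assms by auto
    qed
  qed
qed

text \<open>
  The error is supported in one compact set for all small \<open>h\<close>, so that it can be integrated against functions that
  are only locally integrable.
\<close>

lemma uniform_first_order_expansion:
  fixes f :: "'a::euclidean_space \<Rightarrow> real"
  assumes f: "\<And>x. (f has_derivative (\<lambda>h. g x \<bullet> h)) (at x)"
    and g: "continuous_on UNIV g" and S: "compact S" "\<And>x. x \<notin> S \<Longrightarrow> f x = 0" and "0 < \<eta>"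
  obtains \<delta> where "0 < \<delta>" "\<delta> \<le> 1"
    "\<And>x h. norm h \<le> \<delta> \<Longrightarrow> \<bar>f (x + h) - f x - g x \<bullet> h\<bar> \<le> \<eta> * norm h * indicator (unit_nbhd S) x"
proof -
  have g0: "x \<notin> S \<Longrightarrow> g x = 0" for x
    using gradient_zero_outside_support[OF f compact_imp_closed[OF S(1)] S(2)] by blast
  obtain \<delta> where \<delta>: "0 < \<delta>" "\<delta> \<le> 1" "\<And>x h. norm h \<le> \<delta> \<Longrightarrow> norm (g (x + h) - g x) \<le> \<eta>"
    using uniform_continuity_of_compact_support[OF g S(1) g0 \<open>0 < \<eta>\<close>] by blast
  show thesis
  proof
    show "0 < \<delta>" "\<delta> \<le> 1" by (fact \<delta>)+
    fix x h :: 'a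
    assume h: "norm h \<le> \<delta>"
    show "\<bar>f (x + h) - f x - g x \<bullet> h\<bar> \<le> \<eta> * norm h * indicator (unit_nbhd S) x"
    proof (cases "x \<in> unit_nbhd S")
      case False
      then have "x \<notin> S" "x + h \<notin> S"
        using unit_nbhdI[of x 0 S] unit_nbhdI[of x h S] h \<delta> by auto
      then show ?thesis using S g0 False by auto
    next
      case True
      have "((\<lambda>t. f (x + t *\<^sub>R h)) has_derivative (\<lambda>s. s * (g (x + t *\<^sub>R h) \<bullet> h))) (at t within {0..1})" for t :: real
      proof -
        have "((\<lambda>t. x + t *\<^sub>R h) has_derivative (\<lambda>s. s *\<^sub>R h)) (at t within {0..1})"
          by (auto intro!: derivative_eq_intros)
        from has_derivative_compose[OF this f] show ?thesis by simp
      qed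
      then have "\<exists>s\<in>{0<..<1::real}. f (x + 1 *\<^sub>R h) - f (x + 0 *\<^sub>R h) = (1 - 0) * (g (x + s *\<^sub>R h) \<bullet> h)"
        by (intro mvt_simple) auto
      then obtain s where s: "0 < s" "s < 1" "f (x + h) - f x = g (x + s *\<^sub>R h) \<bullet> h" by auto
      have "\<bar>f (x + h) - f x - g x \<bullet> h\<bar> = \<bar>(g (x + s *\<^sub>R h) - g x) \<bullet> h\<bar>"
        by (simp add: s inner_diff_left)
      also have "\<dots> \<le> norm (g (x + s *\<^sub>R h) - g x) * norm h"
        by (rule Cauchy_Schwarz_ineq2)
      also have "\<dots> \<le> \<eta> * norm h"
        using s h by (intro mult_right_mono \<delta>(3)) (auto intro: order_trans[OF mult_left_le_one_le])
      finally show ?thesis using True by simp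
    qed
  qed
qed

lemma compact_support_integrable:
  fixes f :: "'a::euclidean_space \<Rightarrow> 'b::euclidean_space"
  assumes "continuous_on UNIV f" "compact S" "\<And>x. x \<notin> S \<Longrightarrow> f x = 0"
  shows "integrable lborel f"
proof -
  have "integrable lborel (\<lambda>x. indicator S x *\<^sub>R f x)"
    using borel_integrable_compact[OF assms(2) continuous_on_subset[OF assms(1)]] by simp
  also have "(\<lambda>x. indicator S x *\<^sub>R f x) = f"
    using assms(3) by (auto simp: indicator_def)
  finally show ?thesis .
qed

lemma compact_support_bounded:
  fixes f :: "'a::euclidean_space \<Rightarrow> 'b::euclidean_space"
  assumes "continuous_on UNIV f" "compact S" "\<And>x. x \<notin> S \<Longrightarrow> f x = 0"
  obtains B where "0 < B" "\<And>x. norm (f x) \<le> B"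
proof -
  have "bounded (f ` S)"
    using assms by (meson compact_continuous_image compact_imp_bounded continuous_on_subset top_greatest)
  then obtain B where "0 < B" "\<And>x. x \<in> S \<Longrightarrow> norm (f x) \<le> B"
    unfolding bounded_pos by auto
  then show thesis using that[of B] assms(3) by (metis less_imp_le norm_zero)
qed

lemma integrable_indicator_compact:
  fixes K :: "'a::euclidean_space set"
  assumes "compact K"
  shows "integrable lborel (indicator K :: 'a \<Rightarrow> real)"
  using assms emeasure_bounded_finite[OF compact_imp_bounded[OF assms]]
  by (intro integrable_real_indicator) (auto simp: borel_compact)

lemma lborel_integral_translate:
  fixes f :: "'a::euclidean_space \<Rightarrow> 'b::euclidean_space"
  assumes [measurable]: "f \<in> borel_measurable borel"
  shows "(\<integral>x. f (x + a) \<partial>lborel) = (\<integral>x. f x \<partial>lborel)"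
    and "integrable lborel (\<lambda>x. f (x + a)) \<longleftrightarrow> integrable lborel f"
proof -
  have d: "distr lborel borel (\<lambda>x. x + a) = (lborel :: 'a measure)"
    using lborel_distr_plus[of a] by (simp only: add.commute[of _ a])
  show "(\<integral>x. f (x + a) \<partial>lborel) = (\<integral>x. f x \<partial>lborel)"
    by (subst (2) d[symmetric], subst integral_distr) auto
  show "integrable lborel (\<lambda>x. f (x + a)) \<longleftrightarrow> integrable lborel f"
    by (subst (2) d[symmetric], subst integrable_distr_eq) auto
qed

text \<open>Integrals of translates agree, so the first-order term of the expansion integrates to zero.\<close>

lemma integral_gradient_eq_0:
  fixes f :: "'a::euclidean_space \<Rightarrow> real"
  assumes f: "\<And>x. (f has_derivative (\<lambda>h. g x \<bullet> h)) (at x)"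
    and g: "continuous_on UNIV g" and S: "compact S" "\<And>x. x \<notin> S \<Longrightarrow> f x = 0"
  shows "(\<integral>x. g x \<bullet> b \<partial>lborel) = 0"
proof (cases "b = 0")
  case False
  have cf: "continuous_on UNIV f"
    using f by (meson has_derivative_continuous continuous_at_imp_continuous_on)
  have g0: "x \<notin> S \<Longrightarrow> g x = 0" for x
    using gradient_zero_outside_support[OF f compact_imp_closed[OF S(1)] S(2)] by blast
  have fi: "integrable lborel f" by (rule compact_support_integrable[OF cf S])
  have fm: "f \<in> borel_measurable borel" by (rule borel_measurable_continuous_onI[OF cf])
  have gi: "integrable lborel (\<lambda>x. g x \<bullet> h)" for h
    by (intro integrable_inner_left compact_support_integrable[OF g S(1) g0])
  let ?m = "measure lborel (unit_nbhd S)"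
  have cK: "compact (unit_nbhd S)" by (rule compact_unit_nbhd[OF S(1)])
  have "\<bar>\<integral>x. g x \<bullet> b \<partial>lborel\<bar> \<le> \<eta> * (norm b * ?m)" if \<eta>: "\<eta> > 0" for \<eta>
  proof -
    obtain \<delta> where \<delta>: "0 < \<delta>" "\<delta> \<le> 1" "\<And>x h. norm h \<le> \<delta> \<Longrightarrow>
        \<bar>f (x + h) - f x - g x \<bullet> h\<bar> \<le> \<eta> * norm h * indicator (unit_nbhd S) x"
      by (rule uniform_first_order_expansion[OF f g S \<eta>]) (assumption | rule that)+
    define t where "t = \<delta> / norm b"
    have t: "t > 0" "norm (t *\<^sub>R b) \<le> \<delta>" using \<delta>(1) False by (auto simp: t_def)
    have i: "integrable lborel (\<lambda>x. f (x + t *\<^sub>R b))"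
      using lborel_integral_translate(2)[OF fm] fi by simp
    have ind: "integrable lborel (indicator (unit_nbhd S) :: 'a \<Rightarrow> real)"
      by (rule integrable_indicator_compact[OF cK])
    have "(\<integral>x. f (x + t *\<^sub>R b) - f x - g x \<bullet> (t *\<^sub>R b) \<partial>lborel) = - (\<integral>x. g x \<bullet> (t *\<^sub>R b) \<partial>lborel)"
      using i fi gi lborel_integral_translate(1)[OF fm] by simp
    then have "\<bar>\<integral>x. g x \<bullet> (t *\<^sub>R b) \<partial>lborel\<bar> = \<bar>\<integral>x. f (x + t *\<^sub>R b) - f x - g x \<bullet> (t *\<^sub>R b) \<partial>lborel\<bar>"
      by simp
    also have "\<dots> \<le> (\<integral>x. \<bar>f (x + t *\<^sub>R b) - f x - g x \<bullet> (t *\<^sub>R b)\<bar> \<partial>lborel)"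
      by (rule integral_abs_bound)
    also have "\<dots> \<le> (\<integral>x. \<eta> * norm (t *\<^sub>R b) * indicator (unit_nbhd S) x \<partial>lborel)"
      using \<delta>(3)[OF t(2)] ind i fi gi by (intro integral_mono) auto
    also have "\<dots> = \<eta> * norm (t *\<^sub>R b) * ?m"
      using cK by (simp add: borel_compact)
    finally have "t * \<bar>\<integral>x. g x \<bullet> b \<partial>lborel\<bar> \<le> t * (\<eta> * (norm b * ?m))"
      using t by (simp add: abs_mult algebra_simps)
    then show ?thesis using t by simp
  qed
  then have le: "\<And>\<eta>. \<eta> > 0 \<Longrightarrow> \<bar>\<integral>x. g x \<bullet> b \<partial>lborel\<bar> \<le> \<eta> * (norm b * ?m)" .
  have "\<bar>\<integral>x. g x \<bullet> b \<partial>lborel\<bar> \<le> 0 + e" if "e > 0" for e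
  proof -
    obtain \<eta> where "\<eta> > 0" "\<eta> * (norm b * ?m) \<le> e"
      by (rule small_multiple[OF \<open>e > 0\<close>, of "norm b * ?m"]) auto
    with le show ?thesis by fastforce
  qed
  then have "\<bar>\<integral>x. g x \<bullet> b \<partial>lborel\<bar> \<le> 0" by (rule field_le_epsilon)
  then show ?thesis by simp
qed simp

section \<open>Approximation of indicators by test functions\<close>

text \<open>
  With \<open>g\<close> a finite sum of bumps on balls that cover \<open>K\<close>, the functions \<open>1 - exp (- n g)\<close> take values in
  \<open>[0, 1)\<close>, vanish where \<open>g\<close> does and increase to \<open>1\<close> where \<open>g > 0\<close>, uniformly on \<open>K\<close>.
\<close>

lemma test_function_near_1_on_compact:
  fixes K :: "'a::euclidean_space set"
  assumes "compact K" "open U" "K \<subseteq> U" "0 < \<eta>"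
  obtains \<psi> where "\<psi> \<in> test_functions U" "\<And>x. 0 \<le> \<psi> x" "\<And>x. \<psi> x \<le> 1"
    "\<And>x. x \<in> K \<Longrightarrow> 1 - \<psi> x \<le> \<eta>"
proof (cases "K = {}")
  case True
  show thesis by (rule that[of "\<lambda>x. 0"]) (auto simp: test_functions_def True)
next
  case False
  have "\<forall>x\<in>K. \<exists>r>0. cball x r \<subseteq> U"
    using assms by (meson open_contains_cball subsetD)
  then obtain r where r: "\<And>x. x \<in> K \<Longrightarrow> r x > 0" "\<And>x. x \<in> K \<Longrightarrow> cball x (r x) \<subseteq> U" by metis
  have "K \<subseteq> (\<Union>x\<in>K. ball x (r x))" using r(1) by force
  then obtain D where D: "D \<subseteq> K" "finite D" "K \<subseteq> (\<Union>x\<in>D. ball x (r x))"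
    using compactE_image[OF assms(1), of K "\<lambda>x. ball x (r x)"] by auto
  define q where "q x y = (r x)\<^sup>2 - (dist x y)\<^sup>2" for x y
  define g where "g y = (\<Sum>x\<in>D. flat_bump 1 (q x y))" for y
  have q_Ck: "Ck k (\<lambda>y. q x y)" for k x
  proof -
    have "q x y = (r x)\<^sup>2 - x \<bullet> x + y \<bullet> (2 *\<^sub>R x) + (- 1) * (\<Sum>b\<in>Basis. (y \<bullet> b) * (y \<bullet> b))" for y
      unfolding euclidean_inner[of y y, symmetric]
      by (simp add: q_def dist_norm power2_norm_eq_inner algebra_simps inner_commute)
    then have "(\<lambda>y. q x y) = (\<lambda>y. (r x)\<^sup>2 - x \<bullet> x + y \<bullet> (2 *\<^sub>R x) + (- 1) * (\<Sum>b\<in>Basis. (y \<bullet> b) * (y \<bullet> b)))"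
      by (rule ext)
    then show ?thesis by (simp only:) (intro Ck_add Ck_mult Ck_sum Ck_const Ck_inner_const)
  qed
  have g_Ck: "Ck k g" for k
    unfolding g_def[abs_def] by (rule Ck_sum, rule Ck_compose_smooth[OF smooth_real_flat_bump q_Ck])
  have bump_nonneg: "0 \<le> flat_bump 1 t" for t by (simp add: flat_bump_def)
  have g_nonneg: "0 \<le> g y" for y
    unfolding g_def by (intro sum_nonneg bump_nonneg)
  have g_zero: "g y = 0" if "y \<notin> (\<Union>x\<in>D. cball x (r x))" for y
  proof -
    have "q x y \<le> 0" if "x \<in> D" for x
    proof -
      have "r x \<le> dist x y" "0 \<le> r x"
        using that \<open>y \<notin> _\<close> r(1)[of x] D(1) by (auto simp: less_imp_le)
      then show ?thesis by (simp add: q_def)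
    qed
    then show ?thesis unfolding g_def by (intro sum.neutral) (force simp: flat_bump_def)
  qed
  have g_pos: "0 < g y" if "y \<in> K" for y
  proof -
    obtain x where x: "x \<in> D" "y \<in> ball x (r x)" using D(3) \<open>y \<in> K\<close> by blast
    have "dist x y < r x" using x by simp
    then have "q x y > 0" unfolding q_def by (simp add: power_strict_mono)
    then have "0 < flat_bump 1 (q x y)" by (simp add: flat_bump_def)
    also have "\<dots> \<le> g y" unfolding g_def
      by (rule member_le_sum[OF x(1)]) (auto intro: bump_nonneg D)
    finally show ?thesis .
  qed
  have "continuous_on K g" using g_Ck[of 0] continuous_on_subset by auto
  then obtain y0 where y0: "y0 \<in> K" "\<And>y. y \<in> K \<Longrightarrow> g y0 \<le> g y"
    using continuous_attains_inf[OF assms(1) False] by blast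
  obtain n :: nat where "- ln \<eta> / g y0 < n" using reals_Archimedean2 by blast
  then have n: "- (n * g y0) \<le> ln \<eta>" using g_pos[OF y0(1)] by (simp add: field_simps)
  define \<psi> where "\<psi> y = 1 - exp (- (n * g y))" for y
  have "\<psi> y = 0" if "y \<notin> (\<Union>x\<in>D. cball x (r x))" for y
    using g_zero[OF that] by (simp add: \<psi>_def)
  then have "{y. \<psi> y \<noteq> 0} \<subseteq> (\<Union>x\<in>D. cball x (r x))" by blast
  then have sub: "closure {y. \<psi> y \<noteq> 0} \<subseteq> (\<Union>x\<in>D. cball x (r x))"
    by (rule closure_minimal) (intro closed_UN D closed_cball ballI)
  have comp: "compact (\<Union>x\<in>D. cball x (r x))" using D(2) by (intro compact_UN) auto
  show thesis
  proof
    have "Ck k \<psi>" for k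
      unfolding \<psi>_def[abs_def]
      by (rule Ck_compose_smooth[OF smooth_real_one_minus_exp]) (intro Ck_mult Ck_const g_Ck)
    moreover have "compact (closure {y. \<psi> y \<noteq> 0})"
      using compact_closure[of "{y. \<psi> y \<noteq> 0}"] sub comp
      by (meson bounded_subset closure_subset compact_imp_bounded)
    moreover have "closure {y. \<psi> y \<noteq> 0} \<subseteq> U"
      using sub r(2) D(1) by blast
    ultimately show "\<psi> \<in> test_functions U" by (simp add: test_functions_def)
    show "0 \<le> \<psi> x" "\<psi> x \<le> 1" for x using g_nonneg[of x] by (auto simp: \<psi>_def)
    show "1 - \<psi> x \<le> \<eta>" if "x \<in> K" for x
    proof -
      have "- (n * g x) \<le> - (n * g y0)" using y0(2)[OF that] by (simp add: mult_left_mono)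
      also note n
      finally have "exp (- (n * g x)) \<le> exp (ln \<eta>)" by simp
      then show ?thesis using assms(4) by (simp add: \<psi>_def)
    qed
  qed
qed

lemma compact_subset_measure_approx:
  fixes B :: "'a::euclidean_space set"
  assumes B: "B \<in> sets borel" "emeasure lborel B < \<infinity>" and "0 < \<eta>"
  obtains K where "compact K" "K \<subseteq> B" "measure lborel (B - K) < \<eta>"
proof (cases "emeasure lborel B = 0")
  case True
  then have "measure lborel B = 0" by (simp add: measure_def)
  then show thesis using that[of "{}"] assms by simp
next
  case False
  let ?M = "density lborel (indicator B)"
  have M: "emeasure ?M A = emeasure lborel (B \<inter> A)" if "A \<in> sets borel" for A
    using that B by (simp add: emeasure_density nn_integral_set_ennreal inf_commute 
        flip: indicator_inter_arith)
  have "emeasure ?M B = (SUP K \<in> {K. K \<subseteq> B \<and> compact K}. emeasure ?M K)"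
    using B M[of UNIV] by (intro inner_regular) auto
  also have "\<dots> = (SUP K \<in> {K. K \<subseteq> B \<and> compact K}. emeasure lborel K)"
    by (intro SUP_cong refl) (auto simp: M borel_compact Int_absorb1)
  finally have sup: "emeasure lborel B = (SUP K \<in> {K. K \<subseteq> B \<and> compact K}. emeasure lborel K)"
    using M[OF B(1)] by simp
  have mB: "emeasure lborel B = ennreal (measure lborel B)"
    using B by (simp add: emeasure_eq_ennreal_measure)
  have "measure lborel B > 0" using False mB zero_less_measure_iff by fastforce
  then have "emeasure lborel B - ennreal \<eta> < emeasure lborel B"
    unfolding mB using \<open>0 < \<eta>\<close> by (simp add: ennreal_minus ennreal_lessI)
  from less_le_trans[OF this eq_refl[OF sup]]
  obtain K where K: "compact K" "K \<subseteq> B" "emeasure lborel B - ennreal \<eta> < emeasure lborel K"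
    unfolding less_SUP_iff by blast
  have mK: "emeasure lborel K = ennreal (measure lborel K)"
    using emeasure_mono[OF K(2), of lborel] B by (intro emeasure_eq_ennreal_measure) auto
  have "measure lborel B - \<eta> < measure lborel K"
  proof (cases "\<eta> \<le> measure lborel B")
    case True
    then show ?thesis
      using K(3) \<open>0 < \<eta>\<close> unfolding mB mK by (simp add: ennreal_minus ennreal_less_iff)
  next
    case False
    then show ?thesis using measure_nonneg[of lborel K] by linarith
  qed
  moreover have "measure lborel (B - K) = measure lborel B - measure lborel K"
    using K B emeasure_mono[OF K(2), of lborel] by (intro measure_Diff) (auto simp: borel_compact)
  ultimately show thesis using that K by force
qed

lemma test_function_integrable:
  assumes "\<psi> \<in> test_functions \<Omega>"
  shows "integrable lborel \<psi>"
  using continuous_on_test_function[OF assms] compact_csupp[OF assms] zero_outside_csupp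
  by (rule compact_support_integrable)

text \<open>
  The function is almost \<open>1\<close> on a compact \<open>K \<subseteq> B\<close> and supported in an open \<open>V \<supseteq> B\<close>, where \<open>V - K\<close> has small measure.
\<close>

lemma indicator_approx_by_test_function:
  fixes B :: "'a::euclidean_space set"
  assumes B: "B \<in> sets borel" "emeasure lborel B < \<infinity>" and U: "open U" "B \<subseteq> U" and "0 < \<eta>"
  obtains \<psi> where "\<psi> \<in> test_functions U" "\<forall>x. 0 \<le> \<psi> x \<and> \<psi> x \<le> 1"
    "(\<integral>x. \<bar>indicator B x - \<psi> x\<bar> \<partial>lborel) < \<eta>"
proof -
  obtain K where K: "compact K" "K \<subseteq> B" "measure lborel (B - K) < \<eta> / 3"
    using compact_subset_measure_approx[OF B, of "\<eta> / 3"] \<open>0 < \<eta>\<close> by auto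
  have "B \<in> sets lebesgue" "0 < \<eta> / 3" using B \<open>0 < \<eta>\<close> by auto
  then obtain V where V: "open V" "B \<subseteq> V" "emeasure lebesgue (V - B) < ennreal (\<eta> / 3)"
    by (rule sets_lebesgue_outer_open)
  have W: "open (V \<inter> U)" "K \<subseteq> V \<inter> U" using V U K by auto
  define m where "m = measure lborel K"
  have m: "0 \<le> m" by (simp add: m_def)
  obtain \<psi> where \<psi>: "\<psi> \<in> test_functions (V \<inter> U)" "\<And>x. 0 \<le> \<psi> x" "\<And>x. \<psi> x \<le> 1"
    "\<And>x. x \<in> K \<Longrightarrow> 1 - \<psi> x \<le> \<eta> / (3 * (m + 1))"
    using test_function_near_1_on_compact[OF K(1) W, of "\<eta> / (3 * (m + 1))"] \<open>0 < \<eta>\<close> m by auto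
  have VB: "V - B \<in> sets borel" using V B by auto
  have mVB: "measure lborel (V - B) < \<eta> / 3" "emeasure lborel (V - B) < \<infinity>"
  proof -
    have "emeasure lebesgue (V - B) = emeasure lborel (V - B)"
      using VB by (simp add: emeasure_completion)
    with V(3) have *: "emeasure lborel (V - B) < ennreal (\<eta> / 3)" by simp
    then show fin: "emeasure lborel (V - B) < \<infinity>" using less_trans by fastforce
    show "measure lborel (V - B) < \<eta> / 3"
      using * \<open>0 < \<eta>\<close> fin by (simp add: emeasure_eq_ennreal_measure ennreal_less_iff)
  qed
  have KB: "K \<in> sets borel" "B - K \<in> sets borel" using K B by (auto simp: borel_compact)
  have fin: "emeasure lborel (B - K) < \<infinity>" "emeasure lborel K < \<infinity>"
    using B(2) emeasure_mono[of "B - K" B lborel] emeasure_mono[of K B lborel] K B by (auto intro: le_less_trans)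
  have le: "\<bar>indicator B x - \<psi> x\<bar> \<le> indicator (V - B) x + indicator (B - K) x + \<eta> / (3 * (m + 1)) * indicator K x" for x
  proof -
    have "x \<notin> V \<Longrightarrow> \<psi> x = 0"
      using csupp_subset[OF \<psi>(1)] zero_outside_csupp[of x \<psi>] by auto
    then show ?thesis
      using \<psi>(2,3)[of x] \<psi>(4)[of x] K(2) V(2) by (auto simp: indicator_def)
  qed
  have int: "integrable lborel (\<lambda>x. indicator (V - B) x + indicator (B - K) x + \<eta> / (3 * (m + 1)) * indicator K x :: real)"
    using VB KB fin mVB by auto
  have "(\<integral>x. \<bar>indicator B x - \<psi> x\<bar> \<partial>lborel) \<le>
      (\<integral>x. indicator (V - B) x + indicator (B - K) x + \<eta> / (3 * (m + 1)) * indicator K x \<partial>lborel)"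
  proof (rule integral_mono[OF _ int le])
    show "integrable lborel (\<lambda>x. \<bar>indicator B x - \<psi> x\<bar>)"
      using B test_function_integrable[OF \<psi>(1)] by auto
  qed
  also have "\<dots> = measure lborel (V - B) + measure lborel (B - K) + \<eta> / (3 * (m + 1)) * m"
    using VB KB fin mVB by (simp add: m_def)
  also have "\<dots> < \<eta> / 3 + \<eta> / 3 + \<eta> / 3"
  proof -
    have "\<eta> / (3 * (m + 1)) * m \<le> \<eta> / 3" using m \<open>0 < \<eta>\<close> by (simp add: field_simps)
    then show ?thesis using mVB(1) K(3) by linarith
  qed
  finally show thesis
    using that[OF test_functions_mono[OF \<psi>(1)]] \<psi>(2,3) by simp
qed

section \<open>The fundamental lemma of the calculus of variations\<close>

definition borel_locally_integrable :: "'a::euclidean_space set \<Rightarrow> ('a \<Rightarrow> 'b::euclidean_space) \<Rightarrow> bool" where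
  "borel_locally_integrable \<Omega> f \<longleftrightarrow> f \<in> borel_measurable borel \<and>
     (\<forall>K. compact K \<and> K \<subseteq> \<Omega> \<longrightarrow> integrable lborel (\<lambda>x. indicator K x *\<^sub>R f x))"

lemma borel_locally_integrable_times_compact_support:
  fixes f :: "'a::euclidean_space \<Rightarrow> 'b::euclidean_space"
  assumes f: "borel_locally_integrable \<Omega> f" and S: "compact S" "S \<subseteq> \<Omega>" "\<And>x. x \<notin> S \<Longrightarrow> g x = 0"
    and g: "continuous_on UNIV g"
  shows "integrable lborel (\<lambda>x. g x *\<^sub>R f x)"
proof -
  obtain B where B: "0 < B" "\<And>x. norm (g x) \<le> B"
    using g S(1,3) by (rule compact_support_bounded) (assumption | rule that)+
  have "integrable lborel (\<lambda>x. B *\<^sub>R (indicator S x *\<^sub>R f x))"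
    using f S unfolding borel_locally_integrable_def by (intro integrable_scaleR_right) auto
  then show ?thesis
  proof (rule Bochner_Integration.integrable_bound)
    show "(\<lambda>x. g x *\<^sub>R f x) \<in> borel_measurable lborel"
      using f borel_measurable_continuous_onI[OF g] by (auto simp: borel_locally_integrable_def)
    have "norm (g x *\<^sub>R f x) \<le> norm (B *\<^sub>R (indicator S x *\<^sub>R f x))" for x
      using B(1) B(2)[of x] S(3)[of x]
      by (cases "x \<in> S") (auto intro!: mult_right_mono)
    then show "AE x in lborel. norm (g x *\<^sub>R f x) \<le> norm (B *\<^sub>R (indicator S x *\<^sub>R f x))" by simp
  qed
qed

lemma borel_locally_integrable_times_test:
  fixes f :: "'a::euclidean_space \<Rightarrow> 'b::euclidean_space"
  assumes "borel_locally_integrable \<Omega> f" "\<psi> \<in> test_functions \<Omega>"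
  shows "integrable lborel (\<lambda>x. \<psi> x *\<^sub>R f x)"
  using assms(1) compact_csupp[OF assms(2)] csupp_subset[OF assms(2)] zero_outside_csupp
    continuous_on_test_function[OF assms(2)]
  by (rule borel_locally_integrable_times_compact_support)

text \<open>
  The indicator of \<open>{x \<in> K. f x > 0}\<close> is the almost everywhere limit of test functions with values in \<open>[0, 1]\<close> that are
  supported in one compact neighbourhood of \<open>K\<close>, on which \<open>f\<close> is integrable. By dominated convergence \<open>f\<close> integrates
  to zero over this set.
\<close>

lemma nonpos_AE_if_orthogonal_to_test_functions:
  fixes f :: "'a::euclidean_space \<Rightarrow> real"
  assumes "open \<Omega>" and f: "borel_locally_integrable \<Omega> f"
    and 0: "\<And>\<psi>. \<psi> \<in> test_functions \<Omega> \<Longrightarrow> (\<integral>x. f x * \<psi> x \<partial>lborel) = 0"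
    and K: "compact K" "K \<subseteq> \<Omega>"
  shows "AE x in lborel. x \<in> K \<longrightarrow> f x \<le> 0"
proof -
  obtain e where e: "e > 0" "(\<Union>x\<in>K. cball x e) \<subseteq> \<Omega>"
    using compact_subset_open_imp_cball_epsilon_subset[OF K(1) \<open>open \<Omega>\<close> K(2)] by metis
  define L where "L = {x + y |x y. x \<in> K \<and> y \<in> cball 0 e}"
  have L: "compact L" unfolding L_def using K by (intro compact_sums) auto
  have "L \<subseteq> (\<Union>x\<in>K. cball x e)" by (force simp: L_def dist_norm)
  then have L\<Omega>: "L \<subseteq> \<Omega>" using e by blast
  define U where "U = (\<Union>x\<in>K. ball x e)"
  have U: "open U" by (auto simp: U_def)
  have KU: "K \<subseteq> U" using e by (auto simp: U_def)
  have UL: "U \<subseteq> L"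
  proof
    fix z assume "z \<in> U"
    then obtain x where "x \<in> K" "dist x z < e" by (auto simp: U_def)
    then show "z \<in> L" unfolding L_def 
      by (intro CollectI exI[of _ x] exI[of _ "z - x"]) (auto simp: dist_norm norm_minus_commute)
  qed
  have fm [measurable]: "f \<in> borel_measurable borel" using f by (simp add: borel_locally_integrable_def)
  define B where "B = {x \<in> K. f x > 0}"
  have [measurable]: "K \<in> sets borel" using K by (simp add: borel_compact)
  have B [measurable]: "B \<in> sets borel" unfolding B_def by measurable
  have BU: "B \<subseteq> U" using KU by (auto simp: B_def)
  have Bfin: "emeasure lborel B < \<infinity>"
    using emeasure_mono[of B K lborel] emeasure_bounded_finite[OF compact_imp_bounded[OF K(1)]] by (auto simp: B_def intro: le_less_trans)
  have "\<exists>\<psi>. \<psi> \<in> test_functions U \<and> (\<forall>x. 0 \<le> \<psi> x \<and> \<psi> x \<le> 1) \<and> (\<integral>x. \<bar>indicator B x - \<psi> x\<bar> \<partial>lborel) < 1 / (Suc n)" for n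
    by (rule indicator_approx_by_test_function[OF B Bfin U BU, of "1 / Suc n"]) (simp, blast)
  then obtain \<psi> where \<psi>: "\<And>n. \<psi> n \<in> test_functions U" "\<And>n x. 0 \<le> \<psi> n x \<and> \<psi> n x \<le> 1"
    "\<And>n. (\<integral>x. \<bar>indicator B x - \<psi> n x\<bar> \<partial>lborel) < 1 / (Suc n)" by metis
  have \<psi>i: "integrable lborel (\<psi> n)" for n
    by (rule test_function_integrable[OF \<psi>(1)])
  have Bi: "integrable lborel (\<lambda>x. indicator B x :: real)" using Bfin B by auto
  have lim: "(\<lambda>n. \<integral>x. norm (indicator B x - \<psi> n x) \<partial>lborel) \<longlonglongrightarrow> 0"
  proof (rule tendsto_sandwich[of "\<lambda>_. 0" _ _ "\<lambda>n. 1 / (Suc n)"])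
    show "(\<lambda>n. 1 / real (Suc n)) \<longlonglongrightarrow> 0" using LIMSEQ_inverse_real_of_nat by (simp add: inverse_eq_divide)
    show "\<forall>\<^sub>F n in sequentially. (\<integral>x. norm (indicator B x - \<psi> n x) \<partial>lborel) \<le> 1 / (Suc n)"
      using \<psi>(3) by (auto intro!: always_eventually less_imp_le)
  qed auto
  obtain s where s: "strict_mono s" "AE x in lborel. (\<lambda>n. indicator B x - \<psi> (s n) x) \<longlonglongrightarrow> 0"
    using tendsto_L1_AE_subseq[OF _ lim] Bi \<psi>i by auto
  have fL: "integrable lborel (\<lambda>x. indicator L x *\<^sub>R f x)"
    using f L L\<Omega> by (auto simp: borel_locally_integrable_def)
  have "(\<lambda>n. \<integral>x. f x * \<psi> (s n) x \<partial>lborel) \<longlonglongrightarrow> (\<integral>x. f x * indicator B x \<partial>lborel)"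
  proof (rule integral_dominated_convergence[where w = "\<lambda>x. \<bar>indicator L x *\<^sub>R f x\<bar>"])
    show "(\<lambda>x. f x * \<psi> (s n) x) \<in> borel_measurable lborel" for n
      using \<psi>i[of "s n"] by (auto simp: integrable_iff_bounded)
    show "AE x in lborel. (\<lambda>i. f x * \<psi> (s i) x) \<longlonglongrightarrow> f x * indicat_real B x"
      using s(2)
    proof eventually_elim
      case (elim x)
      have "(\<lambda>n. indicator B x - (indicator B x - \<psi> (s n) x)) \<longlonglongrightarrow> indicat_real B x - 0"
        by (intro tendsto_diff tendsto_const elim)
      then show ?case by (auto intro!: tendsto_mult)
    qed
    show "AE x in lborel. norm (f x * \<psi> (s i) x) \<le> \<bar>indicator L x *\<^sub>R f x\<bar>" for i
    proof (rule AE_I2)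
      fix x
      have "x \<notin> L \<Longrightarrow> \<psi> (s i) x = 0"
        using csupp_subset[OF \<psi>(1)[of "s i"]] UL zero_outside_csupp[of x "\<psi> (s i)"] by auto
      then show "norm (f x * \<psi> (s i) x) \<le> \<bar>indicator L x *\<^sub>R f x\<bar>"
        using \<psi>(2)[of "s i" x] by (cases "x \<in> L") (auto simp: abs_mult mult_left_le)
    qed
  qed (use fL in auto)
  moreover have "(\<integral>x. f x * \<psi> (s n) x \<partial>lborel) = 0" for n
    by (rule 0) (use test_functions_mono[OF \<psi>(1)] UL L\<Omega> in auto)
  ultimately have int0: "(\<integral>x. f x * indicator B x \<partial>lborel) = 0"
    by (simp add: LIMSEQ_const_iff)
  have "integrable lborel (\<lambda>x. indicator B x *\<^sub>R (indicator L x *\<^sub>R f x))"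
    by (rule integrable_mult_indicator[OF _ fL]) simp
  also have "(\<lambda>x. indicator B x *\<^sub>R (indicator L x *\<^sub>R f x)) = (\<lambda>x. f x * indicator B x)"
    using KU UL by (auto simp: indicator_def B_def fun_eq_iff)
  finally have "AE x in lborel. f x * indicator B x = 0"
    using integral_nonneg_eq_0_iff_AE[of lborel "\<lambda>x. f x * indicator B x"] int0
    by (auto simp: B_def indicator_def)
  then show ?thesis by eventually_elim (auto simp: B_def indicator_def)
qed

lemma zero_AE_if_orthogonal_to_test_functions:
  fixes f :: "'a::euclidean_space \<Rightarrow> real"
  assumes "open \<Omega>" and f: "borel_locally_integrable \<Omega> f"
    and 0: "\<And>\<psi>. \<psi> \<in> test_functions \<Omega> \<Longrightarrow> (\<integral>x. f x * \<psi> x \<partial>lborel) = 0"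
  shows "AE x in lborel. x \<in> \<Omega> \<longrightarrow> f x = 0"
proof -
  obtain C where C: "\<And>n::nat. compact (C n)" "\<And>n. C n \<subseteq> \<Omega>" "(\<Union>n. C n) = \<Omega>"
    using open_Union_compact_subsets[OF \<open>open \<Omega>\<close>] by metis
  have f': "borel_locally_integrable \<Omega> (\<lambda>x. - f x)" using f by (auto simp: borel_locally_integrable_def)
  have "AE x in lborel. x \<in> C n \<longrightarrow> f x = 0" for n
    using nonpos_AE_if_orthogonal_to_test_functions[OF \<open>open \<Omega>\<close> f 0 C(1,2)[of n]]
      nonpos_AE_if_orthogonal_to_test_functions[OF \<open>open \<Omega>\<close> f' _ C(1,2)[of n]] 0
    by (auto elim!: eventually_elim2)
  then have "AE x in lborel. \<forall>n. x \<in> C n \<longrightarrow> f x = 0"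
    by (subst AE_all_countable) blast
  then show ?thesis by eventually_elim (use C(3) in auto)
qed

lemma ball_in_sets_borel [measurable]: "ball (x::'a::euclidean_space) r \<in> sets borel"
  by simp

lemma unit_ball_emeasure:
  "emeasure lborel (ball (0::'a::euclidean_space) 1) \<noteq> 0"
  "emeasure lborel (ball (0::'a::euclidean_space) 1) \<noteq> top"
  using emeasure_bounded_finite[of "ball (0::'a) 1"] content_ball_pos[of 1 "0::'a"]
  by (auto simp: measure_def)

section \<open>Invariance under reflections\<close>

text \<open>
  Integrating \<open>A(x + y) B(y)\<close> in both orders gives \<open>\<lambda>(A) \<mu>(B) = \<mu>(A) \<lambda>(B)\<close> for any two translation invariant
  measures.
\<close>

lemma translation_invariant_measure_eq_lborel:
  fixes \<mu> :: "'a::euclidean_space measure"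
  assumes [measurable_cong]: "sets \<mu> = sets borel" and "sigma_finite_measure \<mu>"
    and tr: "\<And>a. distr \<mu> borel ((+) a) = \<mu>"
    and ball: "emeasure \<mu> (ball 0 1) = emeasure lborel (ball (0::'a) 1)"
  shows "\<mu> = lborel"
proof (rule measure_eqI)
  interpret sigma_finite_measure \<mu> by fact
  interpret P: pair_sigma_finite lborel \<mu> by standard
  show "sets \<mu> = sets lborel" by (simp add: assms)
  fix A assume "A \<in> sets \<mu>"
  then have A [measurable]: "A \<in> sets borel" by (simp add: assms)
  define B where "B = ball (0::'a) 1"
  have B [measurable]: "B \<in> sets borel" by (simp add: B_def)
  have lrefl: "distr lborel borel (\<lambda>x. y - x) = lborel" for y :: 'a
    using lborel_affine[of "-1" y] by (simp add: density_1)
  have 1: "(\<integral>\<^sup>+ x. indicator A (x + y) \<partial>lborel) = emeasure lborel A" for y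
  proof -
    have "(\<integral>\<^sup>+ x. indicator A (y + x) \<partial>lborel) = (\<integral>\<^sup>+ x. indicator A x \<partial>distr lborel borel ((+) y))"
      by (subst nn_integral_distr) auto
    then show ?thesis by (simp add: lborel_distr_plus add.commute)
  qed
  have 2: "(\<integral>\<^sup>+ y. indicator A (x + y) * indicator B y \<partial>\<mu>) = (\<integral>\<^sup>+ y. indicator A y * indicator B (y - x) \<partial>\<mu>)" for x
  proof -
    have "(\<integral>\<^sup>+ y. indicator A (x + y) * indicator B (x + y - x) \<partial>\<mu>)
        = (\<integral>\<^sup>+ y. indicator A y * indicator B (y - x) \<partial>distr \<mu> borel ((+) x))"
    proof (subst nn_integral_distr)
      show "(+) x \<in> \<mu> \<rightarrow>\<^sub>M borel" by measurable
    qed auto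
    then show ?thesis by (simp add: tr)
  qed
  have 3: "(\<integral>\<^sup>+ x. indicator B (y - x) \<partial>lborel) = emeasure lborel B" for y
  proof -
    have "(\<integral>\<^sup>+ x. indicator B (y - x) \<partial>lborel) = (\<integral>\<^sup>+ x. indicator B x \<partial>distr lborel borel (\<lambda>x. y - x))"
      by (subst nn_integral_distr) auto
    then show ?thesis by (simp add: lrefl)
  qed
  have "emeasure lborel A * emeasure \<mu> B = (\<integral>\<^sup>+ y. (\<integral>\<^sup>+ x. indicator A (x + y) * indicator B y \<partial>lborel) \<partial>\<mu>)"
    using assms(1) by (simp add: nn_integral_multc nn_integral_cmult 1)
  also have "\<dots> = (\<integral>\<^sup>+ x. (\<integral>\<^sup>+ y. indicator A (x + y) * indicator B y \<partial>\<mu>) \<partial>lborel)"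
    by (rule P.Fubini') measurable
  also have "\<dots> = (\<integral>\<^sup>+ x. (\<integral>\<^sup>+ y. indicator A y * indicator B (y - x) \<partial>\<mu>) \<partial>lborel)"
    by (simp only: 2)
  also have "\<dots> = (\<integral>\<^sup>+ y. (\<integral>\<^sup>+ x. indicator A y * indicator B (y - x) \<partial>lborel) \<partial>\<mu>)"
    by (rule P.Fubini'[symmetric]) measurable
  also have "\<dots> = emeasure \<mu> A * emeasure lborel B"
    using assms(1) by (simp add: nn_integral_multc nn_integral_cmult 3)
  finally have "emeasure lborel A * emeasure lborel B = emeasure \<mu> A * emeasure lborel B"
    using ball by (simp add: B_def)
  moreover have "emeasure lborel B \<noteq> 0" "emeasure lborel B \<noteq> top"
    using unit_ball_emeasure by (simp_all add: B_def)
  ultimately show "emeasure \<mu> A = emeasure lborel A"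
    by (simp add: mult.commute[of _ "emeasure lborel B"] ennreal_mult_cancel_left)
qed

definition reflect :: "'a::euclidean_space \<Rightarrow> 'a \<Rightarrow> 'a" where
  "reflect a x = x - (2 * (x \<bullet> a) / (a \<bullet> a)) *\<^sub>R a"

lemma reflect_add: "reflect a (x + y) = reflect a x + reflect a y"
  by (simp add: reflect_def inner_add_left algebra_simps add_divide_distrib)

lemma reflect_scaleR: "reflect a (c *\<^sub>R x) = c *\<^sub>R reflect a x"
  by (simp add: reflect_def algebra_simps)

lemma inner_reflect: "reflect a x \<bullet> y = x \<bullet> reflect a y"
  by (simp add: reflect_def inner_diff_left inner_diff_right inner_commute)

lemma reflect_reflect [simp]: "reflect a (reflect a x) = x"
  by (cases "a = 0") (auto simp: reflect_def inner_diff_left algebra_simps simp flip: scaleR_add_left)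

lemma norm_reflect [simp]: "norm (reflect a x) = norm x"
  by (simp add: norm_eq_sqrt_inner inner_reflect)

lemma sgn_reflect: "sgn (reflect a x) = reflect a (sgn x)"
  by (simp add: sgn_div_norm reflect_scaleR)

lemma reflect_measurable [measurable]: "reflect a \<in> borel_measurable borel"
  unfolding reflect_def[abs_def] by measurable

lemma reflect_swaps:
  assumes "norm c = norm d"
  shows "reflect (c - d) c = d"
proof (cases "c = d")
  case False
  define X where "X = c \<bullet> (c - d)"
  have eq: "(c - d) \<bullet> (c - d) = 2 * X"
    using assms by (simp add: X_def inner_diff_left inner_diff_right inner_commute norm_eq_sqrt_inner)
  have "X \<noteq> 0" using False eq by (metis inner_eq_zero_iff mult_zero_right right_minus_eq)
  then have one: "2 * (c \<bullet> (c - d)) / ((c - d) \<bullet> (c - d)) = 1" unfolding eq X_def[symmetric] by simp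
  show ?thesis unfolding reflect_def one by simp
qed (simp add: reflect_def)

lemma lborel_reflect: "distr lborel borel (reflect a) = (lborel :: 'a::euclidean_space measure)"
proof (rule translation_invariant_measure_eq_lborel)
  let ?\<mu> = "distr lborel borel (reflect a)"
  have pre: "reflect a -` cball 0 r = cball 0 r" "reflect a -` ball 0 r = ball 0 r" for r
    by auto
  show "sets ?\<mu> = sets borel" by simp
  show "sigma_finite_measure ?\<mu>"
  proof
    have "emeasure ?\<mu> (cball 0 (real n)) \<noteq> \<infinity>" for n
      using emeasure_bounded_finite[of "cball (0::'a) (real n)"]
      by (simp add: emeasure_distr pre less_top[symmetric])
    moreover have "(\<Union>n. cball 0 (real n)) = (UNIV :: 'a set)"
      using real_arch_simple by auto
    ultimately show "\<exists>A. countable A \<and> A \<subseteq> sets ?\<mu> \<and> \<Union> A = space ?\<mu> \<and> (\<forall>a\<in>A. emeasure ?\<mu> a \<noteq> \<infinity>)"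
      by (intro exI[of _ "range (\<lambda>n. cball 0 (real n))"]) auto
  qed
  show "distr ?\<mu> borel ((+) b) = ?\<mu>" for b
  proof -
    have "distr ?\<mu> borel ((+) b) = distr lborel borel (\<lambda>x. b + reflect a x)"
      by (subst distr_distr) (auto simp: comp_def)
    also have "(\<lambda>x. b + reflect a x) = reflect a \<circ> (+) (reflect a b)"
      by (auto simp: reflect_add)
    also have "distr lborel borel \<dots> = distr (distr lborel borel ((+) (reflect a b))) borel (reflect a)"
      by (subst distr_distr) auto
    finally show ?thesis by (simp add: lborel_distr_plus)
  qed
  show "emeasure ?\<mu> (ball 0 1) = emeasure lborel (ball (0::'a) 1)"
    by (simp add: emeasure_distr pre)
qed

section \<open>The constant \<open>K\<^bsub>d,p\<^esub>\<close>\<close>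

text \<open>
  The surface measure is \<open>d\<close> times the image of Lebesgue measure on the unit ball under \<open>sgn\<close>; the factor \<open>d\<close>
  cancels in the normalised integral.
\<close>

lemma nn_integral_ball_K_const:
  fixes e :: "'a::euclidean_space"
  assumes "1 < p" "norm e = 1"
  shows "(\<integral>\<^sup>+ z. indicator (ball 0 1) z * ennreal (\<bar>sgn z \<bullet> e\<bar> powr p) \<partial>lborel) =
         ennreal (K_const e p) * emeasure lborel (ball (0::'a) 1)"
proof -
  let ?R = "restrict_space lborel (ball (0::'a) 1 - {0})"
  let ?S = "restrict_space borel (sphere (0::'a) 1)"
  let ?I = "\<integral>\<^sup>+ z. indicator (ball 0 1) z * ennreal (\<bar>sgn z \<bullet> e\<bar> powr p) \<partial>lborel"
  let ?V = "measure lborel (ball (0::'a) 1)"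
  have "sgn \<in> borel_measurable ?R"
    unfolding sgn_div_norm by (rule measurable_restrict_space1) simp
  then have sgn: "sgn \<in> measurable ?R ?S"
    by (intro measurable_restrict_space2) (auto simp: space_restrict_space norm_sgn)
  have fin: "emeasure lborel (ball (0::'a) 1) = ennreal ?V"
    using emeasure_bounded_finite[of "ball (0::'a) 1"] by (intro emeasure_eq_ennreal_measure) auto
  have Vpos: "?V > 0" using content_ball_pos[of 1 "0::'a"] by simp
  have I_le: "?I \<le> emeasure lborel (ball (0::'a) 1)"
  proof -
    have "?I \<le> (\<integral>\<^sup>+ z. indicator (ball 0 1) z \<partial>(lborel :: 'a measure))"
    proof (rule nn_integral_mono)
      fix z :: 'a
      have "\<bar>sgn z \<bullet> e\<bar> \<le> norm (sgn z) * norm e" by (rule Cauchy_Schwarz_ineq2)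
      also have "\<dots> \<le> 1" using assms by (simp add: norm_sgn)
      finally have "\<bar>sgn z \<bullet> e\<bar> powr p \<le> 1" using assms by (simp add: powr_le1)
      then show "indicator (ball 0 1) z * ennreal (\<bar>sgn z \<bullet> e\<bar> powr p) \<le> indicator (ball 0 1) z"
        by (auto simp: indicator_def)
    qed
    then show ?thesis by simp
  qed
  have ae: "AE z in lborel. (z::'a) \<noteq> 0" by (rule AE_lborel_singleton)
  have "(\<integral>\<^sup>+ w. ennreal (\<bar>w \<bullet> e\<bar> powr p) \<partial>sphere_measure) =
      ennreal (real DIM('a)) * (\<integral>\<^sup>+ z. ennreal (\<bar>sgn z \<bullet> e\<bar> powr p) \<partial>?R)"
    unfolding sphere_measure_def
    by (subst nn_integral_scale_measure) (auto simp: nn_integral_distr[OF sgn] measurable_restrict_space1)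
  also have "(\<integral>\<^sup>+ z. ennreal (\<bar>sgn z \<bullet> e\<bar> powr p) \<partial>?R) = ?I"
    using ae by (subst nn_integral_restrict_space) (auto intro!: nn_integral_cong_AE simp: indicator_def mult.commute)
  finally have 1: "(\<integral>\<^sup>+ w. ennreal (\<bar>w \<bullet> e\<bar> powr p) \<partial>sphere_measure) = ennreal (real DIM('a)) * ?I" .
  have sm: "(\<lambda>w. \<bar>w \<bullet> e\<bar> powr p) \<in> borel_measurable (sphere_measure :: 'a measure)"
    unfolding sphere_measure_def measurable_cong_sets[OF sets_scale_measure refl] measurable_distr_eq1
    by (rule measurable_restrict_space1) measurable
  have "(\<integral>w. \<bar>w \<bullet> e\<bar> powr p \<partial>sphere_measure) = enn2real (ennreal (real DIM('a)) * ?I)"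
    by (subst integral_eq_nn_integral[OF sm]) (auto simp: 1)
  also have "\<dots> = real DIM('a) * enn2real ?I"
    by (simp add: enn2real_mult)
  finally have 2: "(\<integral>w. \<bar>w \<bullet> e\<bar> powr p \<partial>sphere_measure) = real DIM('a) * enn2real ?I" .
  have "emeasure sphere_measure (sphere (0::'a) 1) = ennreal (real DIM('a)) * emeasure ?R (space ?R)"
  proof -
    have "sgn -` sphere 0 1 \<inter> space ?R = space ?R"
      by (auto simp: space_restrict_space norm_sgn)
    then show ?thesis unfolding sphere_measure_def
      using emeasure_distr[OF sgn, of "sphere 0 1"] sets.top[of ?S] by (simp add: space_restrict_space)
  qed
  also have "emeasure ?R (space ?R) = emeasure lborel (ball (0::'a) 1 - {0})"
    by (subst emeasure_restrict_space) (auto simp: space_restrict_space)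
  also have "\<dots> = emeasure lborel (ball (0::'a) 1)"
    by (intro emeasure_eq_AE) (use ae in auto)
  finally have 3: "measure sphere_measure (sphere (0::'a) 1) = real DIM('a) * ?V"
    by (simp add: measure_def enn2real_mult)
  have "K_const e p = enn2real ?I / ?V"
    unfolding K_const_def 2 3 by simp
  then have "K_const e p * ?V = enn2real ?I" using Vpos by simp
  moreover have "?I = ennreal (enn2real ?I)"
    using I_le fin by (intro ennreal_enn2real[symmetric]) (auto simp: less_top[symmetric] top_unique)
  ultimately show ?thesis
    using fin by (metis ennreal_mult'' measure_nonneg)
qed

lemma K_const_nonneg: "0 \<le> K_const e p"
  unfolding K_const_def by (intro mult_nonneg_nonneg integral_nonneg_AE) auto

text \<open>
  The reflection invariance stands in for polar coordinates. The integral of \<open>\<bar>sgn z \<bullet> h\<bar>\<^sup>p\<close> over \<open>h\<close> does not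
  depend on \<open>z\<close>, and its integral over \<open>z\<close> in the unit ball depends on \<open>h\<close> only through \<open>\<bar>h\<bar>\<^sup>p\<close>; comparing
  the two orders of integration produces \<open>K\<^bsub>d,p\<^esub>\<close>.
\<close>

lemma nn_integral_directional_moment:
  fixes \<mu> :: "'a::euclidean_space measure" and e :: 'a
  assumes "1 < p" "norm e = 1" "norm c = 1"
    and [measurable_cong]: "sets \<mu> = sets borel" and "sigma_finite_measure \<mu>"
    and inv: "\<And>a. distr \<mu> borel (reflect a) = \<mu>"
  shows "(\<integral>\<^sup>+ h. indicator (ball 0 r) h * ennreal (\<bar>c \<bullet> h\<bar> powr p) \<partial>\<mu>) =
         ennreal (K_const e p) * (\<integral>\<^sup>+ h. indicator (ball 0 r) h * ennreal (norm h powr p) \<partial>\<mu>)"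
    (is "?\<kappa> = _ * ?m")
proof -
  interpret sigma_finite_measure \<mu> by fact
  interpret P: pair_sigma_finite lborel \<mu> by standard
  let ?B = "ball (0::'a) 1"
  have rm: "reflect a \<in> \<mu> \<rightarrow>\<^sub>M borel" for a :: 'a by measurable
  have \<kappa>: "(\<integral>\<^sup>+ h. indicator (ball 0 r) h * ennreal (\<bar>d \<bullet> h\<bar> powr p) \<partial>\<mu>) = ?\<kappa>" if "norm d = 1" for d
  proof -
    have "(\<integral>\<^sup>+ h. indicator (ball 0 r) h * ennreal (\<bar>d \<bullet> h\<bar> powr p) \<partial>distr \<mu> borel (reflect (d - c)))
        = (\<integral>\<^sup>+ h. indicator (ball 0 r) (reflect (d - c) h) * ennreal (\<bar>d \<bullet> reflect (d - c) h\<bar> powr p) \<partial>\<mu>)"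
      by (subst nn_integral_distr[OF rm]) measurable
    also have "\<dots> = ?\<kappa>"
      using that assms(3) by (simp add: indicator_def flip: inner_reflect) (simp add: reflect_swaps)
    finally show ?thesis by (simp add: inv)
  qed
  have I: "(\<integral>\<^sup>+ z. indicator ?B z * ennreal (\<bar>sgn z \<bullet> w\<bar> powr p) \<partial>lborel) =
      ennreal (K_const e p) * emeasure lborel ?B" if "norm w = 1" for w
  proof -
    have "(\<integral>\<^sup>+ z. indicator ?B z * ennreal (\<bar>sgn z \<bullet> w\<bar> powr p) \<partial>distr lborel borel (reflect (w - e)))
        = (\<integral>\<^sup>+ z. indicator ?B (reflect (w - e) z) * ennreal (\<bar>sgn (reflect (w - e) z) \<bullet> w\<bar> powr p) \<partial>lborel)"
      by (subst nn_integral_distr) auto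
    also have "\<dots> = (\<integral>\<^sup>+ z. indicator ?B z * ennreal (\<bar>sgn z \<bullet> e\<bar> powr p) \<partial>lborel)"
      using that assms(2) by (simp add: indicator_def sgn_reflect inner_reflect reflect_swaps)
    finally show ?thesis
      by (simp add: lborel_reflect nn_integral_ball_K_const[OF assms(1,2)])
  qed
  let ?f = "\<lambda>z h. indicator ?B z * (indicator (ball 0 r) h * ennreal (\<bar>sgn z \<bullet> h\<bar> powr p))"
  have ae: "AE z in lborel. (z::'a) \<noteq> 0" by (rule AE_lborel_singleton)
  have "(\<integral>\<^sup>+ z. (\<integral>\<^sup>+ h. ?f z h \<partial>\<mu>) \<partial>lborel) = (\<integral>\<^sup>+ z. indicator ?B z * ?\<kappa> \<partial>lborel)"
  proof (rule nn_integral_cong_AE)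
    show "AE z in lborel. (\<integral>\<^sup>+ h. ?f z h \<partial>\<mu>) = indicator ?B z * ?\<kappa>"
      using ae
    proof eventually_elim
      case (elim z)
      then show ?case using \<kappa>[of "sgn z"] by (simp add: nn_integral_cmult norm_sgn)
    qed
  qed
  also have "\<dots> = emeasure lborel ?B * ?\<kappa>"
    by (simp add: nn_integral_multc)
  finally have 1: "(\<integral>\<^sup>+ z. (\<integral>\<^sup>+ h. ?f z h \<partial>\<mu>) \<partial>lborel) = emeasure lborel ?B * ?\<kappa>" .
  have 2: "(\<integral>\<^sup>+ z. ?f z h \<partial>lborel) =
      indicator (ball 0 r) h * ennreal (norm h powr p) * (ennreal (K_const e p) * emeasure lborel ?B)" for h
  proof (cases "h = 0")
    case True
    then show ?thesis using assms by simp
  next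
    case False
    have "?f z h = indicator (ball 0 r) h * ennreal (norm h powr p) *
        (indicator ?B z * ennreal (\<bar>sgn z \<bullet> sgn h\<bar> powr p))" for z
    proof -
      have "h = norm h *\<^sub>R sgn h" using False by (simp add: sgn_div_norm)
      then have "\<bar>sgn z \<bullet> h\<bar> powr p = norm h powr p * \<bar>sgn z \<bullet> sgn h\<bar> powr p"
        by (metis abs_ge_zero abs_mult abs_norm_cancel inner_scaleR_right norm_ge_zero powr_mult)
      then show ?thesis by (simp add: ennreal_mult mult_ac)
    qed
    then show ?thesis
      using False I[of "sgn h"] by (simp add: nn_integral_cmult norm_sgn)
  qed
  have "emeasure lborel ?B * ?\<kappa> = (\<integral>\<^sup>+ h. (\<integral>\<^sup>+ z. ?f z h \<partial>lborel) \<partial>\<mu>)"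
    unfolding 1[symmetric] by (rule P.Fubini'[symmetric]) measurable
  also have "\<dots> = ?m * (ennreal (K_const e p) * emeasure lborel ?B)"
    unfolding 2 by (subst nn_integral_multc) auto
  finally have "emeasure lborel ?B * ?\<kappa> = emeasure lborel ?B * (ennreal (K_const e p) * ?m)"
    by (simp add: mult_ac)
  moreover have "emeasure lborel ?B \<noteq> 0" "emeasure lborel ?B \<noteq> top"
    using unit_ball_emeasure by simp_all
  ultimately show ?thesis by (simp add: ennreal_mult_cancel_left)
qed

text \<open>
  A reflection that fixes \<open>c\<close> shows that the vector \<open>\<integral> pflux p (c \<bullet> h) h d\<mu>\<close> is a multiple of \<open>c\<close>; its component along
  \<open>c\<close> is the directional moment computed above.
\<close>

lemma radial_flux_integral:
  fixes \<mu> :: "'a::euclidean_space measure" and e :: 'a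
  assumes "1 < p" "norm e = 1"
    and [measurable_cong]: "sets \<mu> = sets borel" and "sigma_finite_measure \<mu>"
    and inv: "\<And>a. distr \<mu> borel (reflect a) = \<mu>"
    and int: "integrable \<mu> (\<lambda>h. indicator (ball 0 r) h * norm h powr p)"
  shows "integrable \<mu> (\<lambda>h. indicator (ball 0 r) h * (pflux p (c \<bullet> h) * (z \<bullet> h)))"
    and "(\<integral>h. indicator (ball 0 r) h * (pflux p (c \<bullet> h) * (z \<bullet> h)) \<partial>\<mu>) =
      K_const e p * (\<integral>h. indicator (ball 0 r) h * norm h powr p \<partial>\<mu>) * (pflux p c \<bullet> z)"
proof -
  let ?T = "\<lambda>z h. indicator (ball 0 r) h * (pflux p (c \<bullet> h) * (z \<bullet> h))"
  let ?m = "\<integral>h. indicator (ball 0 r) h * norm h powr p \<partial>\<mu>"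
  have Ti: "integrable \<mu> (?T z)" for z
  proof (rule Bochner_Integration.integrable_bound)
    show "integrable \<mu> (\<lambda>h. norm c powr (p - 1) * norm z * (indicator (ball 0 r) h * norm h powr p))"
      using int by simp
    have "norm (?T z h) \<le> norm (norm c powr (p - 1) * norm z * (indicator (ball 0 r) h * norm h powr p))" for h
    proof -
      have "\<bar>c \<bullet> h\<bar> powr (p - 1) * \<bar>z \<bullet> h\<bar> \<le> (norm c * norm h) powr (p - 1) * (norm z * norm h)"
        using assms(1) by (intro mult_mono powr_mono2 Cauchy_Schwarz_ineq2) auto
      also have "\<dots> = norm c powr (p - 1) * norm z * (norm h powr (p - 1) * norm h)"
        by (simp add: powr_mult)
      also have "norm h powr (p - 1) * norm h = norm h powr p"
        using powr_mult_self[of "norm h" "p - 1"] by simp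
      finally show ?thesis
        using norm_pflux[of p "c \<bullet> h"] by (simp add: abs_mult indicator_def)
    qed
    then show "AE h in \<mu>. norm (?T z h) \<le> norm (norm c powr (p - 1) * norm z * (indicator (ball 0 r) h * norm h powr p))"
      by simp
  qed measurable
  show "integrable \<mu> (?T z)" by (rule Ti)
  show "integral\<^sup>L \<mu> (?T z) = K_const e p * ?m * (pflux p c \<bullet> z)"
  proof (cases "c = 0")
    case True
    then show ?thesis by simp
  next
    case False
    have orth: "integral\<^sup>L \<mu> (?T w) = 0" if "w \<bullet> c = 0" for w
    proof -
      have rm: "reflect w \<in> \<mu> \<rightarrow>\<^sub>M borel" by measurable
      have rc: "reflect w c = c" using that by (simp add: reflect_def inner_commute)
      have rw: "reflect w w = - w" by (cases "w = 0") (auto simp: reflect_def algebra_simps scaleR_2)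
      have "integral\<^sup>L \<mu> (?T w) = integral\<^sup>L (distr \<mu> borel (reflect w)) (?T w)" by (simp add: inv)
      also have "\<dots> = (\<integral>h. ?T w (reflect w h) \<partial>\<mu>)"
        by (subst integral_distr[OF rm]) auto
      also have "\<dots> = (\<integral>h. - ?T w h \<partial>\<mu>)"
        by (simp add: indicator_def rc rw flip: inner_reflect)
      finally show ?thesis by simp
    qed
    have along: "integral\<^sup>L \<mu> (?T c) = norm c powr p * (K_const e p * ?m)"
    proof -
      have eq: "?T c h = norm c powr p * (indicator (ball 0 r) h * \<bar>sgn c \<bullet> h\<bar> powr p)" for h
      proof -
        have "pflux p (c \<bullet> h) * (c \<bullet> h) = \<bar>c \<bullet> h\<bar> powr (p - 2) * \<bar>c \<bullet> h\<bar> * \<bar>c \<bullet> h\<bar>"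
          by (simp add: pflux_def abs_mult_self_eq mult.assoc)
        also have "\<dots> = \<bar>c \<bullet> h\<bar> powr p"
          using powr_mult_self[of "\<bar>c \<bullet> h\<bar>" "p - 2"] powr_mult_self[of "\<bar>c \<bullet> h\<bar>" "p - 1"] by simp
        finally have 1: "pflux p (c \<bullet> h) * (c \<bullet> h) = \<bar>c \<bullet> h\<bar> powr p" .
        have "c = norm c *\<^sub>R sgn c" using False by (simp add: sgn_div_norm)
        then have 2: "c \<bullet> h = norm c * (sgn c \<bullet> h)" by (metis inner_scaleR_left)
        have "\<bar>c \<bullet> h\<bar> powr p = norm c powr p * \<bar>sgn c \<bullet> h\<bar> powr p"
          by (subst 2) (simp add: abs_mult powr_mult)
        then show ?thesis by (simp add: 1)
      qed
      have "(\<integral>h. indicator (ball 0 r) h * \<bar>sgn c \<bullet> h\<bar> powr p \<partial>\<mu>) =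
          enn2real (\<integral>\<^sup>+ h. indicator (ball 0 r) h * ennreal (\<bar>sgn c \<bullet> h\<bar> powr p) \<partial>\<mu>)"
        by (subst integral_eq_nn_integral) (auto simp: ennreal_mult ennreal_indicator)
      also have "\<dots> = enn2real (ennreal (K_const e p) * (\<integral>\<^sup>+ h. indicator (ball 0 r) h * ennreal (norm h powr p) \<partial>\<mu>))"
        using False by (subst nn_integral_directional_moment[OF assms(1,2) _ assms(3-5)]) (auto simp: norm_sgn)
      also have "\<dots> = K_const e p * ?m"
        by (subst integral_eq_nn_integral) (auto simp: ennreal_mult ennreal_indicator enn2real_mult K_const_nonneg)
      finally show ?thesis unfolding eq by simp
    qed
    define s where "s = (z \<bullet> c) / (c \<bullet> c)"
    define w where "w = z - s *\<^sub>R c"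
    have w: "w \<bullet> c = 0" using False by (simp add: w_def s_def inner_diff_left)
    have "?T z = (\<lambda>h. s * ?T c h + ?T w h)"
      by (auto simp: w_def inner_diff_left algebra_simps)
    then have "integral\<^sup>L \<mu> (?T z) = s * integral\<^sup>L \<mu> (?T c) + integral\<^sup>L \<mu> (?T w)"
      using Ti[of c] Ti[of w] by simp
    also have "\<dots> = K_const e p * ?m * (s * norm c powr p)"
      by (simp add: along orth[OF w])
    also have "s * norm c powr p = pflux p c \<bullet> z"
    proof -
      have "norm c powr p = norm c powr (p - 2) * (c \<bullet> c)"
        using powr_mult_self[of "norm c" "p - 2"] powr_mult_self[of "norm c" "p - 1"] False
        by (simp add: dot_square_norm power2_eq_square mult.assoc[symmetric])
      then show ?thesis using False by (simp add: s_def pflux_def inner_commute)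
    qed
    finally show ?thesis .
  qed
qed

section \<open>Functions with integrable \<open>p\<close>-th power\<close>

definition p_integrable :: "real \<Rightarrow> 'a measure \<Rightarrow> ('a \<Rightarrow> 'b::euclidean_space) \<Rightarrow> bool" where
  "p_integrable p M f \<longleftrightarrow> f \<in> borel_measurable M \<and> integrable M (\<lambda>x. norm (f x) powr p)"

lemma p_integrable_measurable [measurable_dest]: "p_integrable p M f \<Longrightarrow> f \<in> borel_measurable M"
  and p_integrable_integrable: "p_integrable p M f \<Longrightarrow> integrable M (\<lambda>x. norm (f x) powr p)"
  by (auto simp: p_integrable_def)

lemma p_integrable_bound:
  fixes f :: "'a \<Rightarrow> 'b::euclidean_space"
  assumes [measurable]: "f \<in> borel_measurable M" and "integrable M g" "AE x in M. norm (f x) powr p \<le> g x"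
  shows "p_integrable p M f"
  unfolding p_integrable_def
proof (intro conjI Bochner_Integration.integrable_bound[OF assms(2)])
  show "AE x in M. norm (norm (f x) powr p) \<le> norm (g x)"
    using assms(3) by eventually_elim auto
qed measurable

lemma p_integrable_add:
  fixes f g :: "'a \<Rightarrow> 'b::euclidean_space"
  assumes "0 < p" "p_integrable p M f" "p_integrable p M g"
  shows "p_integrable p M (\<lambda>x. f x + g x)"
proof (rule p_integrable_bound)
  show "integrable M (\<lambda>x. 2 powr p * (norm (f x) powr p + norm (g x) powr p))"
    using assms by (intro integrable_mult_right Bochner_Integration.integrable_add p_integrable_integrable)
qed (use assms norm_add_powr_le[OF assms(1)] in \<open>auto simp: p_integrable_def\<close>)

lemma p_integrable_scaleR:
  fixes f :: "'a \<Rightarrow> 'b::euclidean_space"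
  assumes "p_integrable p M f"
  shows "p_integrable p M (\<lambda>x. c *\<^sub>R f x)"
  using assms by (auto simp: p_integrable_def powr_mult)

lemma p_integrable_diff:
  fixes f g :: "'a \<Rightarrow> 'b::euclidean_space"
  assumes "0 < p" "p_integrable p M f" "p_integrable p M g"
  shows "p_integrable p M (\<lambda>x. f x - g x)"
  using p_integrable_add[OF assms(1,2) p_integrable_scaleR[OF assms(3), of "-1"]] by simp

lemma integral_norm_add_powr_le:
  fixes f g :: "'a \<Rightarrow> 'b::euclidean_space"
  assumes "0 < p" "p_integrable p M f" "p_integrable p M g"
  shows "(\<integral>x. norm (f x + g x) powr p \<partial>M) \<le>
    2 powr p * ((\<integral>x. norm (f x) powr p \<partial>M) + (\<integral>x. norm (g x) powr p \<partial>M))"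
proof -
  have "(\<integral>x. norm (f x + g x) powr p \<partial>M) \<le> (\<integral>x. 2 powr p * (norm (f x) powr p + norm (g x) powr p) \<partial>M)"
    by (intro integral_mono norm_add_powr_le[OF assms(1)] integrable_mult_right
        Bochner_Integration.integrable_add p_integrable_integrable p_integrable_add assms)
  also have "\<dots> = 2 powr p * ((\<integral>x. norm (f x) powr p \<partial>M) + (\<integral>x. norm (g x) powr p \<partial>M))"
    using assms(2,3) by (simp add: p_integrable_integrable)
  finally show ?thesis .
qed

lemma integral_powr_nonneg: "0 \<le> (\<integral>x. norm (f x) powr p \<partial>M)"
  by (intro integral_nonneg_AE) auto

subsection \<open>Pairing with the flux\<close>

lemma integrable_pflux_inner:
  fixes a T :: "'a \<Rightarrow> 'b::euclidean_space"
  assumes "1 < p" and a: "p_integrable p M a" and T: "p_integrable p M T"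
  shows "integrable M (\<lambda>x. pflux p (a x) \<bullet> T x)"
proof -
  have [measurable]: "a \<in> borel_measurable M" "T \<in> borel_measurable M"
    using a T by (auto simp: p_integrable_def)
  obtain C where C: "0 \<le> C" "\<And>(a::'b) b t. 0 \<le> t \<Longrightarrow>
       norm (pflux p a - pflux p b) * t \<le> 1 * (t powr p + norm b powr p) + C * norm (a - b) powr p"
    using assms(1) by (rule pflux_diff_absorb[of p 1]) (simp, rule that)
  show ?thesis
  proof (rule Bochner_Integration.integrable_bound)
    show "integrable M (\<lambda>x. norm (T x) powr p + C * norm (a x) powr p)"
      using a T by (auto simp: p_integrable_def)
    show "AE x in M. norm (pflux p (a x) \<bullet> T x) \<le> norm (norm (T x) powr p + C * norm (a x) powr p)"
    proof (rule AE_I2)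
      fix x
      have "norm (pflux p (a x) \<bullet> T x) \<le> norm (pflux p (a x) - pflux p 0) * norm (T x)"
        using Cauchy_Schwarz_ineq2[of "pflux p (a x)" "T x"] by simp
      also have "\<dots> \<le> norm (T x) powr p + C * norm (a x) powr p"
        using C(2)[of "norm (T x)" "a x" 0] by simp
      finally show "norm (pflux p (a x) \<bullet> T x) \<le> norm (norm (T x) powr p + C * norm (a x) powr p)"
        using C(1) by simp
    qed
  qed measurable
qed

text \<open>
  The constant depends on \<open>p\<close> and \<open>\<eta>\<close> alone. It can therefore serve a whole sequence of measures, such as those of
  the kernels.
\<close>

lemma pflux_inner_integral_diff:
  fixes p \<eta> :: real
  assumes "1 < p" "0 < \<eta>"
  obtains C where "0 \<le> C"
    "\<And>(M :: 'a measure) (a :: 'a \<Rightarrow> 'b::euclidean_space) b T.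
       p_integrable p M a \<Longrightarrow> p_integrable p M b \<Longrightarrow> p_integrable p M T \<Longrightarrow>
       \<bar>(\<integral>x. pflux p (a x) \<bullet> T x \<partial>M) - (\<integral>x. pflux p (b x) \<bullet> T x \<partial>M)\<bar> \<le>
       \<eta> * ((\<integral>x. norm (T x) powr p \<partial>M) + (\<integral>x. norm (b x) powr p \<partial>M)) + C * (\<integral>x. norm (a x - b x) powr p \<partial>M)"
proof -
  obtain C where C: "0 \<le> C" "\<And>(a::'b) b t. 0 \<le> t \<Longrightarrow>
       norm (pflux p a - pflux p b) * t \<le> \<eta> * (t powr p + norm b powr p) + C * norm (a - b) powr p"
    using assms by (rule pflux_diff_absorb) (assumption | rule that)+
  show thesis
  proof
    show "0 \<le> C" by fact
    fix M :: "'a measure" and a b T :: "'a \<Rightarrow> 'b"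
    assume a: "p_integrable p M a" and b: "p_integrable p M b" and T: "p_integrable p M T"
    have p: "0 < p" using assms by simp
    have d: "p_integrable p M (\<lambda>x. a x - b x)" by (rule p_integrable_diff[OF p a b])
    note i = integrable_pflux_inner[OF assms(1) a T] integrable_pflux_inner[OF assms(1) b T]
    have "\<bar>(\<integral>x. pflux p (a x) \<bullet> T x \<partial>M) - (\<integral>x. pflux p (b x) \<bullet> T x \<partial>M)\<bar> =
        \<bar>\<integral>x. (pflux p (a x) - pflux p (b x)) \<bullet> T x \<partial>M\<bar>"
      using i by (simp add: inner_diff_left)
    also have "\<dots> \<le> (\<integral>x. \<bar>(pflux p (a x) - pflux p (b x)) \<bullet> T x\<bar> \<partial>M)"
      by (rule integral_abs_bound)
    also have "\<dots> \<le> (\<integral>x. \<eta> * (norm (T x) powr p + norm (b x) powr p) + C * norm (a x - b x) powr p \<partial>M)"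
    proof (rule integral_mono)
      show "integrable M (\<lambda>x. \<bar>(pflux p (a x) - pflux p (b x)) \<bullet> T x\<bar>)"
        using i by (simp add: inner_diff_left)
      show "integrable M (\<lambda>x. \<eta> * (norm (T x) powr p + norm (b x) powr p) + C * norm (a x - b x) powr p)"
        using T b d by (simp add: p_integrable_integrable)
      fix x
      have "\<bar>(pflux p (a x) - pflux p (b x)) \<bullet> T x\<bar> \<le> norm (pflux p (a x) - pflux p (b x)) * norm (T x)"
        by (rule Cauchy_Schwarz_ineq2)
      also have "\<dots> \<le> \<eta> * (norm (T x) powr p + norm (b x) powr p) + C * norm (a x - b x) powr p"
        by (rule C(2)) simp
      finally show "\<bar>(pflux p (a x) - pflux p (b x)) \<bullet> T x\<bar> \<le>
          \<eta> * (norm (T x) powr p + norm (b x) powr p) + C * norm (a x - b x) powr p" .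
    qed
    also have "\<dots> = \<eta> * ((\<integral>x. norm (T x) powr p \<partial>M) + (\<integral>x. norm (b x) powr p \<partial>M)) + C * (\<integral>x. norm (a x - b x) powr p \<partial>M)"
      using T b d by (simp add: p_integrable_integrable)
    finally show "\<bar>(\<integral>x. pflux p (a x) \<bullet> T x \<partial>M) - (\<integral>x. pflux p (b x) \<bullet> T x \<partial>M)\<bar> \<le>
       \<eta> * ((\<integral>x. norm (T x) powr p \<partial>M) + (\<integral>x. norm (b x) powr p \<partial>M)) + C * (\<integral>x. norm (a x - b x) powr p \<partial>M)" .
  qed
qed

subsection \<open>Simple functions and translations\<close>

lemma simple_function_approx_Lp:
  fixes G :: "'a \<Rightarrow> 'b::euclidean_space"
  assumes "0 < p" and G: "p_integrable p M G" and "0 < \<eta>"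
  obtains \<Phi> where "simple_function M \<Phi>" "\<forall>x\<in>space M. norm (\<Phi> x) \<le> 2 * norm (G x)"
    "p_integrable p M \<Phi>" "(\<integral>x. norm (G x - \<Phi> x) powr p \<partial>M) < \<eta>"
proof -
  have [measurable]: "G \<in> borel_measurable M" using G by (simp add: p_integrable_def)
  obtain s where "\<forall>i. simple_function M (s i)" "\<forall>x\<in>space M. (\<lambda>i. s i x) \<longlonglongrightarrow> G x"
    "\<forall>i. \<forall>x\<in>space M. norm (s i x) \<le> 2 * norm (G x)"
    using borel_measurable_implies_sequence_metric[of G M 0] by (auto simp: dist_norm)
  then have s: "\<And>i. simple_function M (s i)" "\<And>x. x \<in> space M \<Longrightarrow> (\<lambda>i. s i x) \<longlonglongrightarrow> G x"
    "\<And>i x. x \<in> space M \<Longrightarrow> norm (s i x) \<le> 2 * norm (G x)" by auto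
  have [measurable]: "s i \<in> borel_measurable M" for i by (rule borel_measurable_simple_function[OF s(1)])
  have "(\<lambda>i. \<integral>x. norm (G x - s i x) powr p \<partial>M) \<longlonglongrightarrow> (\<integral>x. 0 \<partial>M)"
  proof (rule integral_dominated_convergence[where w = "\<lambda>x. 3 powr p * norm (G x) powr p"])
    show "AE x in M. (\<lambda>i. norm (G x - s i x) powr p) \<longlonglongrightarrow> 0"
    proof (rule AE_I2)
      fix x assume "x \<in> space M"
      then have "(\<lambda>i. norm (G x - s i x)) \<longlonglongrightarrow> norm (G x - G x)"
        by (intro tendsto_intros s)
      then show "(\<lambda>i. norm (G x - s i x) powr p) \<longlonglongrightarrow> 0"
        using assms(1) by (auto intro!: tendsto_zero_powrI)
    qed
    show "AE x in M. norm (norm (G x - s i x) powr p) \<le> 3 powr p * norm (G x) powr p" for i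
    proof (rule AE_I2)
      fix x assume "x \<in> space M"
      then have "norm (G x - s i x) \<le> 3 * norm (G x)"
        using norm_triangle_ineq4[of "G x" "s i x"] s(3)[of x i] by simp
      then have "norm (G x - s i x) powr p \<le> (3 * norm (G x)) powr p"
        using assms(1) by (intro powr_mono2) auto
      then show "norm (norm (G x - s i x) powr p) \<le> 3 powr p * norm (G x) powr p"
        by (simp add: powr_mult)
    qed
    show "integrable M (\<lambda>x. 3 powr p * norm (G x) powr p)"
      using G by (simp add: p_integrable_integrable)
  qed measurable
  then have "eventually (\<lambda>i. (\<integral>x. norm (G x - s i x) powr p \<partial>M) < \<eta>) sequentially"
    using \<open>0 < \<eta>\<close> by (auto intro: order_tendstoD)
  then obtain i where i: "(\<integral>x. norm (G x - s i x) powr p \<partial>M) < \<eta>"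
    by (auto simp: eventually_sequentially)
  have "p_integrable p M (s i)"
  proof (rule p_integrable_bound)
    show "integrable M (\<lambda>x. 2 powr p * norm (G x) powr p)"
      using G by (simp add: p_integrable_integrable)
    show "AE x in M. norm (s i x) powr p \<le> 2 powr p * norm (G x) powr p"
      using s(3) assms(1) by (auto simp flip: powr_mult intro!: AE_I2 powr_mono2)
  qed measurable
  with that[of "s i"] s(1,3) i show thesis by blast
qed

lemma finite_measure_simple_function_level:
  fixes \<Phi> :: "'a \<Rightarrow> 'b::euclidean_space"
  assumes "simple_function M \<Phi>" "p_integrable p M \<Phi>" "c \<noteq> 0"
  shows "\<Phi> -` {c} \<inter> space M \<in> sets M" "emeasure M (\<Phi> -` {c} \<inter> space M) < \<infinity>"
proof -
  show [measurable]: "\<Phi> -` {c} \<inter> space M \<in> sets M"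
    using assms(1) by (rule simple_functionD(2))
  have i: "integrable M (\<lambda>x. norm (\<Phi> x) powr p * indicator (\<Phi> -` {c} \<inter> space M) x)"
    using p_integrable_integrable[OF assms(2)]
    by (intro integrable_real_mult_indicator) auto
  have "integrable M (\<lambda>x. norm c powr p * indicator (\<Phi> -` {c} \<inter> space M) x)"
    by (rule Bochner_Integration.integrable_cong[THEN iffD1, OF refl _ i]) (auto simp: indicator_def)
  then have "integrable M (\<lambda>x. indicator (\<Phi> -` {c} \<inter> space M) x :: real)"
    using assms(3) by simp
  then show "emeasure M (\<Phi> -` {c} \<inter> space M) < \<infinity>"
    by (simp add: integrable_indicator_iff)
qed

lemma indicator_translation_continuous:
  fixes B :: "'a::euclidean_space set" and \<eta> :: real
  assumes B: "B \<in> sets borel" "emeasure lborel B < \<infinity>" and "0 < \<eta>"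
  obtains \<delta> where "0 < \<delta>"
    "\<forall>h. norm h \<le> \<delta> \<longrightarrow> (\<integral>x. \<bar>indicat_real B (x + h) - indicat_real B x\<bar> \<partial>lborel) \<le> \<eta>"
proof -
  have eta3: "0 < \<eta> / 3" using \<open>0 < \<eta>\<close> by simp
  obtain \<psi> where \<psi>: "\<psi> \<in> test_functions UNIV" "(\<integral>x. \<bar>indicat_real B x - \<psi> x\<bar> \<partial>lborel) < \<eta> / 3"
    by (rule indicator_approx_by_test_function[OF B open_UNIV subset_UNIV eta3]) blast
  let ?K = "unit_nbhd (csupp \<psi>)"
  have K: "compact ?K" by (rule compact_unit_nbhd[OF compact_csupp[OF \<psi>(1)]])
  obtain \<eta>' where \<eta>': "0 < \<eta>'" "\<eta>' * measure lborel ?K \<le> \<eta> / 3"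
    by (rule small_multiple[OF eta3, of "measure lborel ?K"]) auto
  obtain \<delta> where \<delta>: "0 < \<delta>" "\<delta> \<le> 1" "\<And>x h. norm h \<le> \<delta> \<Longrightarrow> norm (\<psi> (x + h) - \<psi> x) \<le> \<eta>'"
    using continuous_on_test_function[OF \<psi>(1)] compact_csupp[OF \<psi>(1)] zero_outside_csupp \<eta>'(1)
    by (rule uniform_continuity_of_compact_support) (assumption | rule that)+
  have [measurable]: "\<psi> \<in> borel_measurable borel" "B \<in> sets borel"
    using borel_measurable_continuous_onI[OF continuous_on_test_function[OF \<psi>(1)]] B by auto
  have \<psi>i: "integrable lborel \<psi>" by (rule test_function_integrable[OF \<psi>(1)])
  have Bi: "integrable lborel (\<lambda>x. indicat_real B x :: real)" using B by auto
  define f where "f x = indicat_real B x - \<psi> x" for x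
  have fi: "integrable lborel f" unfolding f_def using \<psi>i Bi by simp
  have [measurable]: "f \<in> borel_measurable borel" unfolding f_def by measurable
  show thesis
  proof (rule that[OF \<delta>(1)], intro allI impI)
    fix h :: 'a assume h: "norm h \<le> \<delta>"
    have fhi: "integrable lborel (\<lambda>x. f (x + h))" using fi lborel_integral_translate(2)[of f h] by simp
    have \<psi>hi: "integrable lborel (\<lambda>x. \<psi> (x + h))" using \<psi>i lborel_integral_translate(2)[of \<psi> h] by simp
    have Ki: "integrable lborel (\<lambda>x. \<eta>' * indicator ?K x)"
      using integrable_indicator_compact[OF K] by simp
    have le: "\<bar>\<psi> (x + h) - \<psi> x\<bar> \<le> \<eta>' * indicator ?K x" for x
    proof (cases "x \<in> ?K")
      case True
      then show ?thesis using \<delta>(3)[OF h, of x] by simp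
    next
      case False
      then have "x \<notin> csupp \<psi>" "x + h \<notin> csupp \<psi>"
        using unit_nbhdI[of x 0 "csupp \<psi>"] unit_nbhdI[of x h "csupp \<psi>"] h \<delta>(2) by auto
      then show ?thesis using zero_outside_csupp[of _ \<psi>] False by simp
    qed
    have "(\<integral>x. \<bar>indicat_real B (x + h) - indicat_real B x\<bar> \<partial>lborel) \<le>
        (\<integral>x. \<bar>f (x + h)\<bar> + \<bar>f x\<bar> + \<eta>' * indicator ?K x \<partial>lborel)"
    proof (rule integral_mono)
      have "indicat_real B (x + h) - indicat_real B x = f (x + h) - f x + (\<psi> (x + h) - \<psi> x)" for x
        by (simp add: f_def)
      note * = this
      show "integrable lborel (\<lambda>x. \<bar>indicat_real B (x + h) - indicat_real B x\<bar>)"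
        unfolding * using fi fhi \<psi>i \<psi>hi by simp
      show "\<bar>indicat_real B (x + h) - indicat_real B x\<bar> \<le> \<bar>f (x + h)\<bar> + \<bar>f x\<bar> + \<eta>' * indicator ?K x" for x
        unfolding * using le[of x] by linarith
    qed (use fi fhi Ki in auto)
    also have "\<dots> = (\<integral>x. \<bar>f (x + h)\<bar> \<partial>lborel) + (\<integral>x. \<bar>f x\<bar> \<partial>lborel) + \<eta>' * measure lborel ?K"
      using fi fhi Ki K by (simp add: borel_compact)
    also have "(\<integral>x. \<bar>f (x + h)\<bar> \<partial>lborel) = (\<integral>x. \<bar>f x\<bar> \<partial>lborel)"
      by (rule lborel_integral_translate(1)[of "\<lambda>x. \<bar>f x\<bar>"]) measurable
    also have "(\<integral>x. \<bar>f x\<bar> \<partial>lborel) + (\<integral>x. \<bar>f x\<bar> \<partial>lborel) + \<eta>' * measure lborel ?K \<le> \<eta>"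
      using \<psi>(2) \<eta>'(2) by (simp add: f_def)
    finally show "(\<integral>x. \<bar>indicat_real B (x + h) - indicat_real B x\<bar> \<partial>lborel) \<le> \<eta>" .
  qed
qed

lemma p_integrable_translate:
  fixes G :: "'a::euclidean_space \<Rightarrow> 'b::euclidean_space"
  assumes "p_integrable p lborel G"
  shows "p_integrable p lborel (\<lambda>x. G (x + h))"
    and "(\<integral>x. norm (G (x + h)) powr p \<partial>lborel) = (\<integral>x. norm (G x) powr p \<partial>lborel)"
proof -
  have [measurable]: "G \<in> borel_measurable borel" using assms by (simp add: p_integrable_def)
  show "p_integrable p lborel (\<lambda>x. G (x + h))"
    using assms lborel_integral_translate(2)[of "\<lambda>x. norm (G x) powr p" h]
    by (simp add: p_integrable_def)
  show "(\<integral>x. norm (G (x + h)) powr p \<partial>lborel) = (\<integral>x. norm (G x) powr p \<partial>lborel)"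
    by (rule lborel_integral_translate(1)[of "\<lambda>x. norm (G x) powr p"]) measurable
qed

text \<open>
  For simple functions the difference of two translates is bounded and nonzero only where the indicator of
  some level set changes; the general case follows by density.
\<close>

lemma simple_translation_continuous:
  fixes \<Phi> :: "'a::euclidean_space \<Rightarrow> 'b::euclidean_space"
  assumes "0 < p" "simple_function lborel \<Phi>" "p_integrable p lborel \<Phi>" "0 < \<eta>"
  obtains \<delta> where "0 < \<delta>"
    "\<forall>h. norm h \<le> \<delta> \<longrightarrow> (\<integral>x. norm (\<Phi> (x + h) - \<Phi> x) powr p \<partial>lborel) \<le> \<eta>"
proof -
  define S where "S = range \<Phi> - {0}"
  have fS: "finite S" using assms(2) by (simp add: simple_function_def S_def)
  define B where "B c = \<Phi> -` {c}" for c
  have B: "B c \<in> sets borel" "emeasure lborel (B c) < \<infinity>" if "c \<in> S" for c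
    using finite_measure_simple_function_level[OF assms(2,3), of c] that by (auto simp: B_def S_def)
  define m where "m = Max (insert 1 (norm ` S))"
  have m: "1 \<le> m" "\<And>x. norm (\<Phi> x) \<le> m"
  proof -
    have fin: "finite (insert 1 (norm ` S))" using fS by simp
    show "1 \<le> m" unfolding m_def by (rule Max_ge[OF fin]) simp
    show "norm (\<Phi> x) \<le> m" for x
    proof (cases "\<Phi> x = 0")
      case True
      then show ?thesis using \<open>1 \<le> m\<close> by simp
    next
      case False
      then show ?thesis unfolding m_def by (intro Max_ge[OF fin]) (auto simp: S_def)
    qed
  qed
  define A where "A = (2 * m) powr p"
  have A: "0 \<le> A" by (simp add: A_def)
  obtain \<eta>' where \<eta>': "0 < \<eta>'" "\<eta>' * (A * card S) \<le> \<eta>"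
    by (rule small_multiple[OF assms(4), of "A * card S"]) (use A in auto)
  have "\<exists>\<delta>>0. \<forall>h. norm h \<le> \<delta> \<longrightarrow> (\<integral>x. \<bar>indicat_real (B c) (x + h) - indicat_real (B c) x\<bar> \<partial>lborel) \<le> \<eta>'" if "c \<in> S" for c
    by (rule indicator_translation_continuous[OF B[OF that] \<eta>'(1)]) blast
  then obtain d where d: "\<And>c. c \<in> S \<Longrightarrow> 0 < d c"
    "\<And>c h. c \<in> S \<Longrightarrow> norm h \<le> d c \<Longrightarrow> (\<integral>x. \<bar>indicat_real (B c) (x + h) - indicat_real (B c) x\<bar> \<partial>lborel) \<le> \<eta>'"
    by metis
  define \<delta> where "\<delta> = Min (insert 1 (d ` S))"
  have "0 < \<delta>" unfolding \<delta>_def using fS d(1) by (subst Min_gr_iff) auto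
  moreover have "(\<integral>x. norm (\<Phi> (x + h) - \<Phi> x) powr p \<partial>lborel) \<le> \<eta>" if h: "norm h \<le> \<delta>" for h
  proof -
    have hd: "norm h \<le> d c" if "c \<in> S" for c
      using h that fS by (auto simp: \<delta>_def)
    have int: "integrable lborel (\<lambda>x. \<bar>indicat_real (B c) (x + h) - indicat_real (B c) x\<bar> :: real)" if "c \<in> S" for c
    proof -
      have [measurable]: "B c \<in> sets borel" using B(1)[OF that] .
      have i: "integrable lborel (\<lambda>x. indicat_real (B c) x :: real)" using B[OF that] by auto
      then have "integrable lborel (\<lambda>x. indicat_real (B c) (x + h) :: real)"
        using lborel_integral_translate(2)[of "\<lambda>x. indicat_real (B c) x :: real" h] by simp
      with i show ?thesis by simp
    qed
    have le: "norm (\<Phi> (x + h) - \<Phi> x) powr p \<le> A * (\<Sum>c\<in>S. \<bar>indicat_real (B c) (x + h) - indicat_real (B c) x\<bar>)" for x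
    proof (cases "\<Phi> (x + h) = \<Phi> x")
      case True
      then show ?thesis using A by (simp add: sum_nonneg)
    next
      case False
      then obtain c where c: "c \<in> S" "\<Phi> (x + h) = c \<or> \<Phi> x = c"
        unfolding S_def by (metis Diff_iff empty_iff insert_iff rangeI)
      have "1 = \<bar>indicat_real (B c) (x + h) - indicat_real (B c) x :: real\<bar>"
        using c(2) False by (auto simp: B_def indicator_def)
      also have "\<dots> \<le> (\<Sum>c\<in>S. \<bar>indicat_real (B c) (x + h) - indicat_real (B c) x\<bar>)"
        by (rule member_le_sum[OF c(1) _ fS]) simp
      finally have s: "1 \<le> (\<Sum>c\<in>S. \<bar>indicat_real (B c) (x + h) - indicat_real (B c) x :: real\<bar>)" .
      have "norm (\<Phi> (x + h) - \<Phi> x) \<le> 2 * m"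
        using norm_triangle_ineq4[of "\<Phi> (x + h)" "\<Phi> x"] m(2)[of x] m(2)[of "x + h"] by linarith
      then have "norm (\<Phi> (x + h) - \<Phi> x) powr p \<le> A * 1"
        unfolding A_def using assms(1) by (simp add: powr_mono2)
      also have "\<dots> \<le> A * (\<Sum>c\<in>S. \<bar>indicat_real (B c) (x + h) - indicat_real (B c) x\<bar>)"
        by (rule mult_left_mono[OF s A])
      finally show ?thesis .
    qed
    have "(\<integral>x. norm (\<Phi> (x + h) - \<Phi> x) powr p \<partial>lborel) \<le>
        (\<integral>x. A * (\<Sum>c\<in>S. \<bar>indicat_real (B c) (x + h) - indicat_real (B c) x\<bar>) \<partial>lborel)"
      by (intro integral_mono p_integrable_integrable p_integrable_diff assms p_integrable_translate le
          integrable_mult_right Bochner_Integration.integrable_sum int)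
    also have "\<dots> = A * (\<Sum>c\<in>S. \<integral>x. \<bar>indicat_real (B c) (x + h) - indicat_real (B c) x\<bar> \<partial>lborel)"
      using int by simp
    also have "\<dots> \<le> A * (\<Sum>c\<in>S. \<eta>')"
      by (intro mult_left_mono sum_mono d(2) hd A)
    also have "\<dots> \<le> \<eta>" using \<eta>'(2) by (simp add: mult_ac)
    finally show ?thesis .
  qed
  ultimately show thesis using that by blast
qed

lemma Lp_translation_continuous:
  fixes G :: "'a::euclidean_space \<Rightarrow> 'b::euclidean_space"
  assumes "0 < p" and G: "p_integrable p lborel G" and "0 < \<eta>"
  obtains \<delta> where "0 < \<delta>"
    "\<forall>h. norm h \<le> \<delta> \<longrightarrow> (\<integral>x. norm (G (x + h) - G x) powr p \<partial>lborel) \<le> \<eta>"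
proof -
  define A where "A = (2::real) powr p"
  have A: "0 \<le> A" by (simp add: A_def)
  obtain \<eta>' where \<eta>': "0 < \<eta>'" "\<eta>' * (A * (1 + A * 2)) \<le> \<eta>"
    by (rule small_multiple[OF assms(3), of "A * (1 + A * 2)"]) (use A in auto)
  obtain \<Phi> where \<Phi>: "simple_function lborel \<Phi>" "p_integrable p lborel \<Phi>"
    "(\<integral>x. norm (G x - \<Phi> x) powr p \<partial>lborel) < \<eta>'"
    by (rule simple_function_approx_Lp[OF assms(1) G \<eta>'(1)]) blast
  obtain \<delta> where \<delta>: "0 < \<delta>" "\<forall>h. norm h \<le> \<delta> \<longrightarrow> (\<integral>x. norm (\<Phi> (x + h) - \<Phi> x) powr p \<partial>lborel) \<le> \<eta>'"
    by (rule simple_translation_continuous[OF assms(1) \<Phi>(1,2) \<eta>'(1)]) blast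
  define f where "f x = G x - \<Phi> x" for x
  have f: "p_integrable p lborel f" unfolding f_def by (rule p_integrable_diff[OF assms(1) G \<Phi>(2)])
  show thesis
  proof (rule that[OF \<delta>(1)], intro allI impI)
    fix h :: 'a assume h: "norm h \<le> \<delta>"
    let ?I = "\<lambda>u::'a \<Rightarrow> 'b. (\<integral>x. norm (u x) powr p \<partial>lborel)"
    have pf: "p_integrable p lborel (\<lambda>x. f (x + h))" "p_integrable p lborel (\<lambda>x. - f x)"
      and p\<Phi>: "p_integrable p lborel (\<lambda>x. \<Phi> (x + h) - \<Phi> x)"
      using p_integrable_translate(1)[OF f] p_integrable_scaleR[OF f, of "-1"]
        p_integrable_diff[OF assms(1) p_integrable_translate(1)[OF \<Phi>(2)] \<Phi>(2)] by auto
    have "?I (\<lambda>x. G (x + h) - G x) = ?I (\<lambda>x. (\<Phi> (x + h) - \<Phi> x) + (f (x + h) + - f x))"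
      by (simp add: f_def algebra_simps)
    also have "\<dots> \<le> A * (?I (\<lambda>x. \<Phi> (x + h) - \<Phi> x) + ?I (\<lambda>x. f (x + h) + - f x))"
      unfolding A_def by (intro integral_norm_add_powr_le assms(1) p\<Phi> p_integrable_add pf)
    also have "\<dots> \<le> A * (\<eta>' + A * (?I (\<lambda>x. f (x + h)) + ?I (\<lambda>x. - f x)))"
      unfolding A_def using \<delta>(2) h
      by (intro mult_left_mono add_mono integral_norm_add_powr_le assms(1) pf) auto
    also have "\<dots> = A * (\<eta>' + A * (2 * ?I f))"
      by (simp add: p_integrable_translate(2)[OF f])
    also have "\<dots> \<le> A * (\<eta>' + A * (2 * \<eta>'))"
      using \<Phi>(3) A by (intro mult_left_mono add_mono) (auto simp: f_def)
    also have "\<dots> = \<eta>' * (A * (1 + A * 2))" by (simp add: algebra_simps)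
    also note \<eta>'(2)
    finally show "?I (\<lambda>x. G (x + h) - G x) \<le> \<eta>" .
  qed
qed

section \<open>Difference quotients of Sobolev functions\<close>

lemma (in pair_sigma_finite) integrable_from_fibres:
  fixes f :: "'a \<Rightarrow> 'b \<Rightarrow> 'c::{banach, second_countable_topology}"
  assumes [measurable]: "case_prod f \<in> borel_measurable (M1 \<Otimes>\<^sub>M M2)"
    and g: "integrable M1 g"
    and f: "\<And>x. x \<in> space M1 \<Longrightarrow> integrable M2 (f x)"
      "\<And>x. x \<in> space M1 \<Longrightarrow> (\<integral>y. norm (f x y) \<partial>M2) \<le> g x"
  shows "integrable (M1 \<Otimes>\<^sub>M M2) (case_prod f)"
proof (rule Fubini_integrable)
  have [measurable]: "(\<lambda>x. \<integral>y. norm (f x y) \<partial>M2) \<in> borel_measurable M1" by measurable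
  have "integrable M1 (\<lambda>x. \<integral>y. norm (f x y) \<partial>M2)"
  proof (rule Bochner_Integration.integrable_bound[OF g])
    show "AE x in M1. norm (\<integral>y. norm (f x y) \<partial>M2) \<le> norm (g x)"
    proof (rule AE_I2)
      fix x assume x: "x \<in> space M1"
      have "0 \<le> (\<integral>y. norm (f x y) \<partial>M2)" by (intro integral_nonneg_AE) auto
      with f(2)[OF x] show "norm (\<integral>y. norm (f x y) \<partial>M2) \<le> norm (g x)" by simp
    qed
  qed measurable
  then show "integrable M1 (\<lambda>x. \<integral>y. norm (case_prod f (x, y)) \<partial>M2)" by simp
  show "AE x in M1. integrable M2 (\<lambda>y. case_prod f (x, y))"
    using f(1) by (intro AE_I2) simp
qed measurable

definition borel_weak_grad :: "'a::euclidean_space set \<Rightarrow> ('a \<Rightarrow> real) \<Rightarrow> ('a \<Rightarrow> 'a) \<Rightarrow> bool" where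
  "borel_weak_grad \<Omega> U G \<longleftrightarrow> borel_locally_integrable \<Omega> U \<and> borel_locally_integrable \<Omega> G \<and>
     (\<forall>\<psi>\<in>test_functions \<Omega>. \<forall>b. (\<integral>x. U x * (tgrad \<psi> x \<bullet> b) \<partial>lborel) = - (\<integral>x. (G x \<bullet> b) * \<psi> x \<partial>lborel))"

lemma le_one_plus_powr: "1 < p \<Longrightarrow> 0 \<le> t \<Longrightarrow> t \<le> 1 + t powr p" for t p :: real
  using le_scale_plus_powr[of p 1 t] by simp

lemma p_integrable_times_bounded:
  fixes f :: "'a::euclidean_space \<Rightarrow> 'b::euclidean_space"
  assumes "1 < p" and f: "p_integrable p lborel f" and K: "compact K"
    and g [measurable]: "g \<in> borel_measurable borel" and "0 \<le> B" and le: "\<And>x. \<bar>g x\<bar> \<le> B * indicator K x"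
  shows "integrable lborel (\<lambda>x. g x *\<^sub>R f x)"
    and "(\<integral>x. norm (g x *\<^sub>R f x) \<partial>lborel) \<le> B * (measure lborel K + (\<integral>x. norm (f x) powr p \<partial>lborel))"
proof -
  have [measurable]: "f \<in> borel_measurable borel" using f by (simp add: p_integrable_def)
  let ?w = "\<lambda>x. B * (indicator K x + norm (f x) powr p)"
  have wi: "integrable lborel ?w"
    using f integrable_indicator_compact[OF K] by (simp add: p_integrable_integrable)
  have w: "norm (g x *\<^sub>R f x) \<le> ?w x" for x
  proof (cases "x \<in> K")
    case True
    have "norm (g x *\<^sub>R f x) \<le> B * (1 + norm (f x) powr p)"
      unfolding norm_scaleR using le[of x] True \<open>0 \<le> B\<close> le_one_plus_powr[OF assms(1)]
      by (intro mult_mono) auto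
    then show ?thesis using True by simp
  next
    case False
    then have "g x = 0" using le[of x] by simp
    then show ?thesis using \<open>0 \<le> B\<close> by simp
  qed
  show i: "integrable lborel (\<lambda>x. g x *\<^sub>R f x)"
    by (rule Bochner_Integration.integrable_bound[OF wi], measurable)
       (intro AE_I2 order_trans[OF w], simp)
  have "(\<integral>x. norm (g x *\<^sub>R f x) \<partial>lborel) \<le> (\<integral>x. ?w x \<partial>lborel)"
    by (rule integral_mono[OF integrable_norm[OF i] wi w])
  also have "\<dots> = B * (measure lborel K + (\<integral>x. norm (f x) powr p \<partial>lborel))"
    using f integrable_indicator_compact[OF K] K by (simp add: p_integrable_integrable borel_compact)
  finally show "(\<integral>x. norm (g x *\<^sub>R f x) \<partial>lborel) \<le> B * (measure lborel K + (\<integral>x. norm (f x) powr p \<partial>lborel))" .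
qed

lemma p_integrable_imp_borel_locally_integrable:
  fixes f :: "'a::euclidean_space \<Rightarrow> 'b::euclidean_space"
  assumes "1 < p" "p_integrable p lborel f"
  shows "borel_locally_integrable \<Omega> f"
  unfolding borel_locally_integrable_def
proof (intro conjI allI impI)
  show "f \<in> borel_measurable borel" using assms by (simp add: p_integrable_def)
  fix K :: "'a set" assume "compact K \<and> K \<subseteq> \<Omega>"
  then show "integrable lborel (\<lambda>x. indicat_real K x *\<^sub>R f x)"
    using assms by (intro p_integrable_times_bounded(1)[of p f K _ 1]) (auto intro: borel_measurable_indicator borel_compact)
qed

lemma borel_locally_integrable_diff:
  fixes f g :: "'a::euclidean_space \<Rightarrow> 'b::euclidean_space"
  assumes "borel_locally_integrable \<Omega> f" "borel_locally_integrable \<Omega> g"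
  shows "borel_locally_integrable \<Omega> (\<lambda>x. f x - g x)"
  using assms unfolding borel_locally_integrable_def
  by (auto simp: scaleR_diff_right intro: Bochner_Integration.integrable_diff)

text \<open>
  Testing with \<open>\<psi>\<close> moves the difference onto \<open>\<psi>\<close>, where the fundamental theorem of calculus applies, and
  Fubini's theorem together with the definition of the weak gradient moves the derivative back.
\<close>

lemma difference_eq_integral_of_weak_grad:
  fixes U :: "'a::euclidean_space \<Rightarrow> real" and G :: "'a \<Rightarrow> 'a"
  assumes p: "1 < p" and U: "p_integrable p lborel U" and G: "p_integrable p lborel G"
    and weak: "borel_weak_grad UNIV U G"
  shows "AE x in lborel. U x - U (x - h) = (\<integral>t. indicator {0..1} t * (G (x - t *\<^sub>R h) \<bullet> h) \<partial>lborel)"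
proof -
  have [measurable]: "U \<in> borel_measurable borel" "G \<in> borel_measurable borel"
    using U G by (auto simp: p_integrable_def)
  define J where "J x = (\<integral>t. indicator {0..1} t * (G (x - t *\<^sub>R h) \<bullet> h) \<partial>lborel)" for x
  have Jm [measurable]: "J \<in> borel_measurable borel" unfolding J_def by measurable
  have unit: "integrable lborel (\<lambda>t::real. indicator {0..1} t * c)" for c :: real by simp
  \<comment> \<open>Joint integrability of \<open>G(x - t h) \<bullet> h\<close> against a bounded weight of compact support.\<close>
  have A: "integrable (lborel \<Otimes>\<^sub>M lborel) (\<lambda>(t, x). indicator {0..1::real} t * (g x * (G (x - t *\<^sub>R h) \<bullet> h)))"
    if [measurable]: "g \<in> borel_measurable borel" and K: "compact K" and B: "0 \<le> B"
      and le: "\<And>x. \<bar>g x\<bar> \<le> B * indicator K x" for g :: "'a \<Rightarrow> real" and K B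
  proof (rule lborel_pair.integrable_from_fibres)
    let ?C = "B * (measure lborel K + (\<integral>x. norm (G x) powr p \<partial>lborel)) * norm h"
    show "integrable lborel (\<lambda>t::real. indicator {0..1} t * ?C)" by (rule unit)
    fix t :: real
    have Gt: "p_integrable p lborel (\<lambda>x. G (x - t *\<^sub>R h))"
      using p_integrable_translate(1)[OF G, of "- (t *\<^sub>R h)"] by simp
    have "(\<integral>x. norm (G (x - t *\<^sub>R h)) powr p \<partial>lborel) = (\<integral>x. norm (G x) powr p \<partial>lborel)"
      using p_integrable_translate(2)[OF G, of "- (t *\<^sub>R h)"] by simp
    note * = p_integrable_times_bounded[OF p Gt K that(1) B le, unfolded this]
    have i: "integrable lborel (\<lambda>x. g x * (G (x - t *\<^sub>R h) \<bullet> h))"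
      using integrable_inner_left[OF *(1), of h] by simp
    then show "integrable lborel (\<lambda>x. indicator {0..1::real} t * (g x * (G (x - t *\<^sub>R h) \<bullet> h)))" by simp
    have "(\<integral>x. norm (g x * (G (x - t *\<^sub>R h) \<bullet> h)) \<partial>lborel) \<le> (\<integral>x. norm (g x *\<^sub>R G (x - t *\<^sub>R h)) * norm h \<partial>lborel)"
    proof (rule integral_mono)
      show "norm (g x * (G (x - t *\<^sub>R h) \<bullet> h)) \<le> norm (g x *\<^sub>R G (x - t *\<^sub>R h)) * norm h" for x
        using Cauchy_Schwarz_ineq2[of "g x *\<^sub>R G (x - t *\<^sub>R h)" h] by simp
    qed (use integrable_norm[OF i] integrable_norm[OF *(1)] in auto)
    also have "\<dots> \<le> ?C" using *(2) by (simp add: mult_right_mono)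
    finally have "indicator {0..1::real} t * (\<integral>x. norm (g x * (G (x - t *\<^sub>R h) \<bullet> h)) \<partial>lborel) \<le> indicator {0..1::real} t * ?C"
      by (rule mult_left_mono) auto
    then show "(\<integral>x. norm (indicator {0..1::real} t * (g x * (G (x - t *\<^sub>R h) \<bullet> h))) \<partial>lborel) \<le> indicator {0..1} t * ?C"
      by (simp add: abs_mult)
  qed measurable
  have J_ind: "integrable lborel (\<lambda>x. indicator K x *\<^sub>R J x)" if "compact K" for K
  proof -
    have "integrable lborel (\<lambda>x. \<integral>t. indicator {0..1} t * (indicator K x * (G (x - t *\<^sub>R h) \<bullet> h)) \<partial>lborel)"
      using that by (intro lborel_pair.integrable_snd A[of _ K 1]) (auto intro: borel_measurable_indicator borel_compact)
    also have "(\<lambda>x. \<integral>t. indicator {0..1} t * (indicator K x * (G (x - t *\<^sub>R h) \<bullet> h)) \<partial>lborel) = (\<lambda>x. indicator K x *\<^sub>R J x)"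
      by (simp add: J_def mult.left_commute)
    finally show ?thesis .
  qed
  have J_loc: "borel_locally_integrable UNIV J"
    using J_ind by (auto simp: borel_locally_integrable_def)
  have Uh: "p_integrable p lborel (\<lambda>x. U (x - h))" using p_integrable_translate(1)[OF U, of "- h"] by simp
  have D_loc: "borel_locally_integrable UNIV (\<lambda>x. U x - U (x - h))"
    using p by (intro p_integrable_imp_borel_locally_integrable[of p] p_integrable_diff U Uh) auto
  have "AE x in lborel. x \<in> UNIV \<longrightarrow> (U x - U (x - h)) - J x = 0"
  proof (rule zero_AE_if_orthogonal_to_test_functions)
    show "borel_locally_integrable UNIV (\<lambda>x. (U x - U (x - h)) - J x)"
      by (rule borel_locally_integrable_diff[OF D_loc J_loc])
    fix \<psi> :: "'a \<Rightarrow> real" assume \<psi>: "\<psi> \<in> test_functions UNIV"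
    have \<psi>c: "continuous_on UNIV \<psi>" "continuous_on UNIV (tgrad \<psi>)"
      using continuous_on_test_function[OF \<psi>] continuous_on_tgrad[OF \<psi>] by auto
    then have [measurable]: "\<psi> \<in> borel_measurable borel" "tgrad \<psi> \<in> borel_measurable borel"
      by (auto intro: borel_measurable_continuous_onI)
    let ?S = "csupp \<psi>"
    have S: "compact ?S" by (rule compact_csupp[OF \<psi>])
    obtain B where B: "0 < B" "\<And>x. norm (\<psi> x) \<le> B"
      using \<psi>c(1) S zero_outside_csupp by (rule compact_support_bounded) (assumption | rule that)+
    obtain B' where B': "0 < B'" "\<And>x. norm (tgrad \<psi> x) \<le> B'"
      using \<psi>c(2) S tgrad_zero_outside_csupp[OF \<psi>] by (rule compact_support_bounded) (assumption | rule that)+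
    have \<psi>le: "\<bar>\<psi> x\<bar> \<le> B * indicator ?S x" for x
      using B(2)[of x] zero_outside_csupp[of x \<psi>] by (cases "x \<in> ?S") auto
    define L where "L = {x + y |x y. x \<in> ?S \<and> y \<in> cball (0::'a) (norm h)}"
    have L: "compact L" unfolding L_def by (rule compact_sums[OF S compact_cball])
    have gle: "\<bar>tgrad \<psi> (x + t *\<^sub>R h) \<bullet> h\<bar> \<le> B' * norm h * indicator L x" if "t \<in> {0..1}" for x t
    proof (cases "x + t *\<^sub>R h \<in> ?S")
      case True
      have "x = (x + t *\<^sub>R h) + - (t *\<^sub>R h)" "norm (- (t *\<^sub>R h)) \<le> norm h"
        using that by (auto simp: mult_left_le_one_le)
      then have "x \<in> L" unfolding L_def using True by (metis (mono_tags, lifting) mem_Collect_eq mem_cball_0)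
      moreover have "\<bar>tgrad \<psi> (x + t *\<^sub>R h) \<bullet> h\<bar> \<le> norm (tgrad \<psi> (x + t *\<^sub>R h)) * norm h"
        by (rule Cauchy_Schwarz_ineq2)
      moreover have "\<dots> \<le> B' * norm h" by (intro mult_right_mono B') auto
      ultimately show ?thesis by simp
    next
      case False
      then show ?thesis using tgrad_zero_outside_csupp[OF \<psi> False] B'(1) by simp
    qed
    \<comment> \<open>The same for \<open>U(x)\<close> against the derivative of a translate of \<open>\<psi>\<close>.\<close>
    have C: "integrable (lborel \<Otimes>\<^sub>M lborel) (\<lambda>(t, x). indicator {0..1::real} t * ((tgrad \<psi> (x + t *\<^sub>R h) \<bullet> h) * U x))"
    proof (rule lborel_pair.integrable_from_fibres)
      let ?C = "B' * norm h * (measure lborel L + (\<integral>x. norm (U x) powr p \<partial>lborel))"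
      show "integrable lborel (\<lambda>t::real. indicator {0..1} t * ?C)" by (rule unit)
      fix t :: real
      show "integrable lborel (\<lambda>x. indicator {0..1::real} t * ((tgrad \<psi> (x + t *\<^sub>R h) \<bullet> h) * U x))"
        "(\<integral>x. norm (indicator {0..1::real} t * ((tgrad \<psi> (x + t *\<^sub>R h) \<bullet> h) * U x)) \<partial>lborel) \<le> indicator {0..1} t * ?C"
        using p_integrable_times_bounded[OF p U L, of "\<lambda>x. tgrad \<psi> (x + t *\<^sub>R h) \<bullet> h" "B' * norm h"]
          gle[of t] B'(1) by (cases "t \<in> {0..1}"; simp)+
    qed measurable
    have FTC: "(\<integral>t. indicator {0..1} t * (tgrad \<psi> (x + t *\<^sub>R h) \<bullet> h) \<partial>lborel) = \<psi> (x + h) - \<psi> x" for x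
    proof -
      have "(\<integral>t. (tgrad \<psi> (x + t *\<^sub>R h) \<bullet> h) * indicator {0..1} t \<partial>lborel) = \<psi> (x + 1 *\<^sub>R h) - \<psi> (x + 0 *\<^sub>R h)"
      proof (rule integral_FTC_Icc_real)
        fix t :: real
        have "((\<lambda>t. x + t *\<^sub>R h) has_derivative (\<lambda>s. s *\<^sub>R h)) (at t)"
          by (auto intro!: derivative_eq_intros)
        from has_derivative_compose[OF this test_function_has_derivative[OF \<psi>]]
        show "((\<lambda>t. \<psi> (x + t *\<^sub>R h)) has_real_derivative tgrad \<psi> (x + t *\<^sub>R h) \<bullet> h) (at t)"
          by (simp add: has_field_derivative_def mult.commute[of _ "tgrad \<psi> (x + t *\<^sub>R h) \<bullet> h"])
        have "continuous_on UNIV (\<lambda>t. tgrad \<psi> (x + t *\<^sub>R h) \<bullet> h)"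
          by (intro continuous_intros continuous_on_compose2[OF \<psi>c(2)]) auto
        then show "isCont (\<lambda>t. tgrad \<psi> (x + t *\<^sub>R h) \<bullet> h) t"
          by (simp add: continuous_on_eq_continuous_at)
      qed simp
      then show ?thesis by (simp add: mult.commute)
    qed
    have \<psi>h: "(\<lambda>x. \<psi> (x + t *\<^sub>R h)) \<in> test_functions UNIV" "tgrad (\<lambda>x. \<psi> (x + t *\<^sub>R h)) x = tgrad \<psi> (x + t *\<^sub>R h)" for t x
      by (rule test_function_translate[OF \<psi>])+
    have i1: "integrable lborel (\<lambda>x. \<psi> x * U x)"
      using p_integrable_times_bounded(1)[OF p U S _ _ \<psi>le] B(1) by simp
    have i2: "integrable lborel (\<lambda>x. \<psi> x * U (x - h))"
      using p_integrable_times_bounded(1)[OF p Uh S _ _ \<psi>le] B(1) by simp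
    have i3: "integrable lborel (\<lambda>x. \<psi> x * J x)"
      using borel_locally_integrable_times_test[OF J_loc \<psi>] by simp
    have shift: "(\<integral>x. \<psi> x * U (x - h) \<partial>lborel) = (\<integral>x. \<psi> (x + h) * U x \<partial>lborel)"
      using lborel_integral_translate(1)[of "\<lambda>x. \<psi> x * U (x - h)" h] by simp
    have i4: "integrable lborel (\<lambda>x. \<psi> (x + h) * U x)"
      using lborel_integral_translate(2)[of "\<lambda>x. \<psi> x * U (x - h)" h] i2 by simp
    have "(\<integral>x. \<psi> x * J x \<partial>lborel) = (\<integral>x. \<integral>t. indicator {0..1} t * (\<psi> x * (G (x - t *\<^sub>R h) \<bullet> h)) \<partial>lborel \<partial>lborel)"
      by (simp add: J_def mult.left_commute)
    also have "\<dots> = (\<integral>t. \<integral>x. indicator {0..1::real} t * (\<psi> x * (G (x - t *\<^sub>R h) \<bullet> h)) \<partial>lborel \<partial>lborel)"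
      using B(1) by (intro lborel_pair.Fubini_integral A[of \<psi> ?S B] S \<psi>le) auto
    also have "\<dots> = (\<integral>t. \<integral>x. - (indicator {0..1::real} t * ((tgrad \<psi> (x + t *\<^sub>R h) \<bullet> h) * U x)) \<partial>lborel \<partial>lborel)"
    proof (rule Bochner_Integration.integral_cong[OF refl])
      fix t :: real
      have "(\<integral>x. \<psi> x * (G (x - t *\<^sub>R h) \<bullet> h) \<partial>lborel) = (\<integral>x. \<psi> (x + t *\<^sub>R h) * (G x \<bullet> h) \<partial>lborel)"
        using lborel_integral_translate(1)[of "\<lambda>x. \<psi> x * (G (x - t *\<^sub>R h) \<bullet> h)" "t *\<^sub>R h"] by simp
      also have "\<dots> = - (\<integral>x. (tgrad \<psi> (x + t *\<^sub>R h) \<bullet> h) * U x \<partial>lborel)"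
      proof -
        have "(\<integral>x. U x * (tgrad (\<lambda>x. \<psi> (x + t *\<^sub>R h)) x \<bullet> h) \<partial>lborel) = - (\<integral>x. (G x \<bullet> h) * \<psi> (x + t *\<^sub>R h) \<partial>lborel)"
          using weak \<psi>h(1)[of t] unfolding borel_weak_grad_def by blast
        then show ?thesis by (simp add: \<psi>h(2) mult.commute)
      qed
      finally show "(\<integral>x. indicator {0..1} t * (\<psi> x * (G (x - t *\<^sub>R h) \<bullet> h)) \<partial>lborel) =
          (\<integral>x. - (indicator {0..1} t * ((tgrad \<psi> (x + t *\<^sub>R h) \<bullet> h) * U x)) \<partial>lborel)" by simp
    qed
    also have "\<dots> = - (\<integral>t. \<integral>x. indicator {0..1::real} t * ((tgrad \<psi> (x + t *\<^sub>R h) \<bullet> h) * U x) \<partial>lborel \<partial>lborel)"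
      by simp
    also have "(\<integral>t. \<integral>x. indicator {0..1::real} t * ((tgrad \<psi> (x + t *\<^sub>R h) \<bullet> h) * U x) \<partial>lborel \<partial>lborel) =
        (\<integral>x. \<integral>t. indicator {0..1::real} t * ((tgrad \<psi> (x + t *\<^sub>R h) \<bullet> h) * U x) \<partial>lborel \<partial>lborel)"
      by (rule lborel_pair.Fubini_integral[symmetric, OF C])
    also have "\<dots> = (\<integral>x. (\<psi> (x + h) - \<psi> x) * U x \<partial>lborel)"
      by (simp add: mult.assoc[symmetric] FTC)
    also have "- \<dots> = (\<integral>x. \<psi> x * U x \<partial>lborel) - (\<integral>x. \<psi> (x + h) * U x \<partial>lborel)"
      using i1 i4 by (simp add: left_diff_distrib)
    finally have "(\<integral>x. \<psi> x * U x \<partial>lborel) - (\<integral>x. \<psi> x * U (x - h) \<partial>lborel) - (\<integral>x. \<psi> x * J x \<partial>lborel) = 0"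
      by (simp add: shift)
    moreover have "(\<lambda>x. (U x - U (x - h) - J x) * \<psi> x) = (\<lambda>x. \<psi> x * U x - \<psi> x * U (x - h) - \<psi> x * J x)"
      by (auto simp: algebra_simps)
    ultimately show "(\<integral>x. (U x - U (x - h) - J x) * \<psi> x \<partial>lborel) = 0"
      using i1 i2 i3 by simp
  qed auto
  then show ?thesis by (simp add: J_def)
qed

text \<open>
  Jensen's inequality up to a constant: the bound \<open>f \<le> m/2 + (m/2)\<^sup>1\<^sup>-\<^sup>p f\<^sup>p\<close> is integrated with \<open>m\<close> the mean
  of \<open>f\<close>.
\<close>

lemma unit_interval_mean_powr_le:
  fixes f :: "real \<Rightarrow> real"
  assumes "1 < p" and [measurable]: "f \<in> borel_measurable borel" and f: "\<And>t. 0 \<le> f t"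
    and i: "integrable lborel (\<lambda>t. indicator {0..1} t * f t powr p)"
  shows "integrable lborel (\<lambda>t. indicator {0..1} t * f t)"
    and "(\<integral>t. indicator {0..1} t * f t \<partial>lborel) powr p \<le> 2 powr p * (\<integral>t. indicator {0..1} t * f t powr p \<partial>lborel)"
proof -
  let ?I = "indicat_real {0..1::real}"
  have Ii: "integrable lborel ?I" by (rule integrable_indicator_compact) simp
  show fi: "integrable lborel (\<lambda>t. ?I t * f t)"
  proof (rule Bochner_Integration.integrable_bound)
    show "integrable lborel (\<lambda>t. ?I t + ?I t * f t powr p)" using i Ii by (rule Bochner_Integration.integrable_add[rotated])
    show "AE t in lborel. norm (?I t * f t) \<le> norm (?I t + ?I t * f t powr p)"
      using f le_one_plus_powr[OF assms(1) f] by (auto simp: indicator_def abs_le_iff)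
  qed measurable
  define m where "m = (\<integral>t. ?I t * f t \<partial>lborel)"
  define s where "s = (\<integral>t. ?I t * f t powr p \<partial>lborel)"
  have m0: "0 \<le> m" unfolding m_def using f by (intro integral_nonneg_AE) (auto simp: indicator_def)
  show "m powr p \<le> 2 powr p * s"
  proof (cases "m = 0")
    case True
    have "0 \<le> s" unfolding s_def by (intro integral_nonneg_AE) (auto simp: indicator_def)
    then show ?thesis using True by simp
  next
    case False
    then have m: "0 < m / 2" using m0 by simp
    have "m \<le> (\<integral>t. m / 2 * ?I t + (m / 2) powr (1 - p) * (?I t * f t powr p) \<partial>lborel)"
      unfolding m_def
    proof (rule integral_mono[OF fi])
      show "integrable lborel (\<lambda>t. integral\<^sup>L lborel (\<lambda>t. ?I t * f t) / 2 * ?I t +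
          (integral\<^sup>L lborel (\<lambda>t. ?I t * f t) / 2) powr (1 - p) * (?I t * f t powr p))"
        using i by simp
      fix t
      show "?I t * f t \<le> integral\<^sup>L lborel (\<lambda>t. ?I t * f t) / 2 * ?I t +
          (integral\<^sup>L lborel (\<lambda>t. ?I t * f t) / 2) powr (1 - p) * (?I t * f t powr p)"
        using le_scale_plus_powr[OF assms(1) m f, of t] by (simp add: indicator_def m_def)
    qed
    also have "\<dots> = m / 2 + (m / 2) powr (1 - p) * s"
      using i by (simp add: s_def)
    finally have "m / 2 \<le> (m / 2) powr (1 - p) * s" by simp
    then have "(m / 2) powr (p - 1) * (m / 2) \<le> (m / 2) powr (p - 1) * ((m / 2) powr (1 - p) * s)"
      by (rule mult_left_mono) simp
    also have "(m / 2) powr (p - 1) * (m / 2) = (m / 2) powr p"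
      using powr_mult_self[of "m / 2" "p - 1"] m by simp
    also have "(m / 2) powr (p - 1) * ((m / 2) powr (1 - p) * s) = s"
      using m by (simp add: mult.assoc[symmetric] powr_add[symmetric])
    finally have "2 powr p * (m / 2) powr p \<le> 2 powr p * s" by simp
    then show ?thesis using m0 by (simp add: powr_mult[symmetric])
  qed
qed

text \<open>
  The error is the mean over \<open>t \<in> [0, 1]\<close> of \<open>(G(x - t h) - G(x)) \<bullet> h\<close>, and translations are continuous in \<open>L\<^sup>p\<close>.
\<close>

lemma difference_quotient_Lp:
  fixes U :: "'a::euclidean_space \<Rightarrow> real" and G :: "'a \<Rightarrow> 'a"
  assumes p: "1 < p" and U: "p_integrable p lborel U" and G: "p_integrable p lborel G"
    and weak: "borel_weak_grad UNIV U G" and "0 < \<eta>"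
  obtains \<delta> where "0 < \<delta>" "\<forall>h. norm h \<le> \<delta> \<longrightarrow>
    (\<integral>x. norm (U x - U (x - h) - G x \<bullet> h) powr p \<partial>lborel) \<le> \<eta> * norm h powr p"
proof -
  have p0: "0 < p" using p by simp
  have [measurable]: "U \<in> borel_measurable borel" "G \<in> borel_measurable borel"
    using U G by (auto simp: p_integrable_def)
  obtain \<eta>' where \<eta>': "0 < \<eta>'" "\<eta>' * 2 powr p \<le> \<eta>"
    by (rule small_multiple[OF assms(5), of "2 powr p"]) auto
  obtain \<delta> where \<delta>: "0 < \<delta>" "\<forall>k. norm k \<le> \<delta> \<longrightarrow> (\<integral>x. norm (G (x + k) - G x) powr p \<partial>lborel) \<le> \<eta>'"
    by (rule Lp_translation_continuous[OF p0 G \<eta>'(1)]) blast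
  have "(\<integral>x. norm (U x - U (x - h) - G x \<bullet> h) powr p \<partial>lborel) \<le> \<eta> * norm h powr p" if h: "norm h \<le> \<delta>" for h
  proof -
    let ?I = "indicat_real {0..1::real}"
    define f where "f t x = norm (G (x - t *\<^sub>R h) - G x)" for t x
    have [measurable]: "case_prod f \<in> borel_measurable (lborel \<Otimes>\<^sub>M lborel)"
      unfolding f_def by measurable
    have fx: "f t \<in> borel_measurable borel" for t unfolding f_def by measurable
    have ft: "(\<lambda>t. f t x) \<in> borel_measurable borel" for x unfolding f_def by measurable
    have Gt: "p_integrable p lborel (\<lambda>x. G (x - t *\<^sub>R h) - G x)" for t
      using p_integrable_diff[OF p0 p_integrable_translate(1)[OF G, of "- (t *\<^sub>R h)"] G] by simp
    have fle: "(\<integral>x. f t x powr p \<partial>lborel) \<le> \<eta>'" if "t \<in> {0..1}" for t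
    proof -
      have "norm (- (t *\<^sub>R h)) \<le> norm h" using that by (auto simp: mult_left_le_one_le)
      then show ?thesis using \<delta>(2) h by (force simp: f_def dest: spec[of _ "- (t *\<^sub>R h)"])
    qed
    have fint: "integrable (lborel \<Otimes>\<^sub>M lborel) (\<lambda>(t, x). ?I t * f t x powr p)"
    proof (rule lborel_pair.integrable_from_fibres)
      show "integrable lborel (\<lambda>t::real. ?I t * \<eta>')" by simp
      fix t :: real
      show "integrable lborel (\<lambda>x. ?I t * f t x powr p)"
        using p_integrable_integrable[OF Gt] by (simp add: f_def)
      show "(\<integral>x. norm (?I t * f t x powr p) \<partial>lborel) \<le> ?I t * \<eta>'"
        using fle[of t] by (cases "t \<in> {0..1}") (auto simp: abs_mult)
    qed measurable
    have bound: "(\<integral>x. \<integral>t. ?I t * f t x powr p \<partial>lborel \<partial>lborel) \<le> \<eta>'"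
    proof -
      have "(\<integral>x. \<integral>t. ?I t * f t x powr p \<partial>lborel \<partial>lborel) = (\<integral>t. \<integral>x. ?I t * f t x powr p \<partial>lborel \<partial>lborel)"
        by (rule lborel_pair.Fubini_integral[OF fint])
      also have "\<dots> \<le> (\<integral>t. ?I t * \<eta>' \<partial>lborel)"
      proof (rule integral_mono)
        show "integrable lborel (\<lambda>t. \<integral>x. ?I t * f t x powr p \<partial>lborel)" by (rule lborel_pair.integrable_fst[OF fint])
        show "(\<integral>x. ?I t * f t x powr p \<partial>lborel) \<le> ?I t * \<eta>'" for t
          using fle[of t] by (cases "t \<in> {0..1}") auto
      qed simp
      finally show ?thesis by simp
    qed
    let ?D = "\<lambda>x. norm (U x - U (x - h) - G x \<bullet> h) powr p"
    let ?R = "\<lambda>x. norm h powr p * (2 powr p * (\<integral>t. ?I t * f t x powr p \<partial>lborel))"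
    have AE: "AE x in lborel. ?D x \<le> ?R x"
      using difference_eq_integral_of_weak_grad[OF p U G weak, of h] lborel_pair.AE_integrable_snd[OF fint]
    proof eventually_elim
      case (elim x)
      note * = unit_interval_mean_powr_le[OF p ft _ elim(2)]
      have f0: "0 \<le> f t x" for t by (simp add: f_def)
      have i1: "integrable lborel (\<lambda>t. ?I t * f t x)" by (rule *(1)[OF f0])
      have i2: "integrable lborel (\<lambda>t. ?I t * ((G (x - t *\<^sub>R h) - G x) \<bullet> h))"
      proof (rule Bochner_Integration.integrable_bound)
        show "integrable lborel (\<lambda>t. ?I t * f t x * norm h)" using i1 by simp
        have "\<bar>(G (x - t *\<^sub>R h) - G x) \<bullet> h\<bar> \<le> f t x * norm h" for t
          unfolding f_def by (rule Cauchy_Schwarz_ineq2)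
        then show "AE t in lborel. norm (?I t * ((G (x - t *\<^sub>R h) - G x) \<bullet> h)) \<le> norm (?I t * f t x * norm h)"
          using f0 by (auto simp: indicator_def)
      qed measurable
      have "?I t * (G (x - t *\<^sub>R h) \<bullet> h) = ?I t * ((G (x - t *\<^sub>R h) - G x) \<bullet> h) + ?I t * (G x \<bullet> h)" for t
        by (simp add: inner_diff_left algebra_simps)
      then have "U x - U (x - h) = (\<integral>t. ?I t * ((G (x - t *\<^sub>R h) - G x) \<bullet> h) + ?I t * (G x \<bullet> h) \<partial>lborel)"
        using elim(1) by presburger
      also have "\<dots> = (\<integral>t. ?I t * ((G (x - t *\<^sub>R h) - G x) \<bullet> h) \<partial>lborel) + G x \<bullet> h"
        using i2 by simp
      finally have "norm (U x - U (x - h) - G x \<bullet> h) = \<bar>\<integral>t. ?I t * ((G (x - t *\<^sub>R h) - G x) \<bullet> h) \<partial>lborel\<bar>"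
        by simp
      also have "\<dots> \<le> (\<integral>t. \<bar>?I t * ((G (x - t *\<^sub>R h) - G x) \<bullet> h)\<bar> \<partial>lborel)"
        by (rule integral_abs_bound)
      also have "\<dots> \<le> (\<integral>t. norm h * (?I t * f t x) \<partial>lborel)"
      proof (rule integral_mono)
        show "\<bar>?I t * ((G (x - t *\<^sub>R h) - G x) \<bullet> h)\<bar> \<le> norm h * (?I t * f t x)" for t
          using Cauchy_Schwarz_ineq2[of "G (x - t *\<^sub>R h) - G x" h]
          by (auto simp: indicator_def f_def mult.commute)
      qed (use i1 i2 in auto)
      also have "\<dots> = norm h * (\<integral>t. ?I t * f t x \<partial>lborel)" by simp
      finally have "?D x \<le> (norm h * (\<integral>t. ?I t * f t x \<partial>lborel)) powr p"
        using p0 by (intro powr_mono2) auto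
      also have "\<dots> = norm h powr p * (\<integral>t. ?I t * f t x \<partial>lborel) powr p"
        by (rule powr_mult)
      also have "\<dots> \<le> ?R x" by (intro mult_left_mono *(2) f0) auto
      finally show ?case .
    qed
    have "integrable lborel (\<lambda>x. \<integral>t. ?I t * f t x powr p \<partial>lborel)" by (rule lborel_pair.integrable_snd[OF fint])
    then have Ri: "integrable lborel ?R" by simp
    have "integrable lborel ?D"
    proof (rule Bochner_Integration.integrable_bound[OF Ri])
      show "AE x in lborel. norm (?D x) \<le> norm (?R x)"
        using AE by eventually_elim (simp add: order_trans[OF _ abs_ge_self])
    qed measurable
    then have "(\<integral>x. ?D x \<partial>lborel) \<le> (\<integral>x. ?R x \<partial>lborel)"
      by (rule integral_mono_AE[OF _ Ri AE])
    also have "\<dots> = norm h powr p * (2 powr p * (\<integral>x. \<integral>t. ?I t * f t x powr p \<partial>lborel \<partial>lborel))"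
      by simp
    also have "\<dots> \<le> norm h powr p * (2 powr p * \<eta>')"
      by (intro mult_left_mono bound) auto
    also have "\<dots> \<le> norm h powr p * \<eta>"
      using \<eta>'(2) by (intro mult_left_mono) (auto simp: mult.commute)
    finally show ?thesis by (simp add: mult.commute)
  qed
  then show thesis using that \<delta>(1) by blast
qed

section \<open>Concentrating kernels\<close>

lemma (in pair_sigma_finite) p_integrable_from_fibres:
  fixes F :: "'a \<times> 'b \<Rightarrow> 'c::euclidean_space"
  assumes [measurable]: "F \<in> borel_measurable (M1 \<Otimes>\<^sub>M M2)"
    and g: "integrable M1 g"
    and F: "\<And>x. x \<in> space M1 \<Longrightarrow> p_integrable p M2 (\<lambda>y. F (x, y))"
      "\<And>x. x \<in> space M1 \<Longrightarrow> (\<integral>y. norm (F (x, y)) powr p \<partial>M2) \<le> g x"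
  shows "p_integrable p (M1 \<Otimes>\<^sub>M M2) F"
    and "(\<integral>z. norm (F z) powr p \<partial>(M1 \<Otimes>\<^sub>M M2)) = (\<integral>x. \<integral>y. norm (F (x, y)) powr p \<partial>M2 \<partial>M1)"
proof -
  have "integrable (M1 \<Otimes>\<^sub>M M2) (\<lambda>(x, y). norm (F (x, y)) powr p)"
    by (rule integrable_from_fibres[OF _ g]) (use F in \<open>auto simp: p_integrable_def\<close>)
  then have i: "integrable (M1 \<Otimes>\<^sub>M M2) (\<lambda>z. norm (F z) powr p)" by (simp add: split_beta')
  then show "p_integrable p (M1 \<Otimes>\<^sub>M M2) F" by (simp add: p_integrable_def)
  show "(\<integral>z. norm (F z) powr p \<partial>(M1 \<Otimes>\<^sub>M M2)) = (\<integral>x. \<integral>y. norm (F (x, y)) powr p \<partial>M2 \<partial>M1)"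
    using integral_fst'[OF i] by simp
qed

lemma tendsto_if_eventually_le_multiple:
  fixes f :: "nat \<Rightarrow> real"
  assumes "0 \<le> C" "\<And>\<eta>. 0 < \<eta> \<Longrightarrow> eventually (\<lambda>n. \<bar>f n - l\<bar> \<le> C * \<eta>) sequentially"
  shows "f \<longlonglongrightarrow> l"
proof (rule tendstoI)
  fix e :: real assume "0 < e"
  then have "0 < e / 2" by simp
  then obtain \<eta> where \<eta>: "0 < \<eta>" "\<eta> * C \<le> e / 2" using assms(1) by (rule small_multiple)
  show "eventually (\<lambda>n. dist (f n) l < e) sequentially"
    using assms(2)[OF \<eta>(1)]
  proof eventually_elim
    case (elim n)
    then have "\<bar>f n - l\<bar> \<le> e / 2" using \<eta>(2) by (simp add: mult.commute)
    then show ?case using \<open>0 < e\<close> by (simp add: dist_real_def)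
  qed
qed

lemma L1_le_Lp_on_compact:
  fixes f :: "'a::euclidean_space \<Rightarrow> 'b::euclidean_space"
  assumes p: "1 < p" and f: "p_integrable p lborel f" and L: "compact L" and [measurable]: "g \<in> borel_measurable borel"
    and B: "0 \<le> B" "\<And>x. \<bar>g x\<bar> \<le> B * indicator L x" and \<eta>: "0 < \<eta>"
  shows "(\<integral>x. norm (g x *\<^sub>R f x) \<partial>lborel) \<le> B * (\<eta> * measure lborel L + \<eta> powr (1 - p) * (\<integral>x. norm (f x) powr p \<partial>lborel))"
proof -
  let ?R = "\<lambda>x. B * (\<eta> * indicator L x + \<eta> powr (1 - p) * norm (f x) powr p)"
  have Ri: "integrable lborel ?R"
    using integrable_indicator_compact[OF L] p_integrable_integrable[OF f]
    by (intro integrable_mult_right Bochner_Integration.integrable_add)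
  have "(\<integral>x. norm (g x *\<^sub>R f x) \<partial>lborel) \<le> (\<integral>x. ?R x \<partial>lborel)"
  proof (rule integral_mono[OF _ Ri])
    show "integrable lborel (\<lambda>x. norm (g x *\<^sub>R f x))"
      by (intro integrable_norm p_integrable_times_bounded(1)[OF p f L _ B]) measurable
    fix x
    show "norm (g x *\<^sub>R f x) \<le> ?R x"
    proof (cases "x \<in> L")
      case True
      then show ?thesis
        using B(1) B(2)[of x] le_scale_plus_powr[OF p \<eta>, of "norm (f x)"]
        unfolding norm_scaleR by (intro mult_mono) auto
    next
      case False
      then have "g x = 0" using B(2)[of x] by simp
      then show ?thesis using B(1) False by simp
    qed
  qed
  also have "\<dots> = B * (\<eta> * measure lborel L + \<eta> powr (1 - p) * (\<integral>x. norm (f x) powr p \<partial>lborel))"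
    using integrable_indicator_compact[OF L] p_integrable_integrable[OF f] L by (simp add: borel_compact)
  finally show ?thesis .
qed

lemma L1_tendsto_0_on_compact:
  fixes f :: "nat \<Rightarrow> 'a::euclidean_space \<Rightarrow> 'b::euclidean_space"
  assumes p: "1 < p" and f: "\<And>n. p_integrable p lborel (f n)" "(\<lambda>n. \<integral>x. norm (f n x) powr p \<partial>lborel) \<longlonglongrightarrow> 0"
    and L: "compact L" and g: "g \<in> borel_measurable borel" and B: "0 \<le> B" "\<And>x. \<bar>g x\<bar> \<le> B * indicator L x"
  shows "(\<lambda>n. \<integral>x. norm (g x *\<^sub>R f n x) \<partial>lborel) \<longlonglongrightarrow> 0"
proof (rule tendsto_if_eventually_le_multiple)
  show "0 \<le> B * (measure lborel L + 1)" using B(1) by simp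
  fix \<eta> :: real assume \<eta>: "0 < \<eta>"
  have "(\<lambda>n. \<eta> powr (1 - p) * (\<integral>x. norm (f n x) powr p \<partial>lborel)) \<longlonglongrightarrow> \<eta> powr (1 - p) * 0"
    by (intro tendsto_intros f)
  then have "eventually (\<lambda>n. \<eta> powr (1 - p) * (\<integral>x. norm (f n x) powr p \<partial>lborel) < \<eta>) sequentially"
    using \<eta> by (intro order_tendstoD(2)) auto
  then show "eventually (\<lambda>n. \<bar>(\<integral>x. norm (g x *\<^sub>R f n x) \<partial>lborel) - 0\<bar> \<le> B * (measure lborel L + 1) * \<eta>) sequentially"
  proof eventually_elim
    case (elim n)
    have "0 \<le> (\<integral>x. norm (g x *\<^sub>R f n x) \<partial>lborel)" by (intro integral_nonneg_AE) auto
    moreover have "B * (\<eta> * measure lborel L + \<eta> powr (1 - p) * (\<integral>x. norm (f n x) powr p \<partial>lborel)) \<le> B * (\<eta> * measure lborel L + \<eta>)"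
      using elim B(1) by (intro mult_left_mono add_left_mono) auto
    ultimately show ?case
      using L1_le_Lp_on_compact[OF p f(1)[of n] L g B \<eta>] by (simp add: algebra_simps)
  qed
qed

text \<open>
  The measure \<open>\<mu> n\<close> stands for \<open>\<nu>\<^sub>\<epsilon>(h) dh\<close> with \<open>\<epsilon>\<close> the \<open>n\<close>-th term of a null sequence. Radial symmetry enters as
  invariance under reflections, a property of the measure that does not refer to the values of a density on null sets.
\<close>

locale kernel_sequence =
  fixes p :: real and \<mu> :: "nat \<Rightarrow> 'a::euclidean_space measure"
  assumes p_gt_1: "1 < p"
    and sets_kernel [measurable_cong, simp]: "\<And>n. sets (\<mu> n) = sets borel"
    and sigma_finite_kernel: "\<And>n. sigma_finite_measure (\<mu> n)"
    and kernel_mass: "\<And>n. has_bochner_integral (\<mu> n) (\<lambda>h. min 1 (norm h powr p)) 1"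
    and kernel_concentrates: "\<And>\<delta>. 0 < \<delta> \<Longrightarrow> (\<lambda>n. measure (\<mu> n) {h. \<delta> < norm h}) \<longlonglongrightarrow> 0"
    and kernel_reflect: "\<And>n a. distr (\<mu> n) borel (reflect a) = \<mu> n"
begin

lemma p_gt_0: "0 < p" using p_gt_1 by simp

lemma space_kernel [simp]: "space (\<mu> n) = UNIV"
  using sets_eq_imp_space_eq[OF sets_kernel[of n]] by simp

lemma pair_sigma_finite_kernel: "pair_sigma_finite (\<mu> n) lborel"
  by (simp add: pair_sigma_finite_def sigma_finite_kernel lborel.sigma_finite_measure_axioms)

lemma integrable_min_kernel: "integrable (\<mu> n) (\<lambda>h. min 1 (norm h powr p))"
  and integral_min_kernel: "(\<integral>h. min 1 (norm h powr p) \<partial>\<mu> n) = 1"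
  using kernel_mass[of n] by (auto simp: has_bochner_integral_iff)

lemma integrable_indicator_far:
  assumes "0 < \<delta>"
  shows "integrable (\<mu> n) (indicat_real {h. \<delta> < norm h})"
proof (rule Bochner_Integration.integrable_bound)
  define m where "m = min 1 (\<delta> powr p)"
  have m: "0 < m" using assms by (simp add: m_def)
  show "integrable (\<mu> n) (\<lambda>h. (1 / m) * min 1 (norm h powr p))"
    using integrable_min_kernel by (rule integrable_mult_right)
  have "indicat_real {h. \<delta> < norm h} h \<le> (1 / m) * min 1 (norm h powr p)" for h :: 'a
  proof (cases "\<delta> < norm h")
    case True
    then have "\<delta> powr p \<le> norm h powr p" using assms p_gt_0 by (intro powr_mono2) auto
    then have "m \<le> min 1 (norm h powr p)" by (auto simp: m_def)
    then show ?thesis using m True by (simp add: field_simps)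
  next
    case False
    then show ?thesis using m by simp
  qed
  then show "AE h in \<mu> n. norm (indicat_real {h. \<delta> < norm h} h) \<le> norm ((1 / m) * min 1 (norm h powr p))"
    using m by (intro AE_I2) (simp add: abs_of_pos)
qed measurable

lemma integral_le_near_far:
  assumes [measurable]: "\<rho> \<in> borel_measurable borel" and "\<And>h. 0 \<le> \<rho> h" "\<And>h. \<rho> h \<le> C"
    and \<delta>: "0 < \<delta>" "\<delta> \<le> 1" and near: "\<And>h. norm h \<le> \<delta> \<Longrightarrow> \<rho> h \<le> \<eta> * norm h powr p" and "0 \<le> \<eta>"
  shows "integrable (\<mu> n) \<rho>" "(\<integral>h. \<rho> h \<partial>\<mu> n) \<le> \<eta> + C * measure (\<mu> n) {h. \<delta> < norm h}"
proof -
  let ?R = "\<lambda>h. \<eta> * min 1 (norm h powr p) + C * indicat_real {h. \<delta> < norm h} h"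
  have C: "0 \<le> C" using assms(2,3)[of 0] by linarith
  have i1: "integrable (\<mu> n) (\<lambda>h. C * indicat_real {h. \<delta> < norm h} h)"
    using integrable_indicator_far[OF \<delta>(1)] by (rule integrable_mult_right)
  have i2: "integrable (\<mu> n) (\<lambda>h. \<eta> * min 1 (norm h powr p))"
    using integrable_min_kernel by (rule integrable_mult_right)
  have i: "integrable (\<mu> n) ?R" using i2 i1 by (rule Bochner_Integration.integrable_add)
  have le: "\<rho> h \<le> ?R h" for h
  proof (cases "\<delta> < norm h")
    case True
    then show ?thesis using assms(3)[of h] \<open>0 \<le> \<eta>\<close> by (simp add: add_increasing)
  next
    case False
    then have "norm h powr p \<le> 1" using \<delta>(2) p_gt_0 by (intro powr_le1) auto
    then show ?thesis using False near[of h] C by simp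
  qed
  show ri: "integrable (\<mu> n) \<rho>"
  proof (rule Bochner_Integration.integrable_bound[OF i])
    show "AE h in \<mu> n. norm (\<rho> h) \<le> norm (?R h)"
      using assms(2) le by (intro AE_I2) (simp add: order_trans[OF _ abs_ge_self])
  qed measurable
  have "(\<integral>h. \<rho> h \<partial>\<mu> n) \<le> (\<integral>h. ?R h \<partial>\<mu> n)" by (rule integral_mono[OF ri i le])
  also have "\<dots> = \<eta> + C * measure (\<mu> n) {h. \<delta> < norm h}"
    using i1 i2 by (simp add: integral_min_kernel)
  finally show "(\<integral>h. \<rho> h \<partial>\<mu> n) \<le> \<eta> + C * measure (\<mu> n) {h. \<delta> < norm h}" .
qed

text \<open>The kernels see a bounded function only through its behaviour of order \<open>\<bar>h\<bar>\<^sup>p\<close> at the origin.\<close>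

lemma integral_kernel_tendsto_0:
  assumes [measurable]: "\<rho> \<in> borel_measurable borel" and \<rho>: "\<And>h. 0 \<le> \<rho> h" "\<And>h. \<rho> h \<le> C"
    and small: "\<And>\<eta>. 0 < \<eta> \<Longrightarrow> \<exists>\<delta>>0. \<forall>h. norm h \<le> \<delta> \<longrightarrow> \<rho> h \<le> \<eta> * norm h powr p"
  shows "integrable (\<mu> n) \<rho>" "(\<lambda>n. \<integral>h. \<rho> h \<partial>\<mu> n) \<longlonglongrightarrow> 0"
proof -
  have near: "\<exists>\<delta>>0. \<delta> \<le> 1 \<and> (\<forall>h. norm h \<le> \<delta> \<longrightarrow> \<rho> h \<le> \<eta> * norm h powr p)" if \<eta>: "0 < \<eta>" for \<eta>
  proof -
    obtain \<delta> where "0 < \<delta>" "\<forall>h. norm h \<le> \<delta> \<longrightarrow> \<rho> h \<le> \<eta> * norm h powr p" using small[OF \<eta>] by blast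
    then show ?thesis by (intro exI[of _ "min \<delta> 1"]) auto
  qed
  obtain \<delta>1 where \<delta>1: "0 < \<delta>1" "\<delta>1 \<le> 1" "\<And>h. norm h \<le> \<delta>1 \<Longrightarrow> \<rho> h \<le> 1 * norm h powr p"
    using near[of 1] by auto
  show "integrable (\<mu> n) \<rho>"
    by (rule integral_le_near_far(1)[OF _ \<rho> \<delta>1]) auto
  show "(\<lambda>n. \<integral>h. \<rho> h \<partial>\<mu> n) \<longlonglongrightarrow> 0"
  proof (rule tendsto_if_eventually_le_multiple[of 2])
    fix \<eta> :: real assume \<eta>: "0 < \<eta>"
    obtain \<delta> where \<delta>: "0 < \<delta>" "\<delta> \<le> 1" "\<And>h. norm h \<le> \<delta> \<Longrightarrow> \<rho> h \<le> \<eta> * norm h powr p"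
      using near[OF \<eta>] by auto
    have "(\<lambda>n. C * measure (\<mu> n) {h. \<delta> < norm h}) \<longlonglongrightarrow> C * 0"
      by (intro tendsto_intros kernel_concentrates \<delta>)
    then have "eventually (\<lambda>n. C * measure (\<mu> n) {h. \<delta> < norm h} < \<eta>) sequentially"
      using \<eta> by (intro order_tendstoD(2)) auto
    then show "eventually (\<lambda>n. \<bar>(\<integral>h. \<rho> h \<partial>\<mu> n) - 0\<bar> \<le> 2 * \<eta>) sequentially"
    proof eventually_elim
      case (elim n)
      have "0 \<le> (\<integral>h. \<rho> h \<partial>\<mu> n)" using \<rho>(1) by (intro integral_nonneg_AE) auto
      then show ?case using integral_le_near_far(2)[OF _ \<rho> \<delta>, of n] \<eta> elim by simp
    qed
  qed simp
qed

definition annulus_moment :: "nat \<Rightarrow> real \<Rightarrow> real" where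
  "annulus_moment n r = (\<integral>h. indicator (ball 0 1 - ball 0 r) h * norm h powr p \<partial>\<mu> n)"

lemma integrable_ball_moment:
  assumes [measurable]: "S \<in> sets borel" and "S \<subseteq> ball 0 1"
  shows "integrable (\<mu> n) (\<lambda>h. indicator S h * norm h powr p)"
    and "(\<integral>h. indicator S h * norm h powr p \<partial>\<mu> n) \<le> 1"
proof -
  have "norm h powr p \<le> 1" if "h \<in> S" for h
    using assms(2) p_gt_0 that by (intro powr_le1) (auto simp: subset_eq less_imp_le)
  then have le: "indicator S h * norm h powr p \<le> min 1 (norm h powr p)" for h
    by (auto simp: indicator_def)
  show i: "integrable (\<mu> n) (\<lambda>h. indicator S h * norm h powr p)"
  proof (rule Bochner_Integration.integrable_bound[OF integrable_min_kernel])
    show "AE h in \<mu> n. norm (indicator S h * norm h powr p) \<le> norm (min 1 (norm h powr p))"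
      using le by (intro AE_I2) (simp add: order_trans[OF _ abs_ge_self])
  qed measurable
  show "(\<integral>h. indicator S h * norm h powr p \<partial>\<mu> n) \<le> 1"
    using integral_mono[OF i integrable_min_kernel le] by (simp add: integral_min_kernel)
qed

lemma annulus_moment_tendsto_0: "0 < r \<Longrightarrow> (\<lambda>n. annulus_moment n r) \<longlonglongrightarrow> 0"
  unfolding annulus_moment_def
proof (rule integral_kernel_tendsto_0(2)[of _ 1])
  assume r: "0 < r"
  show "\<exists>\<delta>>0. \<forall>h::'a. norm h \<le> \<delta> \<longrightarrow> indicator (ball 0 1 - ball 0 r) h * norm h powr p \<le> \<eta> * norm h powr p"
    if "0 < \<eta>" for \<eta> :: real
    using r that by (intro exI[of _ "r / 2"]) (auto simp: indicator_def)
  show "indicator (ball 0 1 - ball 0 r) h * norm h powr p \<le> 1" for h :: 'a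
    using p_gt_0 by (auto simp: indicator_def intro!: powr_le1)
qed auto

lemma ball_moment_tendsto_1:
  assumes "0 < r" "r \<le> 1"
  shows "(\<lambda>n. \<integral>h. indicator (ball 0 r) h * norm h powr p \<partial>\<mu> n) \<longlonglongrightarrow> 1"
proof -
  let ?\<rho> = "\<lambda>h::'a. min 1 (norm h powr p) - indicator (ball 0 r) h * norm h powr p"
  have sub: "ball (0::'a) r \<subseteq> ball 0 1" using assms(2) by auto
  have "(\<lambda>n. \<integral>h. ?\<rho> h \<partial>\<mu> n) \<longlonglongrightarrow> 0"
  proof (rule integral_kernel_tendsto_0(2)[of _ 1])
    have small: "norm h powr p \<le> 1" if "norm h < r" for h :: 'a
      using that assms p_gt_0 by (intro powr_le1) auto
    show "0 \<le> ?\<rho> h" "?\<rho> h \<le> 1" for h using small[of h] by (auto simp: indicator_def)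
    show "\<exists>\<delta>>0. \<forall>h. norm h \<le> \<delta> \<longrightarrow> ?\<rho> h \<le> \<eta> * norm h powr p" if "0 < \<eta>" for \<eta> :: real
      using assms(1) that small by (intro exI[of _ "r / 2"]) (auto simp: indicator_def)
  qed measurable
  then have "(\<lambda>n. 1 - (\<integral>h. indicator (ball 0 r) h * norm h powr p \<partial>\<mu> n)) \<longlonglongrightarrow> 0"
    using integrable_min_kernel integrable_ball_moment(1)[OF _ sub] by (simp add: integral_min_kernel)
  from tendsto_diff[OF tendsto_const[of 1] this] show ?thesis by simp
qed

abbreviation N :: "nat \<Rightarrow> ('a \<times> 'a) measure" where "N n \<equiv> \<mu> n \<Otimes>\<^sub>M lborel"

lemma sets_kernel_product [measurable_cong]: "sets (N n) = sets (borel \<Otimes>\<^sub>M borel)"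
  by (intro sets_pair_measure_cong) auto

text \<open>
  The linear increment \<open>G(x) \<bullet> h\<close> is cut off at \<open>\<bar>h\<bar> = 1\<close>, since the kernels have a \<open>p\<close>-th moment only near the
  origin.
\<close>

definition linear_increment :: "('a \<Rightarrow> 'a) \<Rightarrow> 'a \<times> 'a \<Rightarrow> real" where
  "linear_increment G = (\<lambda>(h, x). indicator (ball 0 1) h * (G x \<bullet> h))"

lemma linear_increment_measurable [measurable]:
  assumes [measurable]: "G \<in> borel_measurable borel"
  shows "linear_increment G \<in> borel_measurable (N n)"
  unfolding linear_increment_def by measurable

lemma linear_increment_fibre:
  assumes G: "p_integrable p lborel G"
  shows "p_integrable p lborel (\<lambda>x. linear_increment G (h, x))"
    "(\<integral>x. norm (linear_increment G (h, x)) powr p \<partial>lborel) \<le>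
      (indicator (ball 0 1) h * norm h powr p) * (\<integral>x. norm (G x) powr p \<partial>lborel)"
proof -
  have [measurable]: "G \<in> borel_measurable borel" using G by (simp add: p_integrable_def)
  have le: "norm (linear_increment G (h, x)) powr p \<le> (indicator (ball 0 1) h * norm h powr p) * norm (G x) powr p" for x
  proof (cases "h \<in> ball 0 1")
    case True
    have "\<bar>G x \<bullet> h\<bar> powr p \<le> (norm (G x) * norm h) powr p"
      using p_gt_0 by (intro powr_mono2 Cauchy_Schwarz_ineq2) auto
    then show ?thesis using True by (simp add: linear_increment_def powr_mult mult.commute)
  qed (simp add: linear_increment_def)
  have i: "integrable lborel (\<lambda>x. (indicator (ball 0 1) h * norm h powr p) * norm (G x) powr p)"
    by (intro integrable_mult_right p_integrable_integrable[OF G])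
  show 1: "p_integrable p lborel (\<lambda>x. linear_increment G (h, x))"
    by (rule p_integrable_bound[OF _ i]) (use le in \<open>auto simp: linear_increment_def\<close>)
  show "(\<integral>x. norm (linear_increment G (h, x)) powr p \<partial>lborel) \<le>
      (indicator (ball 0 1) h * norm h powr p) * (\<integral>x. norm (G x) powr p \<partial>lborel)"
    using integral_mono[OF p_integrable_integrable[OF 1] i le] by simp
qed

lemma linear_increment_p_integrable:
  assumes G: "p_integrable p lborel G"
  shows "p_integrable p (N n) (linear_increment G)"
    and "(\<integral>z. norm (linear_increment G z) powr p \<partial>N n) \<le> (\<integral>x. norm (G x) powr p \<partial>lborel)"
proof -
  interpret P: pair_sigma_finite "\<mu> n" lborel by (rule pair_sigma_finite_kernel)
  have [measurable]: "G \<in> borel_measurable borel" using G by (simp add: p_integrable_def)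
  let ?c = "\<integral>x. norm (G x) powr p \<partial>lborel"
  have i: "integrable (\<mu> n) (\<lambda>h. (indicator (ball 0 1) h * norm h powr p) * ?c)"
    by (intro integrable_mult_left integrable_ball_moment(1)) auto
  note * = P.p_integrable_from_fibres[OF _ i linear_increment_fibre[OF G]]
  show "p_integrable p (N n) (linear_increment G)" by (rule *(1)) measurable
  then have "integrable (N n) (\<lambda>z. norm (linear_increment G z) powr p)" by (rule p_integrable_integrable)
  from P.integrable_fst'[OF this]
  have "(\<integral>h. \<integral>x. norm (linear_increment G (h, x)) powr p \<partial>lborel \<partial>\<mu> n) \<le>
      (\<integral>h. (indicator (ball 0 1) h * norm h powr p) * ?c \<partial>\<mu> n)"
    by (intro integral_mono i linear_increment_fibre(2)[OF G])
  also have "\<dots> = (\<integral>h. indicator (ball 0 1) h * norm h powr p \<partial>\<mu> n) * ?c" by simp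
  also have "\<dots> \<le> 1 * ?c"
    by (intro mult_right_mono integrable_ball_moment(2) integral_powr_nonneg) auto
  finally show "(\<integral>z. norm (linear_increment G z) powr p \<partial>N n) \<le> ?c"
    by (subst *(2)) auto
qed

lemma linear_increment_diff: "linear_increment G z - linear_increment H z = linear_increment (\<lambda>x. G x - H x) z"
  by (auto simp: linear_increment_def split_beta inner_diff_left algebra_simps)

text \<open>
  By the \<open>L\<^sup>p\<close> bound on difference quotients the error, integrated over \<open>x\<close>, is \<open>o(\<bar>h\<bar>\<^sup>p)\<close> at the origin, and it is
  bounded away from it.
\<close>

lemma increment_approx:
  fixes U :: "'a \<Rightarrow> real"
  assumes U: "p_integrable p lborel U" and G: "p_integrable p lborel G" and weak: "borel_weak_grad UNIV U G"
  shows "p_integrable p (N n) (\<lambda>(h, x). U x - U (x - h))"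
    and "(\<lambda>n. \<integral>z. norm ((case z of (h, x) \<Rightarrow> U x - U (x - h)) - linear_increment G z) powr p \<partial>N n) \<longlonglongrightarrow> 0"
proof -
  have [measurable]: "U \<in> borel_measurable borel" "G \<in> borel_measurable borel"
    using U G by (auto simp: p_integrable_def)
  define F where "F z = (case z of (h, x) \<Rightarrow> U x - U (x - h)) - linear_increment G z" for z
  have Fm [measurable]: "F \<in> borel_measurable (N n)" "F \<in> borel_measurable (lborel \<Otimes>\<^sub>M lborel)" for n
    unfolding F_def linear_increment_def by measurable
  have D: "p_integrable p lborel (\<lambda>x. U x - U (x - h))" for h
    using p_integrable_diff[OF p_gt_0 U p_integrable_translate(1)[OF U, of "- h"]] by simp
  have F_fibre: "p_integrable p lborel (\<lambda>x. F (h, x))" for h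
    unfolding F_def using p_integrable_diff[OF p_gt_0 D linear_increment_fibre(1)[OF G]] by simp
  define \<rho> where "\<rho> h = (\<integral>x. norm (F (h, x)) powr p \<partial>lborel)" for h
  have \<rho>m [measurable]: "\<rho> \<in> borel_measurable borel"
    unfolding \<rho>_def by measurable
  have \<rho>0: "0 \<le> \<rho> h" for h unfolding \<rho>_def by (rule integral_powr_nonneg)
  define A where "A = (2::real) powr p"
  have A: "0 \<le> A" by (simp add: A_def)
  let ?I = "\<lambda>f::'a \<Rightarrow> real. \<integral>x. norm (f x) powr p \<partial>lborel"
  let ?c = "\<integral>x. norm (G x) powr p \<partial>lborel"
  have \<rho>C: "\<rho> h \<le> A * (A * (?I U + ?I U) + ?c)" for h
  proof -
    have Uh: "p_integrable p lborel (\<lambda>x. - U (x - h))"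
      using p_integrable_scaleR[OF p_integrable_translate(1)[OF U, of "- h"], of "-1"] by simp
    have Lh: "p_integrable p lborel (\<lambda>x. - linear_increment G (h, x))"
      using p_integrable_scaleR[OF linear_increment_fibre(1)[OF G], of "-1"] by simp
    have "\<rho> h = ?I (\<lambda>x. (U x + - U (x - h)) + - linear_increment G (h, x))"
      by (simp add: \<rho>_def F_def)
    also have "\<dots> \<le> A * (?I (\<lambda>x. U x + - U (x - h)) + ?I (\<lambda>x. - linear_increment G (h, x)))"
      unfolding A_def by (intro integral_norm_add_powr_le p_gt_0 p_integrable_add U Uh Lh)
    also have "\<dots> \<le> A * (A * (?I U + ?I (\<lambda>x. - U (x - h))) + ?c)"
    proof (intro mult_left_mono add_mono A)
      show "?I (\<lambda>x. U x + - U (x - h)) \<le> A * (?I U + ?I (\<lambda>x. - U (x - h)))"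
        unfolding A_def by (intro integral_norm_add_powr_le p_gt_0 U Uh)
      have "indicator (ball 0 1) h * norm h powr p \<le> 1"
        using p_gt_0 by (auto simp: indicator_def intro!: powr_le1)
      from order_trans[OF linear_increment_fibre(2)[OF G] mult_right_mono[OF this integral_powr_nonneg]]
      show "?I (\<lambda>x. - linear_increment G (h, x)) \<le> ?c" by simp
    qed
    also have "?I (\<lambda>x. - U (x - h)) = ?I U"
      using p_integrable_translate(2)[OF U, of "- h"] by simp
    finally show ?thesis .
  qed
  have small: "\<exists>\<delta>>0. \<forall>h. norm h \<le> \<delta> \<longrightarrow> \<rho> h \<le> \<eta> * norm h powr p" if \<eta>: "0 < \<eta>" for \<eta>
  proof -
    obtain \<delta> where \<delta>: "0 < \<delta>" "\<forall>h. norm h \<le> \<delta> \<longrightarrow>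
        (\<integral>x. norm (U x - U (x - h) - G x \<bullet> h) powr p \<partial>lborel) \<le> \<eta> * norm h powr p"
      by (rule difference_quotient_Lp[OF p_gt_1 U G weak \<eta>]) blast
    then show ?thesis
      by (intro exI[of _ "min \<delta> (1 / 2)"]) (auto simp: \<rho>_def F_def linear_increment_def)
  qed
  note \<rho>_lim = integral_kernel_tendsto_0[OF \<rho>m \<rho>0 \<rho>C small]
  have pF: "p_integrable p (N n) F" and iF: "(\<integral>z. norm (F z) powr p \<partial>N n) = (\<integral>h. \<rho> h \<partial>\<mu> n)" for n
  proof -
    interpret P: pair_sigma_finite "\<mu> n" lborel by (rule pair_sigma_finite_kernel)
    note * = P.p_integrable_from_fibres[OF Fm(1) \<rho>_lim(1) F_fibre eq_refl[OF \<rho>_def[symmetric]]]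
    show "p_integrable p (N n) F" by (rule *(1))
    show "(\<integral>z. norm (F z) powr p \<partial>N n) = (\<integral>h. \<rho> h \<partial>\<mu> n)" unfolding \<rho>_def by (rule *(2))
  qed
  show "(\<lambda>n. \<integral>z. norm ((case z of (h, x) \<Rightarrow> U x - U (x - h)) - linear_increment G z) powr p \<partial>N n) \<longlonglongrightarrow> 0"
    using \<rho>_lim(2) unfolding F_def[symmetric] iF .
  have "(\<lambda>z. F z + linear_increment G z) = (\<lambda>(h, x). U x - U (x - h))"
    by (auto simp: F_def)
  then show "p_integrable p (N n) (\<lambda>(h, x). U x - U (x - h))"
    using p_integrable_add[OF p_gt_0 pF linear_increment_p_integrable(1)[OF G]] by metis
qed

end

section \<open>Passing to the limit\<close>

definition local_increment :: "'a::euclidean_space set \<Rightarrow> ('a \<Rightarrow> real) \<Rightarrow> 'a \<times> 'a \<Rightarrow> real" where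
  "local_increment \<Omega> w = (\<lambda>(h, x). indicator \<Omega> x * indicator \<Omega> (x - h) * (w x - w (x - h)))"

text \<open>
  The functions \<open>w n\<close> are representatives of the \<open>v\<^sub>\<epsilon>\<close>, and \<open>V\<close> is the weak gradient of their local limit. The energy
  of \<open>w n\<close> is the \<open>p\<close>-th power of the norm of its increments in \<open>L\<^sup>p\<close> of the measure \<open>d\<mu> n(h) dx\<close>, which turns the
  nonlocal forms into pairings with a bounded sequence in \<open>L\<^sup>p\<close>.
\<close>

locale bounded_energy_sequence = kernel_sequence p \<mu>
  for p :: real and \<mu> :: "nat \<Rightarrow> 'a::euclidean_space measure" +
  fixes \<Omega> :: "'a set" and w :: "nat \<Rightarrow> 'a \<Rightarrow> real" and w\<^sub>0 :: "'a \<Rightarrow> real" and V :: "'a \<Rightarrow> 'a"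
    and M :: real and e :: 'a
  assumes open_domain: "open \<Omega>"
    and w_p_integrable: "\<And>n. p_integrable p lborel (w n)"
    and w_bound: "\<And>n. (\<integral>x. norm (w n x) powr p \<partial>lborel) \<le> M"
    and energy_p_integrable: "\<And>n. p_integrable p (N n) (local_increment \<Omega> (w n))"
    and energy_bound: "\<And>n. (\<integral>z. norm (local_increment \<Omega> (w n) z) powr p \<partial>N n) \<le> M"
    and w_tendsto_loc: "\<And>K. compact K \<Longrightarrow> K \<subseteq> \<Omega> \<Longrightarrow>
      (\<lambda>n. \<integral>x. indicator K x * norm (w n x - w\<^sub>0 x) powr p \<partial>lborel) \<longlonglongrightarrow> 0"
    and limit_p_integrable: "p_integrable p lborel w\<^sub>0"
    and gradient_p_integrable: "p_integrable p lborel V"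
    and gradient_zero: "\<And>x. x \<notin> \<Omega> \<Longrightarrow> V x = 0"
    and gradient_weak: "borel_weak_grad \<Omega> w\<^sub>0 V"
    and norm_e: "norm e = 1"
begin

abbreviation T :: "nat \<Rightarrow> 'a \<times> 'a \<Rightarrow> real" where "T n \<equiv> local_increment \<Omega> (w n)"

abbreviation K :: real where "K \<equiv> K_const e p"

lemma M_nonneg: "0 \<le> M"
  by (rule order_trans[OF integral_powr_nonneg w_bound])

lemma \<Omega>_borel [measurable]: "\<Omega> \<in> sets borel"
  using open_domain by simp

lemma w_measurable [measurable]: "w n \<in> borel_measurable borel"
  and w\<^sub>0_measurable [measurable]: "w\<^sub>0 \<in> borel_measurable borel"
  and V_measurable [measurable]: "V \<in> borel_measurable borel"
  using w_p_integrable limit_p_integrable gradient_p_integrable by (auto simp: p_integrable_def)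

lemma T_measurable [measurable]: "T n \<in> borel_measurable (N n)"
  using energy_p_integrable by (auto simp: p_integrable_def)

text \<open>
  The variables \<open>h\<close> and \<open>x\<close> separate in these coefficients, so the limits of their pairings reduce to moments of the
  kernels and integrals over \<open>x\<close>.
\<close>

definition separated :: "'a set \<Rightarrow> 'a \<Rightarrow> ('a \<Rightarrow> real) \<Rightarrow> 'a \<times> 'a \<Rightarrow> real" where
  "separated S c g = (\<lambda>(h, x). indicator S h * pflux p (c \<bullet> h) * g x)"

lemma separated_measurable [measurable]:
  assumes [measurable]: "S \<in> sets borel" "g \<in> borel_measurable borel"
  shows "separated S c g \<in> borel_measurable (N n)"
  unfolding separated_def by measurable

text \<open>
  A pairing that separates the variables is small, up to an arbitrarily small multiple of the energy, if either
  the weight \<open>g\<close> is small in \<open>L\<^sup>1\<close> or the set \<open>S\<close> of increments carries little mass.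
\<close>

lemma separated_pairing_estimate:
  assumes "0 < \<eta>"
  obtains D where "0 \<le> D"
    "\<And>n S g. S \<in> sets borel \<Longrightarrow> S \<subseteq> ball 0 1 \<Longrightarrow> integrable lborel g \<Longrightarrow> (\<forall>x. \<bar>g x\<bar> \<le> 1) \<Longrightarrow>
       integrable (N n) (\<lambda>z. separated S c g z * T n z) \<and>
       \<bar>\<integral>z. separated S c g z * T n z \<partial>N n\<bar> \<le>
         \<eta> * M + D * ((\<integral>h. indicator S h * norm h powr p \<partial>\<mu> n) * (\<integral>x. \<bar>g x\<bar> \<partial>lborel))"
proof -
  obtain D where D: "0 \<le> D" "\<And>\<alpha> s t. 0 \<le> \<alpha> \<Longrightarrow> \<alpha> \<le> 1 \<Longrightarrow> 0 \<le> s \<Longrightarrow> 0 \<le> t \<Longrightarrow>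
       \<alpha> * s powr (p - 1) * t \<le> \<eta> * t powr p + D * \<alpha> * s powr p"
    using p_gt_1 assms zero_le_one by (rule weighted_powr_absorb) (assumption | rule that)+
  show thesis
  proof (rule that[of "D * norm c powr p"])
    show "0 \<le> D * norm c powr p" using D(1) by simp
    fix n and S :: "'a set" and g :: "'a \<Rightarrow> real"
    assume S [measurable]: "S \<in> sets borel" and S1: "S \<subseteq> ball 0 1" and g: "integrable lborel g" "\<forall>x. \<bar>g x\<bar> \<le> 1"
    interpret P: pair_sigma_finite "\<mu> n" lborel by (rule pair_sigma_finite_kernel)
    have [measurable]: "g \<in> borel_measurable borel" using g by auto
    let ?q = "\<lambda>h x. (indicator S h * norm h powr p) * \<bar>g x\<bar>"
    let ?R = "\<lambda>z. \<eta> * norm (T n z) powr p + (D * norm c powr p) * case_prod ?q z"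
    have qi: "integrable (N n) (case_prod ?q)"
    proof (rule P.integrable_from_fibres)
      show "integrable (\<mu> n) (\<lambda>h. (indicator S h * norm h powr p) * (\<integral>x. \<bar>g x\<bar> \<partial>lborel))"
        by (intro integrable_mult_left integrable_ball_moment(1) S S1)
    qed (use g in \<open>auto simp: abs_mult\<close>)
    have qint: "(\<integral>z. case_prod ?q z \<partial>N n) = (\<integral>h. indicator S h * norm h powr p \<partial>\<mu> n) * (\<integral>x. \<bar>g x\<bar> \<partial>lborel)"
      by (subst P.integral_fst[OF qi, symmetric]) simp
    have Ti: "integrable (N n) (\<lambda>z. \<eta> * norm (T n z) powr p)"
      by (intro integrable_mult_right p_integrable_integrable energy_p_integrable)
    have Ri: "integrable (N n) ?R"
      using Ti integrable_mult_right[OF qi] by (rule Bochner_Integration.integrable_add)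
    have le: "\<bar>separated S c g z * T n z\<bar> \<le> ?R z" for z
    proof -
      obtain h x where z: "z = (h, x)" by (cases z)
      show ?thesis
      proof (cases "h \<in> S")
        case False
        then show ?thesis using assms by (simp add: z separated_def)
      next
        case True
        have "\<bar>separated S c g z * T n z\<bar> = \<bar>g x\<bar> * \<bar>c \<bullet> h\<bar> powr (p - 1) * \<bar>T n z\<bar>"
          using True norm_pflux[of p "c \<bullet> h"] by (simp add: z separated_def abs_mult)
        also have "\<dots> \<le> \<bar>g x\<bar> * (norm c * norm h) powr (p - 1) * \<bar>T n z\<bar>"
          using p_gt_1 by (intro mult_left_mono mult_right_mono powr_mono2 Cauchy_Schwarz_ineq2) auto
        also have "\<dots> \<le> \<eta> * \<bar>T n z\<bar> powr p + D * \<bar>g x\<bar> * (norm c * norm h) powr p"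
          using g(2) by (intro D(2)) auto
        also have "\<dots> = ?R z"
          using True by (simp add: z powr_mult)
        finally show ?thesis .
      qed
    qed
    have i: "integrable (N n) (\<lambda>z. separated S c g z * T n z)"
    proof (rule Bochner_Integration.integrable_bound[OF Ri])
      show "AE z in N n. norm (separated S c g z * T n z) \<le> norm (?R z)"
        unfolding real_norm_def by (intro AE_I2 order_trans[OF le[unfolded real_norm_def] abs_ge_self])
    qed measurable
    have "\<bar>\<integral>z. separated S c g z * T n z \<partial>N n\<bar> \<le> (\<integral>z. \<bar>separated S c g z * T n z\<bar> \<partial>N n)"
      by (rule integral_abs_bound)
    also have "\<dots> \<le> (\<integral>z. ?R z \<partial>N n)"
      using integrable_norm[OF i] by (intro integral_mono Ri le) simp
    also have "\<dots> = \<eta> * (\<integral>z. norm (T n z) powr p \<partial>N n) + (D * norm c powr p) * (\<integral>z. case_prod ?q z \<partial>N n)"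
      using Ti integrable_mult_right[OF qi] by (subst Bochner_Integration.integral_add) auto
    also have "\<dots> \<le> \<eta> * M + (D * norm c powr p) * (\<integral>z. case_prod ?q z \<partial>N n)"
      using assms energy_bound[of n] by simp
    finally show "integrable (N n) (\<lambda>z. separated S c g z * T n z) \<and>
       \<bar>\<integral>z. separated S c g z * T n z \<partial>N n\<bar> \<le>
         \<eta> * M + (D * norm c powr p) * ((\<integral>h. indicator S h * norm h powr p \<partial>\<mu> n) * (\<integral>x. \<bar>g x\<bar> \<partial>lborel))"
      using i qint by simp
  qed
qed

lemma separated_pairing_integrable:
  assumes "S \<in> sets borel" "S \<subseteq> ball 0 1" "integrable lborel g" "\<forall>x. \<bar>g x\<bar> \<le> 1"
  shows "integrable (N n) (\<lambda>z. separated S c g z * T n z)"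
  by (rule separated_pairing_estimate[OF zero_less_one, of c]) (use assms in blast)

lemma integral_w_tendsto:
  assumes L: "compact L" "L \<subseteq> \<Omega>" and [measurable]: "f \<in> borel_measurable borel"
    and B: "0 \<le> B" "\<And>x. \<bar>f x\<bar> \<le> B * indicator L x"
  shows "(\<lambda>n. \<integral>x. w n x * f x \<partial>lborel) \<longlonglongrightarrow> (\<integral>x. w\<^sub>0 x * f x \<partial>lborel)"
proof -
  have [measurable]: "L \<in> sets borel" using L by (simp add: borel_compact)
  let ?d = "\<lambda>n x. w n x - w\<^sub>0 x"
  let ?d' = "\<lambda>n x. indicator L x *\<^sub>R ?d n x"
  have d: "p_integrable p lborel (?d n)" for n
    by (rule p_integrable_diff[OF p_gt_0 w_p_integrable limit_p_integrable])
  have d': "p_integrable p lborel (?d' n)" for n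
  proof (rule p_integrable_bound)
    show "integrable lborel (\<lambda>x. norm (?d n x) powr p)" by (rule p_integrable_integrable[OF d])
    show "AE x in lborel. norm (?d' n x) powr p \<le> norm (?d n x) powr p"
      by (intro AE_I2) (auto simp: indicator_def)
  qed measurable
  have "norm (?d' n x) powr p = indicator L x * norm (?d n x) powr p" for n x
    by (auto simp: indicator_def)
  then have "(\<lambda>n. \<integral>x. norm (?d' n x) powr p \<partial>lborel) \<longlonglongrightarrow> 0"
    using w_tendsto_loc[OF L] by simp
  from L1_tendsto_0_on_compact[OF p_gt_1 d' this L(1) assms(3) B]
  have lim: "(\<lambda>n. \<integral>x. norm (f x *\<^sub>R ?d' n x) \<partial>lborel) \<longlonglongrightarrow> 0" .
  have i: "integrable lborel (\<lambda>x. w n x * f x)" "integrable lborel (\<lambda>x. w\<^sub>0 x * f x)" for n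
    using p_integrable_times_bounded(1)[OF p_gt_1 w_p_integrable L(1) _ B]
      p_integrable_times_bounded(1)[OF p_gt_1 limit_p_integrable L(1) _ B]
    by (simp_all add: mult.commute)
  have le: "norm ((\<integral>x. w n x * f x \<partial>lborel) - (\<integral>x. w\<^sub>0 x * f x \<partial>lborel)) \<le> (\<integral>x. norm (f x *\<^sub>R ?d' n x) \<partial>lborel)" for n
  proof -
    have eq: "\<bar>?d n x * f x\<bar> = norm (f x *\<^sub>R ?d' n x)" for x
      using B(2)[of x] by (cases "x \<in> L") (auto simp: abs_mult mult.commute)
    have "(\<integral>x. w n x * f x \<partial>lborel) - (\<integral>x. w\<^sub>0 x * f x \<partial>lborel) = (\<integral>x. ?d n x * f x \<partial>lborel)"
      using i by (simp add: left_diff_distrib)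
    then show ?thesis
      using integral_abs_bound[of lborel "\<lambda>x. ?d n x * f x"] by (simp only: eq real_norm_def)
  qed
  have "(\<lambda>n. (\<integral>x. w n x * f x \<partial>lborel) - (\<integral>x. w\<^sub>0 x * f x \<partial>lborel)) \<longlonglongrightarrow> 0"
    by (rule Lim_null_comparison[OF _ lim]) (use le in simp)
  then show ?thesis by (rule LIM_zero_cancel)
qed

text \<open>
  The discrete integration by parts: for fixed \<open>h\<close> the increment of \<open>w\<^sub>n\<close> is moved onto the test function \<open>\<psi>\<close>,
  whose increment is its derivative up to \<open>o(\<bar>h\<bar>)\<close>. The remaining integral in \<open>h\<close> is a moment of the kernel.
\<close>

lemma test_pairing_near_diagonal:
  assumes \<psi>: "\<psi> \<in> test_functions \<Omega>" "\<forall>x. \<bar>\<psi> x\<bar> \<le> 1" and "0 < \<eta>"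
  obtains r where "0 < r" "r \<le> 1"
    "\<And>n. \<bar>(\<integral>z. separated (ball 0 r) c \<psi> z * T n z \<partial>N n) +
       K * (\<integral>h. indicator (ball 0 r) h * norm h powr p \<partial>\<mu> n) * (\<integral>x. w n x * (tgrad \<psi> x \<bullet> pflux p c) \<partial>lborel)\<bar>
       \<le> \<eta> * (norm c powr (p - 1) * (measure lborel (unit_nbhd (csupp \<psi>)) + M))"
proof -
  let ?S = "csupp \<psi>" and ?L = "unit_nbhd (csupp \<psi>)"
  have S: "compact ?S" "?S \<subseteq> \<Omega>" using compact_csupp[OF \<psi>(1)] csupp_subset[OF \<psi>(1)] .
  have L: "compact ?L" by (rule compact_unit_nbhd[OF S(1)])
  have Lb [measurable]: "?L \<in> sets borel" using L by (simp add: borel_compact)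
  have \<psi>c: "continuous_on UNIV \<psi>" "continuous_on UNIV (tgrad \<psi>)"
    using continuous_on_test_function[OF \<psi>(1)] continuous_on_tgrad[OF \<psi>(1)] by auto
  then have [measurable]: "\<psi> \<in> borel_measurable borel" "tgrad \<psi> \<in> borel_measurable borel"
    by (auto intro: borel_measurable_continuous_onI)
  have \<psi>i: "integrable lborel \<psi>" by (rule test_function_integrable[OF \<psi>(1)])
  obtain \<delta>1 where \<delta>1: "0 < \<delta>1" "(\<Union>x\<in>?S. ball x \<delta>1) \<subseteq> \<Omega>"
    using compact_subset_open_imp_ball_epsilon_subset[OF S(1) open_domain S(2)] by metis
  obtain \<delta>2 where \<delta>2: "0 < \<delta>2" "\<delta>2 \<le> 1" "\<And>x h. norm h \<le> \<delta>2 \<Longrightarrow>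
      \<bar>\<psi> (x + h) - \<psi> x - tgrad \<psi> x \<bullet> h\<bar> \<le> \<eta> * norm h * indicator ?L x"
    using test_function_has_derivative[OF \<psi>(1)] \<psi>c(2) S(1) zero_outside_csupp \<open>0 < \<eta>\<close>
    by (rule uniform_first_order_expansion) (assumption | rule that)+
  define r where "r = min \<delta>1 \<delta>2"
  have r: "0 < r" "r \<le> 1" using \<delta>1 \<delta>2 by (auto simp: r_def)
  have sub: "ball (0::'a) r \<subseteq> ball 0 1" using r by auto
  show thesis
  proof (rule that[OF r])
    fix n
    interpret P: pair_sigma_finite "\<mu> n" lborel by (rule pair_sigma_finite_kernel)
    have w: "p_integrable p lborel (w n)" by (rule w_p_integrable)
    let ?m = "\<integral>h. indicator (ball 0 r) h * norm h powr p \<partial>\<mu> n"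
    define C where "C = measure lborel ?L + M"
    have C0: "0 \<le> C" using M_nonneg by (simp add: C_def)
    define z where "z = (\<integral>x. w n x *\<^sub>R tgrad \<psi> x \<partial>lborel)"
    obtain B where B: "0 < B" "\<And>x. norm (tgrad \<psi> x) \<le> B"
      using \<psi>c(2) S(1) tgrad_zero_outside_csupp[OF \<psi>(1)] by (rule compact_support_bounded) (assumption | rule that)+
    have grad_le: "\<bar>tgrad \<psi> x \<bullet> b\<bar> \<le> B * norm b * indicator ?S x" for x b
    proof (cases "x \<in> ?S")
      case True
      have "\<bar>tgrad \<psi> x \<bullet> b\<bar> \<le> norm (tgrad \<psi> x) * norm b" by (rule Cauchy_Schwarz_ineq2)
      also have "\<dots> \<le> B * norm b" by (intro mult_right_mono B) auto
      finally show ?thesis using True by simp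
    qed (simp add: tgrad_zero_outside_csupp[OF \<psi>(1)])
    have wgi: "integrable lborel (\<lambda>x. w n x * (tgrad \<psi> x \<bullet> b))" for b
      using p_integrable_times_bounded(1)[OF p_gt_1 w S(1) _ _ grad_le[of _ b]] B(1)
      by (simp add: mult.commute)
    have wgi': "integrable lborel (\<lambda>x. w n x *\<^sub>R tgrad \<psi> x)"
    proof (rule Bochner_Integration.integrable_bound)
      have "integrable lborel (\<lambda>x. (B * indicator ?S x) *\<^sub>R w n x)"
        using B(1) S(1) by (intro p_integrable_times_bounded(1)[OF p_gt_1 w S(1), of _ B])
          (auto intro!: borel_measurable_times borel_measurable_indicator borel_compact)
      then show "integrable lborel (\<lambda>x. \<bar>(B * indicator ?S x) * w n x\<bar>)" by simp
      show "AE x in lborel. norm (w n x *\<^sub>R tgrad \<psi> x) \<le> norm \<bar>(B * indicator ?S x) * w n x\<bar>"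
      proof (rule AE_I2)
        fix x
        show "norm (w n x *\<^sub>R tgrad \<psi> x) \<le> norm \<bar>(B * indicator ?S x) * w n x\<bar>"
          using B(1) mult_left_mono[OF B(2)[of x] abs_ge_zero[of "w n x"]] tgrad_zero_outside_csupp[OF \<psi>(1), of x]
          by (cases "x \<in> ?S") (auto simp: abs_mult mult.commute[of B])
      qed
    qed measurable
    have zb: "z \<bullet> b = (\<integral>x. w n x * (tgrad \<psi> x \<bullet> b) \<partial>lborel)" for b
      unfolding z_def by (subst integral_inner_left[OF wgi', symmetric]) simp
    have Li: "integrable lborel (\<lambda>x. indicator ?L x * \<bar>w n x\<bar>)"
      and Lint: "(\<integral>x. indicator ?L x * \<bar>w n x\<bar> \<partial>lborel) \<le> C"
    proof -
      have 1: "integrable lborel (\<lambda>x. indicat_real ?L x *\<^sub>R w n x)"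
        "(\<integral>x. norm (indicat_real ?L x *\<^sub>R w n x) \<partial>lborel) \<le> 1 * (measure lborel ?L + (\<integral>x. norm (w n x) powr p \<partial>lborel))"
        by (rule p_integrable_times_bounded[OF p_gt_1 w L, of _ 1]; simp)+
      show "integrable lborel (\<lambda>x. indicator ?L x * \<bar>w n x\<bar>)"
        using integrable_norm[OF 1(1)] by (simp add: abs_mult)
      show "(\<integral>x. indicator ?L x * \<bar>w n x\<bar> \<partial>lborel) \<le> C"
        using 1(2) w_bound[of n] by (simp add: abs_mult C_def)
    qed
    define D where "D h = (\<integral>x. \<psi> x * T n (h, x) \<partial>lborel)" for h
    have D_approx: "\<bar>D h + z \<bullet> h\<bar> \<le> \<eta> * norm h * C" if h: "h \<in> ball 0 r" for h
    proof -
      have eq: "\<psi> x * T n (h, x) = \<psi> x * w n x - \<psi> x * w n (x - h)" for x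
      proof (cases "x \<in> ?S")
        case True
        then have "x \<in> \<Omega>" using S(2) by blast
        have "x - h \<in> ball x \<delta>1" using h by (simp add: r_def dist_norm)
        then have "x - h \<in> \<Omega>" using True \<delta>1(2) by blast
        with \<open>x \<in> \<Omega>\<close> show ?thesis by (simp add: local_increment_def algebra_simps)
      next
        case False
        then show ?thesis using zero_outside_csupp[of x \<psi>] by simp
      qed
      have \<psi>le: "\<bar>\<psi> x\<bar> \<le> 1 * indicator ?S x" for x
        using \<psi>(2) zero_outside_csupp[of x \<psi>] by (cases "x \<in> ?S") auto
      have i1: "integrable lborel (\<lambda>x. \<psi> x * w n x)"
        using p_integrable_times_bounded(1)[OF p_gt_1 w S(1) _ _ \<psi>le] by simp
      have wh: "p_integrable p lborel (\<lambda>x. w n (x - h))" using p_integrable_translate(1)[OF w, of "- h"] by simp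
      have i2: "integrable lborel (\<lambda>x. \<psi> x * w n (x - h))"
        using p_integrable_times_bounded(1)[OF p_gt_1 wh S(1) _ _ \<psi>le] by simp
      have i3: "integrable lborel (\<lambda>x. \<psi> (x + h) * w n x)"
        using lborel_integral_translate(2)[of "\<lambda>x. \<psi> x * w n (x - h)" h] i2 by simp
      have "D h = (\<integral>x. \<psi> x * w n x \<partial>lborel) - (\<integral>x. \<psi> x * w n (x - h) \<partial>lborel)"
        unfolding D_def eq using i1 i2 by simp
      also have "(\<integral>x. \<psi> x * w n (x - h) \<partial>lborel) = (\<integral>x. \<psi> (x + h) * w n x \<partial>lborel)"
        using lborel_integral_translate(1)[of "\<lambda>x. \<psi> x * w n (x - h)" h] by simp
      finally have "D h + z \<bullet> h = - (\<integral>x. (\<psi> (x + h) - \<psi> x - tgrad \<psi> x \<bullet> h) * w n x \<partial>lborel)"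
        using i1 i3 wgi[of h] by (simp add: zb left_diff_distrib mult.commute[of "w n _"])
      then have "\<bar>D h + z \<bullet> h\<bar> = \<bar>\<integral>x. (\<psi> (x + h) - \<psi> x - tgrad \<psi> x \<bullet> h) * w n x \<partial>lborel\<bar>" by simp
      also have "\<dots> \<le> (\<integral>x. \<bar>(\<psi> (x + h) - \<psi> x - tgrad \<psi> x \<bullet> h) * w n x\<bar> \<partial>lborel)"
        by (rule integral_abs_bound)
      also have "\<dots> \<le> (\<integral>x. \<eta> * norm h * (indicator ?L x * \<bar>w n x\<bar>) \<partial>lborel)"
      proof (rule integral_mono)
        have "integrable lborel (\<lambda>x. (\<psi> (x + h) - \<psi> x - tgrad \<psi> x \<bullet> h) * w n x)"
          using i1 i3 wgi[of h] by (simp add: left_diff_distrib mult.commute[of "w n _"])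
        then show "integrable lborel (\<lambda>x. \<bar>(\<psi> (x + h) - \<psi> x - tgrad \<psi> x \<bullet> h) * w n x\<bar>)" by simp
        show "integrable lborel (\<lambda>x. \<eta> * norm h * (indicator ?L x * \<bar>w n x\<bar>))"
          using Li by (rule integrable_mult_right)
        fix x
        have "norm h \<le> \<delta>2" using h by (simp add: r_def)
        from mult_right_mono[OF \<delta>2(3)[OF this, of x] abs_ge_zero[of "w n x"]]
        show "\<bar>(\<psi> (x + h) - \<psi> x - tgrad \<psi> x \<bullet> h) * w n x\<bar> \<le> \<eta> * norm h * (indicator ?L x * \<bar>w n x\<bar>)"
          by (simp add: abs_mult mult.assoc)
      qed
      also have "\<dots> = \<eta> * norm h * (\<integral>x. indicator ?L x * \<bar>w n x\<bar> \<partial>lborel)" by simp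
      also have "\<dots> \<le> \<eta> * norm h * C" using Lint \<open>0 < \<eta>\<close> by (intro mult_left_mono) auto
      finally show ?thesis .
    qed
    have sep: "integrable (N n) (\<lambda>z. separated (ball 0 r) c \<psi> z * T n z)"
      by (rule separated_pairing_integrable[OF _ sub \<psi>i \<psi>(2)]) simp
    have fib: "(\<integral>x. separated (ball 0 r) c \<psi> (h, x) * T n (h, x) \<partial>lborel) = indicator (ball 0 r) h * pflux p (c \<bullet> h) * D h" for h
      by (simp add: separated_def D_def mult.assoc)
    have Di: "integrable (\<mu> n) (\<lambda>h. indicator (ball 0 r) h * pflux p (c \<bullet> h) * D h)"
      using P.integrable_fst'[OF sep] unfolding fib .
    have "(\<integral>z. separated (ball 0 r) c \<psi> z * T n z \<partial>N n) = (\<integral>h. indicator (ball 0 r) h * pflux p (c \<bullet> h) * D h \<partial>\<mu> n)"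
      using P.integral_fst'[OF sep] unfolding fib by simp
    moreover have "(\<integral>h. indicator (ball 0 r) h * (pflux p (c \<bullet> h) * (z \<bullet> h)) \<partial>\<mu> n) = K * ?m * (pflux p c \<bullet> z)"
      and zi: "integrable (\<mu> n) (\<lambda>h. indicator (ball 0 r) h * (pflux p (c \<bullet> h) * (z \<bullet> h)))"
      using radial_flux_integral[OF p_gt_1 norm_e sets_kernel sigma_finite_kernel kernel_reflect
          integrable_ball_moment(1)[OF _ sub], of n c z] by auto
    moreover have "pflux p c \<bullet> z = (\<integral>x. w n x * (tgrad \<psi> x \<bullet> pflux p c) \<partial>lborel)"
      by (subst inner_commute) (rule zb)
    ultimately have "(\<integral>z. separated (ball 0 r) c \<psi> z * T n z \<partial>N n) + K * ?m * (\<integral>x. w n x * (tgrad \<psi> x \<bullet> pflux p c) \<partial>lborel)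
        = (\<integral>h. indicator (ball 0 r) h * pflux p (c \<bullet> h) * D h + indicator (ball 0 r) h * (pflux p (c \<bullet> h) * (z \<bullet> h)) \<partial>\<mu> n)"
      using Di by simp
    also have "\<dots> = (\<integral>h. indicator (ball 0 r) h * pflux p (c \<bullet> h) * (D h + z \<bullet> h) \<partial>\<mu> n)"
      by (simp add: algebra_simps)
    finally have "\<bar>(\<integral>z. separated (ball 0 r) c \<psi> z * T n z \<partial>N n) + K * ?m * (\<integral>x. w n x * (tgrad \<psi> x \<bullet> pflux p c) \<partial>lborel)\<bar>
        = \<bar>\<integral>h. indicator (ball 0 r) h * pflux p (c \<bullet> h) * (D h + z \<bullet> h) \<partial>\<mu> n\<bar>" by simp
    also have "\<dots> \<le> (\<integral>h. \<bar>indicator (ball 0 r) h * pflux p (c \<bullet> h) * (D h + z \<bullet> h)\<bar> \<partial>\<mu> n)"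
      by (rule integral_abs_bound)
    also have "\<dots> \<le> (\<integral>h. \<eta> * (norm c powr (p - 1) * C) * (indicator (ball 0 r) h * norm h powr p) \<partial>\<mu> n)"
    proof (rule integral_mono)
      have "integrable (\<mu> n) (\<lambda>h. indicator (ball 0 r) h * pflux p (c \<bullet> h) * D h + indicator (ball 0 r) h * (pflux p (c \<bullet> h) * (z \<bullet> h)))"
        using Di zi by (rule Bochner_Integration.integrable_add)
      then have "integrable (\<mu> n) (\<lambda>h. indicator (ball 0 r) h * pflux p (c \<bullet> h) * (D h + z \<bullet> h))"
        by (simp add: algebra_simps)
      then show "integrable (\<mu> n) (\<lambda>h. \<bar>indicator (ball 0 r) h * pflux p (c \<bullet> h) * (D h + z \<bullet> h)\<bar>)" by simp
      show "integrable (\<mu> n) (\<lambda>h. \<eta> * (norm c powr (p - 1) * C) * (indicator (ball 0 r) h * norm h powr p))"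
        by (intro integrable_mult_right integrable_ball_moment(1) sub) simp
      fix h
      show "\<bar>indicator (ball 0 r) h * pflux p (c \<bullet> h) * (D h + z \<bullet> h)\<bar> \<le>
          \<eta> * (norm c powr (p - 1) * C) * (indicator (ball 0 r) h * norm h powr p)"
      proof (cases "h \<in> ball 0 r")
        case True
        have "\<bar>pflux p (c \<bullet> h) * (D h + z \<bullet> h)\<bar> = \<bar>c \<bullet> h\<bar> powr (p - 1) * \<bar>D h + z \<bullet> h\<bar>"
          using norm_pflux[of p "c \<bullet> h"] by (simp add: abs_mult)
        also have "\<dots> \<le> (norm c * norm h) powr (p - 1) * (\<eta> * norm h * C)"
          using p_gt_1 by (intro mult_mono powr_mono2 Cauchy_Schwarz_ineq2 D_approx True) auto
        also have "\<dots> = \<eta> * (norm c powr (p - 1) * C) * (norm h powr (p - 1) * norm h)"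
          by (simp add: powr_mult mult_ac)
        also have "norm h powr (p - 1) * norm h = norm h powr p"
          using powr_mult_self[of "norm h" "p - 1"] by simp
        finally show ?thesis using True by simp
      qed simp
    qed
    also have "\<dots> = \<eta> * (norm c powr (p - 1) * C) * ?m" by simp
    also have "\<dots> \<le> \<eta> * (norm c powr (p - 1) * C) * 1"
      using \<open>0 < \<eta>\<close> C0 by (intro mult_left_mono integrable_ball_moment(2) sub) auto
    finally show "\<bar>(\<integral>z. separated (ball 0 r) c \<psi> z * T n z \<partial>N n) + K * ?m * (\<integral>x. w n x * (tgrad \<psi> x \<bullet> pflux p c) \<partial>lborel)\<bar>
       \<le> \<eta> * (norm c powr (p - 1) * (measure lborel ?L + M))" by (simp add: C_def)
  qed
qed

end

context bounded_energy_sequence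
begin

lemma bounded_times_gradient:
  assumes g: "integrable lborel g" "\<forall>x. \<bar>g x\<bar> \<le> 1"
  shows "integrable lborel (\<lambda>x. g x * (b \<bullet> V x))"
proof (rule Bochner_Integration.integrable_bound)
  have [measurable]: "g \<in> borel_measurable borel" using g by auto
  show "integrable lborel (\<lambda>x. norm b * (\<bar>g x\<bar> + norm (V x) powr p))"
    using g by (intro integrable_mult_right Bochner_Integration.integrable_add p_integrable_integrable gradient_p_integrable) auto
  show "(\<lambda>x. g x * (b \<bullet> V x)) \<in> borel_measurable lborel" by measurable
  show "AE x in lborel. norm (g x * (b \<bullet> V x)) \<le> norm (norm b * (\<bar>g x\<bar> + norm (V x) powr p))"
  proof (rule AE_I2)
    fix x
    have "\<bar>g x\<bar> * norm (V x) \<le> \<bar>g x\<bar> + norm (V x) powr p"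
    proof -
      have "\<bar>g x\<bar> * norm (V x) \<le> \<bar>g x\<bar> * (1 + norm (V x) powr p)"
        by (intro mult_left_mono le_one_plus_powr p_gt_1) auto
      also have "\<dots> \<le> \<bar>g x\<bar> + norm (V x) powr p"
        using g(2) mult_right_mono[of "\<bar>g x\<bar>" 1 "norm (V x) powr p"] by (simp add: distrib_left)
      finally show ?thesis .
    qed
    then have "norm b * (\<bar>g x\<bar> * norm (V x)) \<le> norm b * (\<bar>g x\<bar> + norm (V x) powr p)"
      by (rule mult_left_mono) simp
    moreover have "\<bar>g x * (b \<bullet> V x)\<bar> \<le> norm b * (\<bar>g x\<bar> * norm (V x))"
      using mult_left_mono[OF Cauchy_Schwarz_ineq2[of b "V x"] abs_ge_zero[of "g x"]]
      by (simp add: abs_mult mult.left_commute)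
    ultimately show "norm (g x * (b \<bullet> V x)) \<le> norm (norm b * (\<bar>g x\<bar> + norm (V x) powr p))"
      by simp
  qed
qed

text \<open>
  Near the diagonal the pairing is \<open>- K \<integral> w\<^sub>n (grad \<psi> \<bullet> pflux p c)\<close> up to a small error; there \<open>w\<^sub>n\<close> converges in \<open>L\<^sup>1\<close> on the
  support of \<open>\<psi>\<close>, and the definition of the weak gradient turns the limit into \<open>K \<integral> \<psi> (pflux p c \<bullet> V)\<close>. Away from the
  diagonal the kernels vanish in the limit.
\<close>

lemma test_pairing_tendsto:
  assumes \<psi>: "\<psi> \<in> test_functions \<Omega>" "\<forall>x. \<bar>\<psi> x\<bar> \<le> 1"
  shows "(\<lambda>n. \<integral>z. separated (ball 0 1) c \<psi> z * T n z \<partial>N n) \<longlonglongrightarrow> K * (\<integral>x. \<psi> x * (pflux p c \<bullet> V x) \<partial>lborel)"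
proof (rule tendsto_if_eventually_le_multiple)
  define C where "C = norm c powr (p - 1) * (measure lborel (unit_nbhd (csupp \<psi>)) + M)"
  have C0: "0 \<le> C" using M_nonneg by (simp add: C_def)
  then show "0 \<le> C + M + 2" using M_nonneg by simp
  fix \<eta> :: real assume \<eta>: "0 < \<eta>"
  have \<psi>i: "integrable lborel \<psi>" by (rule test_function_integrable[OF \<psi>(1)])
  obtain r where r: "0 < r" "r \<le> 1"
    "\<And>n. \<bar>(\<integral>z. separated (ball 0 r) c \<psi> z * T n z \<partial>N n) +
       K * (\<integral>h. indicator (ball 0 r) h * norm h powr p \<partial>\<mu> n) * (\<integral>x. w n x * (tgrad \<psi> x \<bullet> pflux p c) \<partial>lborel)\<bar>
       \<le> \<eta> * C"
    by (rule test_pairing_near_diagonal[OF \<psi> \<eta>, where c = c, folded C_def]) (assumption | rule that)+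
  obtain D where D: "0 \<le> D"
    "\<And>n S g. S \<in> sets borel \<Longrightarrow> S \<subseteq> ball 0 1 \<Longrightarrow> integrable lborel g \<Longrightarrow> (\<forall>x. \<bar>g x\<bar> \<le> 1) \<Longrightarrow>
       integrable (N n) (\<lambda>z. separated S c g z * T n z) \<and>
       \<bar>\<integral>z. separated S c g z * T n z \<partial>N n\<bar> \<le>
         \<eta> * M + D * ((\<integral>h. indicator S h * norm h powr p \<partial>\<mu> n) * (\<integral>x. \<bar>g x\<bar> \<partial>lborel))"
    using \<eta> by (rule separated_pairing_estimate[of \<eta> c]) (assumption | rule that)+
  let ?A = "ball (0::'a) 1 - ball 0 r"
  let ?m = "\<lambda>n. \<integral>h. indicator (ball 0 r) h * norm h powr p \<partial>\<mu> n"
  let ?y = "\<lambda>n. K * ?m n * (\<integral>x. w n x * (tgrad \<psi> x \<bullet> pflux p c) \<partial>lborel)"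
  let ?l = "K * (\<integral>x. \<psi> x * (pflux p c \<bullet> V x) \<partial>lborel)"
  have \<psi>c: "continuous_on UNIV (tgrad \<psi>)" by (rule continuous_on_tgrad[OF \<psi>(1)])
  then have [measurable]: "tgrad \<psi> \<in> borel_measurable borel" by (rule borel_measurable_continuous_onI)
  obtain B where B: "0 < B" "\<And>x. norm (tgrad \<psi> x) \<le> B"
    using \<psi>c compact_csupp[OF \<psi>(1)] tgrad_zero_outside_csupp[OF \<psi>(1)]
    by (rule compact_support_bounded) (assumption | rule that)+
  have "(\<lambda>n. \<integral>x. w n x * (tgrad \<psi> x \<bullet> pflux p c) \<partial>lborel) \<longlonglongrightarrow> (\<integral>x. w\<^sub>0 x * (tgrad \<psi> x \<bullet> pflux p c) \<partial>lborel)"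
  proof (rule integral_w_tendsto[OF compact_csupp[OF \<psi>(1)] csupp_subset[OF \<psi>(1)]])
    show "0 \<le> B * norm (pflux p c)" using B(1) by simp
    show "\<bar>tgrad \<psi> x \<bullet> pflux p c\<bar> \<le> B * norm (pflux p c) * indicator (csupp \<psi>) x" for x
    proof (cases "x \<in> csupp \<psi>")
      case True
      have "\<bar>tgrad \<psi> x \<bullet> pflux p c\<bar> \<le> norm (tgrad \<psi> x) * norm (pflux p c)" by (rule Cauchy_Schwarz_ineq2)
      also have "\<dots> \<le> B * norm (pflux p c)" by (intro mult_right_mono B) auto
      finally show ?thesis using True by simp
    qed (simp add: tgrad_zero_outside_csupp[OF \<psi>(1)])
  qed measurable
  then have "?y \<longlonglongrightarrow> K * 1 * (\<integral>x. w\<^sub>0 x * (tgrad \<psi> x \<bullet> pflux p c) \<partial>lborel)"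
    by (intro tendsto_mult tendsto_const ball_moment_tendsto_1 r(1,2))
  also have "(\<integral>x. w\<^sub>0 x * (tgrad \<psi> x \<bullet> pflux p c) \<partial>lborel) = - (\<integral>x. (V x \<bullet> pflux p c) * \<psi> x \<partial>lborel)"
    using gradient_weak \<psi>(1) unfolding borel_weak_grad_def by blast
  also have "(\<integral>x. (V x \<bullet> pflux p c) * \<psi> x \<partial>lborel) = (\<integral>x. \<psi> x * (pflux p c \<bullet> V x) \<partial>lborel)"
    by (simp add: inner_commute mult.commute)
  finally have "(\<lambda>n. ?y n + ?l) \<longlonglongrightarrow> - ?l + ?l" by (intro tendsto_add tendsto_const) simp
  then have "eventually (\<lambda>n. \<bar>?y n + ?l\<bar> < \<eta>) sequentially"
    using tendstoD[OF _ \<eta>] by (force simp: dist_real_def)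
  moreover have "eventually (\<lambda>n. D * (annulus_moment n r * (\<integral>x. \<bar>\<psi> x\<bar> \<partial>lborel)) < \<eta>) sequentially"
  proof -
    have "(\<lambda>n. D * (annulus_moment n r * (\<integral>x. \<bar>\<psi> x\<bar> \<partial>lborel))) \<longlonglongrightarrow> D * (0 * (\<integral>x. \<bar>\<psi> x\<bar> \<partial>lborel))"
      by (intro tendsto_intros annulus_moment_tendsto_0 r)
    then show ?thesis using \<eta> by (intro order_tendstoD(2)) auto
  qed
  ultimately show "eventually (\<lambda>n. \<bar>(\<integral>z. separated (ball 0 1) c \<psi> z * T n z \<partial>N n) - ?l\<bar> \<le> (C + M + 2) * \<eta>) sequentially"
  proof eventually_elim
    case (elim n)
    have A: "?A \<in> sets borel" "?A \<subseteq> ball 0 1" by auto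
    have R: "ball 0 r \<in> sets borel" "ball (0::'a) r \<subseteq> ball 0 1" using r(2) by auto
    have "separated (ball 0 1) c \<psi> z * T n z = separated (ball 0 r) c \<psi> z * T n z + separated ?A c \<psi> z * T n z" for z
      using r(2) by (cases z) (auto simp: separated_def indicator_def)
    then have "(\<integral>z. separated (ball 0 1) c \<psi> z * T n z \<partial>N n) =
        (\<integral>z. separated (ball 0 r) c \<psi> z * T n z \<partial>N n) + (\<integral>z. separated ?A c \<psi> z * T n z \<partial>N n)"
      using D(2)[OF A \<psi>i \<psi>(2), of n] D(2)[OF R \<psi>i \<psi>(2), of n] by simp
    moreover have "\<bar>\<integral>z. separated ?A c \<psi> z * T n z \<partial>N n\<bar> \<le> \<eta> * M + \<eta>"
      using D(2)[OF A \<psi>i \<psi>(2), of n] elim(2) by (simp add: annulus_moment_def)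
    ultimately have "\<bar>(\<integral>z. separated (ball 0 1) c \<psi> z * T n z \<partial>N n) - ?l\<bar> \<le> \<eta> * C + \<eta> + (\<eta> * M + \<eta>)"
      using r(3)[of n] elim(1) by linarith
    then show ?case by (simp add: algebra_simps)
  qed
qed

text \<open>
  Increments of \<open>w n\<close> can be integrated by parts only against smooth weights; measurable sets are reached through
  the uniform estimate for weights that are small in \<open>L\<^sup>1\<close>.
\<close>

lemma set_pairing_tendsto:
  assumes B: "B \<in> sets borel" "emeasure lborel B < \<infinity>" "B \<subseteq> \<Omega>"
  shows "(\<lambda>n. \<integral>z. separated (ball 0 1) c (indicator B) z * T n z \<partial>N n) \<longlonglongrightarrow>
    K * (\<integral>x. indicator B x * (pflux p c \<bullet> V x) \<partial>lborel)"
proof (rule tendsto_if_eventually_le_multiple)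
  let ?v = "\<integral>x. norm (V x) powr p \<partial>lborel"
  let ?b = "norm (pflux p c)"
  define C where "C = K * ?b * (?v + 1)"
  have v0: "0 \<le> ?v" by (rule integral_powr_nonneg)
  have K0: "0 \<le> K" by (rule K_const_nonneg)
  have C0: "0 \<le> C" unfolding C_def using v0 K0 by (intro mult_nonneg_nonneg) auto
  then show "0 \<le> C + M + 2" using M_nonneg by simp
  fix \<eta> :: real assume \<eta>: "0 < \<eta>"
  obtain D where D: "0 \<le> D"
    "\<And>n S g. S \<in> sets borel \<Longrightarrow> S \<subseteq> ball 0 1 \<Longrightarrow> integrable lborel g \<Longrightarrow> (\<forall>x. \<bar>g x\<bar> \<le> 1) \<Longrightarrow>
       integrable (N n) (\<lambda>z. separated S c g z * T n z) \<and>
       \<bar>\<integral>z. separated S c g z * T n z \<partial>N n\<bar> \<le>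
         \<eta> * M + D * ((\<integral>h. indicator S h * norm h powr p \<partial>\<mu> n) * (\<integral>x. \<bar>g x\<bar> \<partial>lborel))"
    using \<eta> by (rule separated_pairing_estimate[of \<eta> c]) (assumption | rule that)+
  obtain D' where D': "0 \<le> D'" "\<And>\<alpha> s t. 0 \<le> \<alpha> \<Longrightarrow> \<alpha> \<le> 1 \<Longrightarrow> 0 \<le> s \<Longrightarrow> 0 \<le> t \<Longrightarrow>
       \<alpha> * s powr (p - 1) * t \<le> \<eta> * t powr p + D' * \<alpha> * s powr p"
    using p_gt_1 \<eta> zero_le_one by (rule weighted_powr_absorb) (assumption | rule that)+
  obtain \<eta>' where \<eta>': "0 < \<eta>'" "\<eta>' * (D + D') \<le> \<eta>"
    by (rule small_multiple[OF \<eta>, of "D + D'"]) (use D(1) D'(1) in auto)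
  obtain \<psi> where \<psi>: "\<psi> \<in> test_functions \<Omega>" "\<forall>x. 0 \<le> \<psi> x \<and> \<psi> x \<le> 1"
    "(\<integral>x. \<bar>indicator B x - \<psi> x\<bar> \<partial>lborel) < \<eta>'"
    by (rule indicator_approx_by_test_function[OF B(1,2) open_domain B(3) \<eta>'(1)]) blast
  have \<psi>i: "integrable lborel \<psi>" by (rule test_function_integrable[OF \<psi>(1)])
  have Bi: "integrable lborel (indicat_real B)" using B by (intro integrable_real_indicator) auto
  define g where "g x = indicat_real B x - \<psi> x" for x
  have g: "integrable lborel g" "\<forall>x. \<bar>g x\<bar> \<le> 1"
  proof -
    show "integrable lborel g" unfolding g_def using Bi \<psi>i by (rule Bochner_Integration.integrable_diff)
    show "\<forall>x. \<bar>g x\<bar> \<le> 1"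
    proof
      fix x show "\<bar>g x\<bar> \<le> 1" unfolding g_def using \<psi>(2)[rule_format, of x] by (cases "x \<in> B") auto
    qed
  qed
  have \<psi>1: "\<forall>x. \<bar>\<psi> x\<bar> \<le> 1" using \<psi>(2) by auto
  let ?L = "\<lambda>g n. \<integral>z. separated (ball 0 1) c g z * T n z \<partial>N n"
  let ?l = "\<lambda>g. K * (\<integral>x. g x * (pflux p c \<bullet> V x) \<partial>lborel)"
  have lg: "?l (indicator B) = ?l \<psi> + ?l g"
    using bounded_times_gradient[OF \<psi>i \<psi>1, of "pflux p c"] bounded_times_gradient[OF g, of "pflux p c"]
    by (simp add: distrib_left[symmetric] Bochner_Integration.integral_add[symmetric] g_def algebra_simps
        del: Bochner_Integration.integral_add)
  have lg_le: "\<bar>?l g\<bar> \<le> C * \<eta>"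
  proof -
    have "\<bar>\<integral>x. g x * (pflux p c \<bullet> V x) \<partial>lborel\<bar> \<le> (\<integral>x. \<bar>g x * (pflux p c \<bullet> V x)\<bar> \<partial>lborel)"
      by (rule integral_abs_bound)
    also have "\<dots> \<le> (\<integral>x. ?b * (\<eta> * norm (V x) powr p + D' * \<bar>g x\<bar>) \<partial>lborel)"
    proof (rule integral_mono)
      show "integrable lborel (\<lambda>x. \<bar>g x * (pflux p c \<bullet> V x)\<bar>)"
        using bounded_times_gradient[OF g] by (intro integrable_abs)
      show "integrable lborel (\<lambda>x. ?b * (\<eta> * norm (V x) powr p + D' * \<bar>g x\<bar>))"
        using g(1) by (intro integrable_mult_right Bochner_Integration.integrable_add p_integrable_integrable gradient_p_integrable) auto
      fix x
      have "\<bar>g x * (pflux p c \<bullet> V x)\<bar> \<le> ?b * (\<bar>g x\<bar> * norm (V x))"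
        using mult_left_mono[OF Cauchy_Schwarz_ineq2[of "pflux p c" "V x"] abs_ge_zero[of "g x"]]
        by (simp add: abs_mult mult.left_commute)
      also have "\<dots> \<le> ?b * (\<eta> * norm (V x) powr p + D' * \<bar>g x\<bar>)"
        using D'(2)[of "\<bar>g x\<bar>" 1 "norm (V x)"] g(2) by (intro mult_left_mono) auto
      finally show "\<bar>g x * (pflux p c \<bullet> V x)\<bar> \<le> ?b * (\<eta> * norm (V x) powr p + D' * \<bar>g x\<bar>)" .
    qed
    also have "\<dots> = ?b * (\<eta> * ?v + D' * (\<integral>x. \<bar>g x\<bar> \<partial>lborel))"
      using g(1) p_integrable_integrable[OF gradient_p_integrable] by simp
    also have "\<dots> \<le> ?b * (\<eta> * ?v + \<eta>)"
    proof (intro mult_left_mono add_left_mono)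
      have "D' * (\<integral>x. \<bar>g x\<bar> \<partial>lborel) \<le> D' * \<eta>'"
        using \<psi>(3) D'(1) by (intro mult_left_mono) (auto simp: g_def)
      also have "\<dots> \<le> \<eta>" using \<eta>' D(1) by (smt (verit) distrib_left mult.commute mult_nonneg_nonneg)
      finally show "D' * (\<integral>x. \<bar>g x\<bar> \<partial>lborel) \<le> \<eta>" .
    qed simp
    finally have "K * \<bar>\<integral>x. g x * (pflux p c \<bullet> V x) \<partial>lborel\<bar> \<le> K * (?b * (\<eta> * ?v + \<eta>))"
      using K0 by (rule mult_left_mono)
    then show ?thesis using K0 by (simp add: C_def abs_mult algebra_simps)
  qed
  have "eventually (\<lambda>n. \<bar>?L \<psi> n - ?l \<psi>\<bar> < \<eta>) sequentially"
    using tendstoD[OF test_pairing_tendsto[OF \<psi>(1) \<psi>1] \<eta>] by (simp add: dist_real_def)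
  then show "eventually (\<lambda>n. \<bar>?L (indicator B) n - ?l (indicator B)\<bar> \<le> (C + M + 2) * \<eta>) sequentially"
  proof eventually_elim
    case (elim n)
    have b: "ball 0 1 \<in> sets borel" "ball (0::'a) 1 \<subseteq> ball 0 1" by auto
    have "separated (ball 0 1) c (indicator B) z * T n z = separated (ball 0 1) c \<psi> z * T n z + separated (ball 0 1) c g z * T n z" for z
      by (cases z) (simp add: separated_def g_def algebra_simps)
    then have "?L (indicator B) n = ?L \<psi> n + ?L g n"
      using D(2)[OF b \<psi>i \<psi>1, of n] D(2)[OF b g, of n] by simp
    moreover have "\<bar>?L g n\<bar> \<le> \<eta> * M + \<eta>"
    proof -
      have "D * ((\<integral>h. indicator (ball 0 1) h * norm h powr p \<partial>\<mu> n) * (\<integral>x. \<bar>g x\<bar> \<partial>lborel)) \<le> D * (1 * \<eta>')"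
        using \<psi>(3) D(1) \<eta>'(1) by (intro mult_left_mono mult_mono integrable_ball_moment(2) b) (auto simp: g_def)
      also have "\<dots> \<le> \<eta>" using \<eta>' D'(1) by (smt (verit) distrib_left mult.commute mult_1 mult_nonneg_nonneg)
      finally show ?thesis using D(2)[OF b g, of n] by linarith
    qed
    ultimately have "\<bar>?L (indicator B) n - ?l (indicator B)\<bar> \<le> \<eta> + (\<eta> * M + \<eta>) + C * \<eta>"
      using elim lg lg_le by linarith
    then show ?case by (simp add: algebra_simps)
  qed
qed

text \<open>
  The level sets of a simple function are disjoint, so the nonlinear map \<open>pflux p\<close> acts on it term by term. This is why
  simple functions, and not combinations of test functions, are used to approximate \<open>G\<close>.
\<close>

lemma simple_pairing_tendsto:
  assumes \<Phi>: "simple_function lborel \<Phi>" "p_integrable p lborel \<Phi>" "\<And>x. x \<notin> \<Omega> \<Longrightarrow> \<Phi> x = 0"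
  shows "(\<lambda>n. \<integral>z. pflux p (linear_increment \<Phi> z) * T n z \<partial>N n) \<longlonglongrightarrow> K * (\<integral>x. pflux p (\<Phi> x) \<bullet> V x \<partial>lborel)"
proof -
  define S where "S = range \<Phi> - {0}"
  have fS: "finite S" using \<Phi>(1) by (simp add: simple_function_def S_def)
  define B where "B c = \<Phi> -` {c}" for c
  have B: "B c \<in> sets borel" "emeasure lborel (B c) < \<infinity>" "B c \<subseteq> \<Omega>" if "c \<in> S" for c
    using finite_measure_simple_function_level[OF \<Phi>(1,2), of c] that \<Phi>(3) by (auto simp: B_def S_def)
  have sel: "(\<Sum>c\<in>S. f c * indicator (B c) x) = f (\<Phi> x)" if "f 0 = 0" for f :: "'a \<Rightarrow> real" and x
  proof -
    have "(\<Sum>c\<in>S. f c * indicator (B c) x) = (\<Sum>c\<in>S. if c = \<Phi> x then f c else 0)"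
      by (intro sum.cong) (auto simp: B_def indicator_def)
    also have "\<dots> = f (\<Phi> x)" using fS that by (auto simp: S_def)
    finally show ?thesis .
  qed
  have eq: "pflux p (linear_increment \<Phi> z) * T n z = (\<Sum>c\<in>S. separated (ball 0 1) c (indicator (B c)) z * T n z)" for z n
  proof -
    obtain h x where z: "z = (h, x)" by (cases z)
    have "(\<Sum>c\<in>S. separated (ball 0 1) c (indicator (B c)) z) = indicator (ball 0 1) h * pflux p (\<Phi> x \<bullet> h)"
      using sel[of "\<lambda>c. indicator (ball 0 1) h * pflux p (c \<bullet> h)" x] by (simp add: z separated_def)
    also have "\<dots> = pflux p (linear_increment \<Phi> z)"
      by (simp add: z linear_increment_def indicator_def)
    finally show ?thesis by (simp add: sum_distrib_right[symmetric])
  qed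
  have eq2: "pflux p (\<Phi> x) \<bullet> V x = (\<Sum>c\<in>S. indicator (B c) x * (pflux p c \<bullet> V x))" for x
    using sel[of "\<lambda>c. pflux p c \<bullet> V x" x] by (simp add: mult.commute)
  have Bi: "integrable lborel (indicat_real (B c))" if "c \<in> S" for c
    using B[OF that] by (intro integrable_real_indicator) auto
  have B1: "\<forall>x. \<bar>indicat_real (B c) x\<bar> \<le> 1" for c by (simp add: indicator_def)
  have "(\<lambda>n. \<Sum>c\<in>S. \<integral>z. separated (ball 0 1) c (indicator (B c)) z * T n z \<partial>N n) \<longlonglongrightarrow>
      (\<Sum>c\<in>S. K * (\<integral>x. indicator (B c) x * (pflux p c \<bullet> V x) \<partial>lborel))"
    by (intro tendsto_sum set_pairing_tendsto B)
  moreover have "(\<integral>z. pflux p (linear_increment \<Phi> z) * T n z \<partial>N n) =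
      (\<Sum>c\<in>S. \<integral>z. separated (ball 0 1) c (indicator (B c)) z * T n z \<partial>N n)" for n
    unfolding eq using Bi B1 by (intro Bochner_Integration.integral_sum separated_pairing_integrable) auto
  moreover have "K * (\<integral>x. pflux p (\<Phi> x) \<bullet> V x \<partial>lborel) = (\<Sum>c\<in>S. K * (\<integral>x. indicator (B c) x * (pflux p c \<bullet> V x) \<partial>lborel))"
    unfolding eq2 using Bi B1 bounded_times_gradient
    by (subst Bochner_Integration.integral_sum) (auto simp: sum_distrib_left)
  ultimately show ?thesis by simp
qed

lemma linear_pairing_tendsto:
  assumes G: "p_integrable p lborel G" "\<And>x. x \<notin> \<Omega> \<Longrightarrow> G x = 0"
  shows "(\<lambda>n. \<integral>z. pflux p (linear_increment G z) * T n z \<partial>N n) \<longlonglongrightarrow> K * (\<integral>x. pflux p (G x) \<bullet> V x \<partial>lborel)"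
proof (rule tendsto_if_eventually_le_multiple)
  let ?I = "\<lambda>f::'a \<Rightarrow> 'a. \<integral>x. norm (f x) powr p \<partial>lborel"
  define C where "C = M + ?I G + 1"
  define C' where "C' = K * (?I V + ?I G + 1)"
  have C: "0 \<le> C" "0 \<le> C'" unfolding C_def C'_def
    using M_nonneg K_const_nonneg[of e p] integral_powr_nonneg[of lborel G p] integral_powr_nonneg[of lborel V p]
    by (auto intro!: mult_nonneg_nonneg add_nonneg_nonneg)
  then show "0 \<le> C + C' + 1" by simp
  fix \<eta> :: real assume \<eta>: "0 < \<eta>"
  obtain D where D: "0 \<le> D" "\<And>(M :: ('a \<times> 'a) measure) (a :: 'a \<times> 'a \<Rightarrow> real) b T.
       p_integrable p M a \<Longrightarrow> p_integrable p M b \<Longrightarrow> p_integrable p M T \<Longrightarrow>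
       \<bar>(\<integral>x. pflux p (a x) \<bullet> T x \<partial>M) - (\<integral>x. pflux p (b x) \<bullet> T x \<partial>M)\<bar> \<le>
       \<eta> * ((\<integral>x. norm (T x) powr p \<partial>M) + (\<integral>x. norm (b x) powr p \<partial>M)) + D * (\<integral>x. norm (a x - b x) powr p \<partial>M)"
    using p_gt_1 \<eta> by (rule pflux_inner_integral_diff) (assumption | rule that)+
  obtain D' where D': "0 \<le> D'" "\<And>(M :: 'a measure) (a :: 'a \<Rightarrow> 'a) b T.
       p_integrable p M a \<Longrightarrow> p_integrable p M b \<Longrightarrow> p_integrable p M T \<Longrightarrow>
       \<bar>(\<integral>x. pflux p (a x) \<bullet> T x \<partial>M) - (\<integral>x. pflux p (b x) \<bullet> T x \<partial>M)\<bar> \<le>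
       \<eta> * ((\<integral>x. norm (T x) powr p \<partial>M) + (\<integral>x. norm (b x) powr p \<partial>M)) + D' * (\<integral>x. norm (a x - b x) powr p \<partial>M)"
    using p_gt_1 \<eta> by (rule pflux_inner_integral_diff) (assumption | rule that)+
  obtain \<eta>' where \<eta>': "0 < \<eta>'" "\<eta>' * (D + D') \<le> \<eta>"
    by (rule small_multiple[OF \<eta>, of "D + D'"]) (use D(1) D'(1) in auto)
  have D\<eta>': "D * \<eta>' \<le> \<eta>" "D' * \<eta>' \<le> \<eta>"
    using \<eta>' D(1) D'(1) by (smt (verit) distrib_left mult.commute mult_nonneg_nonneg)+
  obtain \<Phi> where \<Phi>: "simple_function lborel \<Phi>" "\<forall>x\<in>space lborel. norm (\<Phi> x) \<le> 2 * norm (G x)"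
    "p_integrable p lborel \<Phi>" "(\<integral>x. norm (G x - \<Phi> x) powr p \<partial>lborel) < \<eta>'"
    by (rule simple_function_approx_Lp[OF p_gt_0 G(1) \<eta>'(1)]) blast
  have \<Phi>0: "\<Phi> x = 0" if "x \<notin> \<Omega>" for x using bspec[OF \<Phi>(2), of x] G(2)[OF that] by simp
  have \<Phi>G: "?I (\<lambda>x. \<Phi> x - G x) \<le> \<eta>'" using \<Phi>(4) by (simp add: norm_minus_commute)
  have \<Phi>Gp: "p_integrable p lborel (\<lambda>x. \<Phi> x - G x)" by (rule p_integrable_diff[OF p_gt_0 \<Phi>(3) G(1)])
  let ?L = "\<lambda>G n. \<integral>z. pflux p (linear_increment G z) * T n z \<partial>N n"
  let ?l = "\<lambda>G. K * (\<integral>x. pflux p (G x) \<bullet> V x \<partial>lborel)"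
  have l: "\<bar>?l \<Phi> - ?l G\<bar> \<le> C' * \<eta>"
  proof -
    have "\<bar>(\<integral>x. pflux p (\<Phi> x) \<bullet> V x \<partial>lborel) - (\<integral>x. pflux p (G x) \<bullet> V x \<partial>lborel)\<bar> \<le>
        \<eta> * (?I V + ?I G) + D' * ?I (\<lambda>x. \<Phi> x - G x)"
      by (rule D'(2)[OF \<Phi>(3) G(1) gradient_p_integrable])
    also have "\<dots> \<le> \<eta> * (?I V + ?I G) + \<eta>"
      using order_trans[OF mult_left_mono[OF \<Phi>G D'(1)] D\<eta>'(2)] by simp
    finally have "K * \<bar>(\<integral>x. pflux p (\<Phi> x) \<bullet> V x \<partial>lborel) - (\<integral>x. pflux p (G x) \<bullet> V x \<partial>lborel)\<bar> \<le> K * (\<eta> * (?I V + ?I G) + \<eta>)"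
      using K_const_nonneg by (rule mult_left_mono)
    moreover have "\<bar>?l \<Phi> - ?l G\<bar> = K * \<bar>(\<integral>x. pflux p (\<Phi> x) \<bullet> V x \<partial>lborel) - (\<integral>x. pflux p (G x) \<bullet> V x \<partial>lborel)\<bar>"
      using K_const_nonneg[of e p] by (simp add: right_diff_distrib[symmetric] abs_mult)
    moreover have "K * (\<eta> * (?I V + ?I G) + \<eta>) = C' * \<eta>" by (simp add: C'_def algebra_simps)
    ultimately show ?thesis by simp
  qed
  have "eventually (\<lambda>n. \<bar>?L \<Phi> n - ?l \<Phi>\<bar> < \<eta>) sequentially"
    using tendstoD[OF simple_pairing_tendsto[OF \<Phi>(1,3) \<Phi>0] \<eta>] by (simp add: dist_real_def)
  then show "eventually (\<lambda>n. \<bar>?L G n - ?l G\<bar> \<le> (C + C' + 1) * \<eta>) sequentially"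
  proof eventually_elim
    case (elim n)
    note i = linear_increment_p_integrable[where n = n]
    have "\<bar>?L \<Phi> n - ?L G n\<bar> \<le> \<eta> * ((\<integral>z. norm (T n z) powr p \<partial>N n) + (\<integral>z. norm (linear_increment G z) powr p \<partial>N n))
        + D * (\<integral>z. norm (linear_increment \<Phi> z - linear_increment G z) powr p \<partial>N n)"
      using D(2)[OF i(1)[OF \<Phi>(3)] i(1)[OF G(1)] energy_p_integrable[of n]] by simp
    also have "\<dots> \<le> \<eta> * (M + ?I G) + D * \<eta>'"
    proof (intro add_mono mult_left_mono D(1))
      show "(\<integral>z. norm (linear_increment \<Phi> z - linear_increment G z) powr p \<partial>N n) \<le> \<eta>'"
        using order_trans[OF i(2)[OF \<Phi>Gp] \<Phi>G] by (simp add: linear_increment_diff)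
    qed (use energy_bound[of n] i(2)[OF G(1)] \<eta> in auto)
    also have "\<dots> \<le> C * \<eta>" using D\<eta>'(1) by (simp add: C_def algebra_simps)
    finally have "\<bar>?L G n - ?l G\<bar> \<le> C * \<eta> + \<eta> + C' * \<eta>" using elim l by linarith
    then show ?case by (simp add: algebra_simps)
  qed
qed

lemma increment_pairing_tendsto:
  assumes U: "p_integrable p lborel U" and G: "p_integrable p lborel G" and weak: "borel_weak_grad UNIV U G"
  shows "(\<lambda>n. \<integral>z. (case z of (h, x) \<Rightarrow> pflux p (U x - U (x - h))) * T n z \<partial>N n) \<longlonglongrightarrow>
    K * (\<integral>x. pflux p (G x) \<bullet> V x \<partial>lborel)"
proof -
  have [measurable]: "G \<in> borel_measurable borel" using G by (simp add: p_integrable_def)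
  let ?G = "\<lambda>x. indicator \<Omega> x *\<^sub>R G x"
  have G': "p_integrable p lborel ?G"
  proof (rule p_integrable_bound)
    show "integrable lborel (\<lambda>x. norm (G x) powr p)" by (rule p_integrable_integrable[OF G])
    show "AE x in lborel. norm (?G x) powr p \<le> norm (G x) powr p"
      by (intro AE_I2) (auto simp: indicator_def)
  qed measurable
  let ?a = "\<lambda>z. case z of (h, x) \<Rightarrow> U x - U (x - h)"
  have lim: "(\<lambda>n. \<integral>z. pflux p (linear_increment ?G z) * T n z \<partial>N n) \<longlonglongrightarrow> K * (\<integral>x. pflux p (?G x) \<bullet> V x \<partial>lborel)"
    by (rule linear_pairing_tendsto[OF G']) simp
  \<comment> \<open>Outside \<open>\<Omega>\<close> both \<open>T n\<close> and \<open>V\<close> vanish, so the truncation of \<open>G\<close> to \<open>\<Omega>\<close> is harmless.\<close>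
  have eq1: "pflux p (linear_increment ?G z) * T n z = pflux p (linear_increment G z) * T n z" for z n
    by (cases z) (auto simp: linear_increment_def local_increment_def indicator_def)
  have eq2: "pflux p (?G x) \<bullet> V x = pflux p (G x) \<bullet> V x" for x
    using gradient_zero[of x] by (cases "x \<in> \<Omega>") auto
  have lim: "(\<lambda>n. \<integral>z. pflux p (linear_increment G z) * T n z \<partial>N n) \<longlonglongrightarrow> K * (\<integral>x. pflux p (G x) \<bullet> V x \<partial>lborel)"
    using lim unfolding eq1 eq2 .
  have diff: "(\<lambda>n. (\<integral>z. pflux p (?a z) * T n z \<partial>N n) - (\<integral>z. pflux p (linear_increment G z) * T n z \<partial>N n)) \<longlonglongrightarrow> 0"
  proof (rule tendsto_if_eventually_le_multiple)
    let ?g = "\<integral>x. norm (G x) powr p \<partial>lborel"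
    show "0 \<le> M + ?g + 1" using M_nonneg integral_powr_nonneg[of lborel G p] by (simp add: add_nonneg_nonneg)
    fix \<eta> :: real assume \<eta>: "0 < \<eta>"
    obtain D where D: "0 \<le> D" "\<And>(M :: ('a \<times> 'a) measure) (a :: 'a \<times> 'a \<Rightarrow> real) b T.
       p_integrable p M a \<Longrightarrow> p_integrable p M b \<Longrightarrow> p_integrable p M T \<Longrightarrow>
       \<bar>(\<integral>x. pflux p (a x) \<bullet> T x \<partial>M) - (\<integral>x. pflux p (b x) \<bullet> T x \<partial>M)\<bar> \<le>
       \<eta> * ((\<integral>x. norm (T x) powr p \<partial>M) + (\<integral>x. norm (b x) powr p \<partial>M)) + D * (\<integral>x. norm (a x - b x) powr p \<partial>M)"
      using p_gt_1 \<eta> by (rule pflux_inner_integral_diff) (assumption | rule that)+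
    have "(\<lambda>n. D * (\<integral>z. norm (?a z - linear_increment G z) powr p \<partial>N n)) \<longlonglongrightarrow> D * 0"
      by (intro tendsto_intros increment_approx(2) U G weak)
    then have "eventually (\<lambda>n. D * (\<integral>z. norm (?a z - linear_increment G z) powr p \<partial>N n) < \<eta>) sequentially"
      using \<eta> by (intro order_tendstoD(2)) auto
    then show "eventually (\<lambda>n. \<bar>(\<integral>z. pflux p (?a z) * T n z \<partial>N n) - (\<integral>z. pflux p (linear_increment G z) * T n z \<partial>N n) - 0\<bar>
        \<le> (M + ?g + 1) * \<eta>) sequentially"
    proof eventually_elim
      case (elim n)
      note i = linear_increment_p_integrable[OF G, where n = n]
      have "\<bar>(\<integral>z. pflux p (?a z) * T n z \<partial>N n) - (\<integral>z. pflux p (linear_increment G z) * T n z \<partial>N n)\<bar> \<le>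
          \<eta> * ((\<integral>z. norm (T n z) powr p \<partial>N n) + (\<integral>z. norm (linear_increment G z) powr p \<partial>N n))
          + D * (\<integral>z. norm (?a z - linear_increment G z) powr p \<partial>N n)"
        using D(2)[OF increment_approx(1)[OF U G weak] i(1) energy_p_integrable[of n]] by simp
      also have "\<dots> \<le> \<eta> * (M + ?g) + \<eta>"
        using energy_bound[of n] i(2) \<eta> elim by (intro add_mono mult_left_mono) auto
      finally show ?case by (simp add: algebra_simps)
    qed
  qed
  have "(\<lambda>n. \<integral>z. pflux p (?a z) * T n z \<partial>N n) \<longlonglongrightarrow> K * (\<integral>x. pflux p (G x) \<bullet> V x \<partial>lborel)"
    using tendsto_add[OF diff lim] by simp
  moreover have "pflux p (?a z) = (case z of (h, x) \<Rightarrow> pflux p (U x - U (x - h)))" for z by (cases z) simp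
  ultimately show ?thesis by simp
qed

end

section \<open>Borel representatives\<close>

text \<open>
  The function spaces are defined through Lebesgue measurable functions on \<open>\<Omega>\<close>, the limit argument works with Borel
  functions on the whole space; this lemma passes between the two.
\<close>

lemma lebesgue_on_transfer:
  fixes f g :: "'a::euclidean_space \<Rightarrow> 'b::euclidean_space"
  assumes \<Omega> [measurable]: "\<Omega> \<in> sets borel" and g [measurable]: "g \<in> borel_measurable borel"
    and ae: "AE x in lborel. x \<in> \<Omega> \<longrightarrow> f x = g x"
  shows "f \<in> borel_measurable (lebesgue_on \<Omega>)"
    and "integrable (lebesgue_on \<Omega>) f \<longleftrightarrow> integrable lborel (\<lambda>x. indicator \<Omega> x *\<^sub>R g x)"
    and "integral\<^sup>L (lebesgue_on \<Omega>) f = (\<integral>x. indicator \<Omega> x *\<^sub>R g x \<partial>lborel)"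
proof -
  have [simp]: "\<Omega> \<inter> space lebesgue \<in> sets lebesgue" using \<Omega> by simp
  have gm: "(\<lambda>x. indicator \<Omega> x *\<^sub>R g x) \<in> borel_measurable lborel" by measurable
  have ae': "AE x in lebesgue. indicator \<Omega> x *\<^sub>R g x = indicator \<Omega> x *\<^sub>R f x"
    using AE_completion[OF ae] by eventually_elim (auto simp: indicator_def)
  have fm: "(\<lambda>x. indicator \<Omega> x *\<^sub>R f x) \<in> borel_measurable lebesgue"
    by (rule borel_measurable_AE[OF measurable_completion[OF gm] ae'])
  then show "f \<in> borel_measurable (lebesgue_on \<Omega>)"
    by (subst borel_measurable_restrict_space_iff) auto
  have "integrable lebesgue (\<lambda>x. indicator \<Omega> x *\<^sub>R f x) \<longleftrightarrow> integrable lebesgue (\<lambda>x. indicator \<Omega> x *\<^sub>R g x)"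
    by (rule integrable_cong_AE[OF fm measurable_completion[OF gm]]) (use ae' in \<open>auto elim: eventually_mono\<close>)
  then show "integrable (lebesgue_on \<Omega>) f \<longleftrightarrow> integrable lborel (\<lambda>x. indicator \<Omega> x *\<^sub>R g x)"
    by (simp add: integrable_restrict_space integrable_completion[OF gm])
  have "integral\<^sup>L lebesgue (\<lambda>x. indicator \<Omega> x *\<^sub>R f x) = integral\<^sup>L lebesgue (\<lambda>x. indicator \<Omega> x *\<^sub>R g x)"
    by (rule integral_cong_AE[OF fm measurable_completion[OF gm]]) (use ae' in \<open>auto elim: eventually_mono\<close>)
  then show "integral\<^sup>L (lebesgue_on \<Omega>) f = (\<integral>x. indicator \<Omega> x *\<^sub>R g x \<partial>lborel)"
    by (simp add: integral_restrict_space integral_completion[OF gm])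
qed

lemma borel_representative:
  fixes f :: "'a::euclidean_space \<Rightarrow> 'b::euclidean_space"
  assumes \<Omega> [measurable]: "\<Omega> \<in> sets borel" and f: "f \<in> borel_measurable (lebesgue_on \<Omega>)"
  obtains g where "g \<in> borel_measurable borel" "\<forall>x. x \<notin> \<Omega> \<longrightarrow> g x = 0" "AE x in lborel. x \<in> \<Omega> \<longrightarrow> f x = g x"
proof -
  have "\<Omega> \<inter> space lebesgue \<in> sets lebesgue" using \<Omega> by simp
  then have fm: "(\<lambda>x. indicator \<Omega> x *\<^sub>R f x) \<in> borel_measurable lebesgue"
    using f by (simp add: borel_measurable_restrict_space_iff)
  have "\<exists>g\<in>borel_measurable lborel. AE x in lborel. (indicator \<Omega> x *\<^sub>R f x) \<bullet> b = g x" for b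
    by (intro completion_ex_borel_measurable_real borel_measurable_inner[OF fm] borel_measurable_const)
  then obtain g where g: "\<And>b. g b \<in> borel_measurable lborel" "\<And>b. AE x in lborel. (indicator \<Omega> x *\<^sub>R f x) \<bullet> b = g b x"
    by metis
  let ?g = "\<lambda>x. indicator \<Omega> x *\<^sub>R (\<Sum>b\<in>Basis. g b x *\<^sub>R b)"
  have [measurable]: "g b \<in> borel_measurable borel" for b using g(1)[of b] by simp
  have "AE x in lborel. \<forall>b\<in>Basis. (indicator \<Omega> x *\<^sub>R f x) \<bullet> b = g b x"
    using g(2) by (intro AE_finite_allI) auto
  then have "AE x in lborel. x \<in> \<Omega> \<longrightarrow> f x = ?g x"
  proof eventually_elim
    case (elim x)
    then show ?case by (auto simp: euclidean_eq_iff[of "f x"] inner_sum_left inner_Basis if_distrib sum.delta cong: if_cong)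
  qed
  moreover have "?g \<in> borel_measurable borel" by measurable
  ultimately show thesis using that[of ?g] by simp
qed

text \<open>
  Representatives vanish outside \<open>\<Omega>\<close>, so that integrals over \<open>\<Omega>\<close> become integrals over the whole space.
\<close>

definition borel_rep :: "'a::euclidean_space set \<Rightarrow> ('a \<Rightarrow> 'b::euclidean_space) \<Rightarrow> ('a \<Rightarrow> 'b) \<Rightarrow> bool" where
  "borel_rep \<Omega> u U \<longleftrightarrow> U \<in> borel_measurable borel \<and> (\<forall>x. x \<notin> \<Omega> \<longrightarrow> U x = 0) \<and>
     (AE x in lborel. x \<in> \<Omega> \<longrightarrow> u x = U x)"

lemma borel_repD:
  assumes "borel_rep \<Omega> u U"
  shows "U \<in> borel_measurable borel" "\<And>x. x \<notin> \<Omega> \<Longrightarrow> U x = 0" "AE x in lborel. x \<in> \<Omega> \<longrightarrow> u x = U x"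
  using assms by (auto simp: borel_rep_def)

lemma borel_rep_diff:
  assumes "borel_rep \<Omega> u U" "borel_rep \<Omega> v V"
  shows "borel_rep \<Omega> (\<lambda>x. u x - v x) (\<lambda>x. U x - V x)"
  using assms unfolding borel_rep_def by (auto elim: eventually_elim2)

lemma Lp_norm_transfer:
  fixes f g :: "'a::euclidean_space \<Rightarrow> 'b::euclidean_space"
  assumes "0 < p" and \<Omega>: "\<Omega> \<in> sets borel" and [measurable]: "g \<in> borel_measurable borel"
    and ae: "AE x in lborel. x \<in> \<Omega> \<longrightarrow> f x = g x"
  shows "Lp_norm p \<Omega> f powr p = (\<integral>x. indicator \<Omega> x * norm (g x) powr p \<partial>lborel)"
proof -
  have "(\<integral>x. norm (f x) powr p \<partial>lebesgue_on \<Omega>) = (\<integral>x. indicator \<Omega> x *\<^sub>R norm (g x) powr p \<partial>lborel)"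
    by (rule lebesgue_on_transfer(3)[OF \<Omega>]) (use ae in \<open>auto elim: eventually_mono\<close>)
  moreover have "0 \<le> (\<integral>x. norm (f x) powr p \<partial>lebesgue_on \<Omega>)" by (rule integral_powr_nonneg)
  ultimately show ?thesis using assms(1) by (simp add: Lp_norm_def powr_powr)
qed

lemma borel_rep_powr:
  assumes "borel_rep \<Omega> u U"
  shows "indicator \<Omega> x * norm (U x) powr p = norm (U x) powr p"
  using borel_repD(2)[OF assms, of x] by (cases "x \<in> \<Omega>") auto

lemma Lp_norm_borel_rep:
  assumes "0 < p" "\<Omega> \<in> sets borel" "borel_rep \<Omega> u U"
  shows "Lp_norm p \<Omega> u powr p = (\<integral>x. norm (U x) powr p \<partial>lborel)"
  using Lp_norm_transfer[OF assms(1,2) borel_repD(1,3)[OF assms(3)]] by (simp add: borel_rep_powr[OF assms(3)])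

lemma Lp_space_borel_rep:
  fixes u :: "'a::euclidean_space \<Rightarrow> 'b::euclidean_space"
  assumes \<Omega>: "\<Omega> \<in> sets borel" and u: "u \<in> Lp_space p \<Omega>"
  obtains U where "borel_rep \<Omega> u U" "p_integrable p lborel U"
proof -
  obtain U where "U \<in> borel_measurable borel" "\<forall>x. x \<notin> \<Omega> \<longrightarrow> U x = 0" "AE x in lborel. x \<in> \<Omega> \<longrightarrow> u x = U x"
    by (rule borel_representative[OF \<Omega>, of u]) (use u in \<open>auto simp: Lp_space_def\<close>)
  then have U: "borel_rep \<Omega> u U" by (simp add: borel_rep_def)
  have [measurable]: "U \<in> borel_measurable borel" by (rule borel_repD[OF U])
  have "integrable (lebesgue_on \<Omega>) (\<lambda>x. norm (u x) powr p) \<longleftrightarrow> integrable lborel (\<lambda>x. indicator \<Omega> x *\<^sub>R norm (U x) powr p)"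
    by (rule lebesgue_on_transfer(2)[OF \<Omega>]) (use borel_repD(3)[OF U] in \<open>auto elim: eventually_mono\<close>)
  then have "p_integrable p lborel U"
    using u by (simp add: p_integrable_def Lp_space_def borel_rep_powr[OF U])
  with U that show thesis by blast
qed

lemma locally_integrable_borel_rep:
  assumes "\<Omega> \<in> sets borel" and U: "borel_rep \<Omega> u U"
  shows "locally_integrable \<Omega> u \<longleftrightarrow> borel_locally_integrable \<Omega> U"
proof -
  have "integrable (lebesgue_on K) u \<longleftrightarrow> integrable lborel (\<lambda>x. indicator K x *\<^sub>R U x)" if K: "compact K" "K \<subseteq> \<Omega>" for K
  proof (rule lebesgue_on_transfer(2))
    show "AE x in lborel. x \<in> K \<longrightarrow> u x = U x"
      using borel_repD(3)[OF U] by eventually_elim (use K in auto)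
  qed (use K borel_repD(1)[OF U] in \<open>auto simp: borel_compact\<close>)
  then show ?thesis
    using borel_repD(1)[OF U] by (auto simp: locally_integrable_def borel_locally_integrable_def)
qed

lemma has_weak_grad_borel_rep:
  assumes \<Omega>: "\<Omega> \<in> sets borel" and U: "borel_rep \<Omega> u U" and G: "borel_rep \<Omega> g G"
  shows "has_weak_grad \<Omega> u g \<longleftrightarrow> borel_weak_grad \<Omega> U G"
proof -
  have [measurable]: "U \<in> borel_measurable borel" "G \<in> borel_measurable borel"
    using borel_repD(1)[OF U] borel_repD(1)[OF G] by auto
  have 1: "(\<integral>x. u x * frechet_derivative \<psi> (at x) b \<partial>lebesgue_on \<Omega>) = (\<integral>x. U x * (tgrad \<psi> x \<bullet> b) \<partial>lborel)"
    and 2: "(\<integral>x. (g x \<bullet> b) * \<psi> x \<partial>lebesgue_on \<Omega>) = (\<integral>x. (G x \<bullet> b) * \<psi> x \<partial>lborel)"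
    if \<psi>: "\<psi> \<in> test_functions \<Omega>" for \<psi> b
  proof -
    have [measurable]: "\<psi> \<in> borel_measurable borel" "tgrad \<psi> \<in> borel_measurable borel"
      using continuous_on_test_function[OF \<psi>] continuous_on_tgrad[OF \<psi>] by (auto intro: borel_measurable_continuous_onI)
    have "(\<integral>x. u x * frechet_derivative \<psi> (at x) b \<partial>lebesgue_on \<Omega>) = (\<integral>x. indicator \<Omega> x *\<^sub>R (U x * (tgrad \<psi> x \<bullet> b)) \<partial>lborel)"
      unfolding frechet_derivative_test_function[OF \<psi>]
      by (rule lebesgue_on_transfer(3)[OF \<Omega>]) (use borel_repD(3)[OF U] in \<open>auto elim: eventually_mono\<close>)
    also have "(\<lambda>x. indicator \<Omega> x *\<^sub>R (U x * (tgrad \<psi> x \<bullet> b))) = (\<lambda>x. U x * (tgrad \<psi> x \<bullet> b))"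
      using borel_repD(2)[OF U] by (force simp: indicator_def)
    finally show "(\<integral>x. u x * frechet_derivative \<psi> (at x) b \<partial>lebesgue_on \<Omega>) = (\<integral>x. U x * (tgrad \<psi> x \<bullet> b) \<partial>lborel)" .
    have "(\<integral>x. (g x \<bullet> b) * \<psi> x \<partial>lebesgue_on \<Omega>) = (\<integral>x. indicator \<Omega> x *\<^sub>R ((G x \<bullet> b) * \<psi> x) \<partial>lborel)"
      by (rule lebesgue_on_transfer(3)[OF \<Omega>]) (use borel_repD(3)[OF G] in \<open>auto elim: eventually_mono\<close>)
    also have "(\<lambda>x. indicator \<Omega> x *\<^sub>R ((G x \<bullet> b) * \<psi> x)) = (\<lambda>x. (G x \<bullet> b) * \<psi> x)"
      using borel_repD(2)[OF G] by (force simp: indicator_def)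
    finally show "(\<integral>x. (g x \<bullet> b) * \<psi> x \<partial>lebesgue_on \<Omega>) = (\<integral>x. (G x \<bullet> b) * \<psi> x \<partial>lborel)" .
  qed
  \<comment> \<open>It suffices to test the partial derivatives, by linearity in the direction.\<close>
  have lin: "(\<forall>b. (\<integral>x. U x * (tgrad \<psi> x \<bullet> b) \<partial>lborel) = - (\<integral>x. (G x \<bullet> b) * \<psi> x \<partial>lborel)) \<longleftrightarrow>
      (\<forall>b\<in>Basis. (\<integral>x. U x * (tgrad \<psi> x \<bullet> b) \<partial>lborel) = - (\<integral>x. (G x \<bullet> b) * \<psi> x \<partial>lborel))"
    if \<psi>: "\<psi> \<in> test_functions \<Omega>" and Ul: "borel_locally_integrable \<Omega> U" and Gl: "borel_locally_integrable \<Omega> G" for \<psi>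
  proof (intro iffI allI)
    fix b :: 'a
    assume H: "\<forall>b\<in>Basis. (\<integral>x. U x * (tgrad \<psi> x \<bullet> b) \<partial>lborel) = - (\<integral>x. (G x \<bullet> b) * \<psi> x \<partial>lborel)"
    have gi: "integrable lborel (\<lambda>x. U x * (tgrad \<psi> x \<bullet> c))" for c
    proof -
      have "continuous_on UNIV (\<lambda>x. tgrad \<psi> x \<bullet> c)"
        by (intro continuous_intros continuous_on_tgrad[OF \<psi>])
      from borel_locally_integrable_times_compact_support[OF Ul compact_csupp[OF \<psi>] csupp_subset[OF \<psi>] _ this]
      show ?thesis using tgrad_zero_outside_csupp[OF \<psi>] by (simp add: mult.commute)
    qed
    have Gi: "integrable lborel (\<lambda>x. (G x \<bullet> c) * \<psi> x)" for c
      using integrable_inner_left[OF borel_locally_integrable_times_test[OF Gl \<psi>], of c] by (simp add: mult.commute)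
    have b: "y \<bullet> b = (\<Sum>c\<in>Basis. (b \<bullet> c) * (y \<bullet> c))" for y
      by (subst euclidean_inner) (simp add: mult.commute)
    have 3: "U x * (tgrad \<psi> x \<bullet> b) = (\<Sum>c\<in>Basis. (b \<bullet> c) * (U x * (tgrad \<psi> x \<bullet> c)))" for x
      by (subst b) (simp add: sum_distrib_left mult.left_commute)
    have 4: "(G x \<bullet> b) * \<psi> x = (\<Sum>c\<in>Basis. (b \<bullet> c) * ((G x \<bullet> c) * \<psi> x))" for x
      by (subst b) (simp add: sum_distrib_right mult.assoc)
    have "(\<integral>x. U x * (tgrad \<psi> x \<bullet> b) \<partial>lborel) = (\<Sum>c\<in>Basis. (b \<bullet> c) * (\<integral>x. U x * (tgrad \<psi> x \<bullet> c) \<partial>lborel))"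
      unfolding 3 using gi by simp
    also have "\<dots> = - (\<Sum>c\<in>Basis. (b \<bullet> c) * (\<integral>x. (G x \<bullet> c) * \<psi> x \<partial>lborel))"
      using H by (simp add: sum_negf)
    also have "(\<Sum>c\<in>Basis. (b \<bullet> c) * (\<integral>x. (G x \<bullet> c) * \<psi> x \<partial>lborel)) = (\<integral>x. (G x \<bullet> b) * \<psi> x \<partial>lborel)"
      unfolding 4 using Gi by simp
    finally show "(\<integral>x. U x * (tgrad \<psi> x \<bullet> b) \<partial>lborel) = - (\<integral>x. (G x \<bullet> b) * \<psi> x \<partial>lborel)" .
  qed auto
  show ?thesis
    unfolding has_weak_grad_def borel_weak_grad_def
    by (simp add: 1 2 locally_integrable_borel_rep[OF \<Omega> U] locally_integrable_borel_rep[OF \<Omega> G] lin cong: conj_cong)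
qed

lemma borel_weak_grad_diff:
  assumes "borel_weak_grad \<Omega> U G" "borel_weak_grad \<Omega> V H"
  shows "borel_weak_grad \<Omega> (\<lambda>x. U x - V x) (\<lambda>x. G x - H x)"
  unfolding borel_weak_grad_def
proof (intro conjI ballI allI)
  have l: "borel_locally_integrable \<Omega> U" "borel_locally_integrable \<Omega> G" "borel_locally_integrable \<Omega> V" "borel_locally_integrable \<Omega> H"
    using assms by (auto simp: borel_weak_grad_def)
  show "borel_locally_integrable \<Omega> (\<lambda>x. U x - V x)" "borel_locally_integrable \<Omega> (\<lambda>x. G x - H x)"
    by (intro borel_locally_integrable_diff l)+
  fix \<psi> b assume \<psi>: "\<psi> \<in> test_functions \<Omega>"
  have gi: "integrable lborel (\<lambda>x. W x * (tgrad \<psi> x \<bullet> b))" if "borel_locally_integrable \<Omega> W" for W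
  proof -
    have "continuous_on UNIV (\<lambda>x. tgrad \<psi> x \<bullet> b)"
      by (intro continuous_intros continuous_on_tgrad[OF \<psi>])
    from borel_locally_integrable_times_compact_support[OF that compact_csupp[OF \<psi>] csupp_subset[OF \<psi>] _ this]
    show ?thesis using tgrad_zero_outside_csupp[OF \<psi>] by (simp add: mult.commute)
  qed
  have Gi: "integrable lborel (\<lambda>x. (W x \<bullet> b) * \<psi> x)" if "borel_locally_integrable \<Omega> W" for W
    using integrable_inner_left[OF borel_locally_integrable_times_test[OF that \<psi>], of b] by (simp add: mult.commute)
  show "(\<integral>x. (U x - V x) * (tgrad \<psi> x \<bullet> b) \<partial>lborel) = - (\<integral>x. ((G x - H x) \<bullet> b) * \<psi> x \<partial>lborel)"
    using assms \<psi> gi[OF l(1)] gi[OF l(3)] Gi[OF l(2)] Gi[OF l(4)]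
    by (simp add: borel_weak_grad_def inner_diff_left left_diff_distrib)
qed

lemma borel_weak_grad_unique:
  assumes "open \<Omega>" and G: "borel_weak_grad \<Omega> U G" and H: "borel_weak_grad \<Omega> U H"
  shows "AE x in lborel. x \<in> \<Omega> \<longrightarrow> G x = H x"
proof -
  have D: "borel_weak_grad \<Omega> (\<lambda>x. U x - U x) (\<lambda>x. G x - H x)" by (rule borel_weak_grad_diff[OF G H])
  have "AE x in lborel. x \<in> \<Omega> \<longrightarrow> (G x - H x) \<bullet> b = 0" for b
  proof (rule zero_AE_if_orthogonal_to_test_functions[OF \<open>open \<Omega>\<close>])
    show "borel_locally_integrable \<Omega> (\<lambda>x. (G x - H x) \<bullet> b)"
      unfolding borel_locally_integrable_def
    proof (intro conjI allI impI)
      have l: "borel_locally_integrable \<Omega> (\<lambda>x. G x - H x)" using D by (simp add: borel_weak_grad_def)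
      then have [measurable]: "(\<lambda>x. G x - H x) \<in> borel_measurable borel" by (simp add: borel_locally_integrable_def)
      show "(\<lambda>x. (G x - H x) \<bullet> b) \<in> borel_measurable borel" by measurable
      fix K assume "compact K \<and> K \<subseteq> \<Omega>"
      then have "integrable lborel (\<lambda>x. indicat_real K x *\<^sub>R (G x - H x))"
        using l unfolding borel_locally_integrable_def by blast
      from integrable_inner_left[OF this, of b]
      show "integrable lborel (\<lambda>x. indicat_real K x *\<^sub>R ((G x - H x) \<bullet> b))" by simp
    qed
    fix \<psi> assume "\<psi> \<in> test_functions \<Omega>"
    then have "(\<integral>x. (U x - U x) * (tgrad \<psi> x \<bullet> b) \<partial>lborel) = - (\<integral>x. ((G x - H x) \<bullet> b) * \<psi> x \<partial>lborel)"
      using D unfolding borel_weak_grad_def by blast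
    then show "(\<integral>x. (G x - H x) \<bullet> b * \<psi> x \<partial>lborel) = 0" by simp
  qed
  then have "AE x in lborel. \<forall>b\<in>Basis. x \<in> \<Omega> \<longrightarrow> (G x - H x) \<bullet> b = 0"
    by (intro AE_finite_allI) auto
  then show ?thesis
  proof eventually_elim
    case (elim x)
    then show ?case by (auto simp: euclidean_eq_iff[of "G x"] inner_diff_left)
  qed
qed

lemma locally_integrable_imp_measurable:
  fixes f :: "'a::euclidean_space \<Rightarrow> 'b::euclidean_space"
  assumes "open \<Omega>" and f: "locally_integrable \<Omega> f"
  shows "f \<in> borel_measurable (lebesgue_on \<Omega>)"
proof -
  obtain C where C: "\<And>n::nat. compact (C n)" "\<And>n. C n \<subseteq> \<Omega>" "\<And>n. C n \<subseteq> interior (C (Suc n))" "(\<Union>n. C n) = \<Omega>"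
    using open_Union_compact_subsets[OF \<open>open \<Omega>\<close>] by metis
  have mono: "C m \<subseteq> C n" if "m \<le> n" for m n
    by (rule lift_Suc_mono_le[of C, OF _ that]) (use C(3) interior_subset in blast)
  have "(\<lambda>x. indicator \<Omega> x *\<^sub>R f x) \<in> borel_measurable lebesgue"
  proof (rule borel_measurable_LIMSEQ_metric)
    show "(\<lambda>x. indicator (C n) x *\<^sub>R f x) \<in> borel_measurable lebesgue" for n
    proof -
      have "integrable (lebesgue_on (C n)) f" using f C(1,2) by (auto simp: locally_integrable_def)
      then have "f \<in> borel_measurable (lebesgue_on (C n))" by auto
      then show ?thesis
        using C(1)[of n] by (subst (asm) borel_measurable_restrict_space_iff) (auto simp: borel_compact)
    qed
    show "(\<lambda>n. indicator (C n) x *\<^sub>R f x) \<longlonglongrightarrow> indicator \<Omega> x *\<^sub>R f x" for x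
    proof (cases "x \<in> \<Omega>")
      case True
      then obtain m where "x \<in> C m" using C(4) by blast
      then have "eventually (\<lambda>n. indicator (C n) x *\<^sub>R f x = indicator \<Omega> x *\<^sub>R f x) sequentially"
        using mono True unfolding eventually_sequentially by (intro exI[of _ m]) (auto simp: indicator_def)
      then show ?thesis by (rule tendsto_eventually)
    next
      case False
      then have "x \<notin> C n" for n using C(2) by blast
      then show ?thesis using False by simp
    qed
  qed
  then show ?thesis using \<open>open \<Omega>\<close> by (subst borel_measurable_restrict_space_iff) auto
qed

text \<open>The weak gradient is fixed by an arbitrary choice; by uniqueness almost everywhere the choice does not matter.\<close>

lemma weak_grad_borel_rep:
  assumes "open \<Omega>" and U: "borel_rep \<Omega> u U" and weak: "borel_weak_grad \<Omega> U G" and G0: "\<And>x. x \<notin> \<Omega> \<Longrightarrow> G x = 0"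
  shows "borel_rep \<Omega> (weak_grad \<Omega> u) G"
proof -
  have \<Omega>: "\<Omega> \<in> sets borel" using \<open>open \<Omega>\<close> by simp
  have Gm: "G \<in> borel_measurable borel" using weak by (simp add: borel_weak_grad_def borel_locally_integrable_def)
  have GG: "borel_rep \<Omega> G G" using Gm G0 by (simp add: borel_rep_def)
  have "has_weak_grad \<Omega> u G" using has_weak_grad_borel_rep[OF \<Omega> U GG] weak by blast
  then have w: "has_weak_grad \<Omega> u (weak_grad \<Omega> u)"
    unfolding weak_grad_def by (rule someI[where P = "has_weak_grad \<Omega> u"])
  then have "weak_grad \<Omega> u \<in> borel_measurable (lebesgue_on \<Omega>)"
    by (intro locally_integrable_imp_measurable \<open>open \<Omega>\<close>) (simp add: has_weak_grad_def)
  then obtain H where "H \<in> borel_measurable borel" "\<forall>x. x \<notin> \<Omega> \<longrightarrow> H x = 0" "AE x in lborel. x \<in> \<Omega> \<longrightarrow> weak_grad \<Omega> u x = H x"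
    by (rule borel_representative[OF \<Omega>]) blast
  then have H: "borel_rep \<Omega> (weak_grad \<Omega> u) H" by (simp add: borel_rep_def)
  have "borel_weak_grad \<Omega> U H" using has_weak_grad_borel_rep[OF \<Omega> U H] w by blast
  from borel_weak_grad_unique[OF \<open>open \<Omega>\<close> this weak] borel_repD(3)[OF H]
  have "AE x in lborel. x \<in> \<Omega> \<longrightarrow> weak_grad \<Omega> u x = G x" by eventually_elim auto
  with Gm G0 show ?thesis by (simp add: borel_rep_def)
qed

lemma W1p_borel_rep:
  assumes "open \<Omega>" and u: "u \<in> W1p p \<Omega>"
  obtains U G where "borel_rep \<Omega> u U" "p_integrable p lborel U" "borel_rep \<Omega> (weak_grad \<Omega> u) G" "p_integrable p lborel G"
    "borel_weak_grad \<Omega> U G"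
proof -
  have \<Omega>: "\<Omega> \<in> sets borel" using \<open>open \<Omega>\<close> by simp
  obtain g where g: "g \<in> Lp_space p \<Omega>" "has_weak_grad \<Omega> u g" and u': "u \<in> Lp_space p \<Omega>"
    using u by (auto simp: W1p_def)
  obtain U where U: "borel_rep \<Omega> u U" "p_integrable p lborel U" by (rule Lp_space_borel_rep[OF \<Omega> u'])
  obtain G where G: "borel_rep \<Omega> g G" "p_integrable p lborel G" by (rule Lp_space_borel_rep[OF \<Omega> g(1)])
  have weak: "borel_weak_grad \<Omega> U G" using has_weak_grad_borel_rep[OF \<Omega> U(1) G(1)] g(2) by blast
  have "borel_rep \<Omega> (weak_grad \<Omega> u) G"
    by (rule weak_grad_borel_rep[OF \<open>open \<Omega>\<close> U(1) weak borel_repD(2)[OF G(1)]])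
  with U G weak that show thesis by blast
qed

section \<open>Extension to the whole space\<close>

lemma borel_weak_grad_mono:
  assumes "borel_weak_grad \<Omega>' U G" "\<Omega> \<subseteq> \<Omega>'"
  shows "borel_weak_grad \<Omega> U G"
  using assms test_functions_mono[of _ \<Omega> \<Omega>']
  unfolding borel_weak_grad_def borel_locally_integrable_def by (meson order_trans)

lemma test_function_borel_weak_grad:
  fixes \<phi> :: "'a::euclidean_space \<Rightarrow> real"
  assumes \<phi>: "\<phi> \<in> test_functions UNIV"
  shows "borel_weak_grad UNIV \<phi> (tgrad \<phi>)"
  unfolding borel_weak_grad_def
proof (intro conjI ballI allI)
  have c: "continuous_on UNIV \<phi>" "continuous_on UNIV (tgrad \<phi>)"
    using continuous_on_test_function[OF \<phi>] continuous_on_tgrad[OF \<phi>] by auto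
  have l: "borel_locally_integrable UNIV f" if f: "continuous_on UNIV f" for f :: "'a \<Rightarrow> 'b::euclidean_space"
    unfolding borel_locally_integrable_def
    using borel_integrable_compact[OF _ continuous_on_subset[OF f subset_UNIV]] borel_measurable_continuous_onI[OF f] by auto
  show "borel_locally_integrable UNIV \<phi>" "borel_locally_integrable UNIV (tgrad \<phi>)"
    using c by (auto intro: l)
  fix \<psi> :: "'a \<Rightarrow> real" and b :: 'a assume \<psi>: "\<psi> \<in> test_functions UNIV"
  have c': "continuous_on UNIV \<psi>" "continuous_on UNIV (tgrad \<psi>)"
    using continuous_on_test_function[OF \<psi>] continuous_on_tgrad[OF \<psi>] by auto
  let ?g = "\<lambda>x. \<phi> x *\<^sub>R tgrad \<psi> x + \<psi> x *\<^sub>R tgrad \<phi> x"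
  have "(\<integral>x. ?g x \<bullet> b \<partial>lborel) = 0"
  proof (rule integral_gradient_eq_0)
    fix x
    show "((\<lambda>x. \<phi> x * \<psi> x) has_derivative (\<lambda>h. ?g x \<bullet> h)) (at x)"
      using has_derivative_mult[OF test_function_has_derivative[OF \<phi>, of x] test_function_has_derivative[OF \<psi>, of x]]
      by (simp add: inner_add_left mult.commute)
    show "\<phi> x * \<psi> x = 0" if "x \<notin> csupp \<psi>" using zero_outside_csupp[OF that] by simp
  next
    show "continuous_on UNIV ?g" by (intro continuous_intros c c')
  qed (rule compact_csupp[OF \<psi>])
  moreover have "integrable lborel (\<lambda>x. \<phi> x * (tgrad \<psi> x \<bullet> b))"
    by (rule compact_support_integrable[OF _ compact_csupp[OF \<psi>]])
       (auto intro!: continuous_intros c c' simp: tgrad_zero_outside_csupp[OF \<psi>])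
  moreover have "integrable lborel (\<lambda>x. (tgrad \<phi> x \<bullet> b) * \<psi> x)"
    by (rule compact_support_integrable[OF _ compact_csupp[OF \<psi>]])
       (auto intro!: continuous_intros c c' simp: zero_outside_csupp)
  ultimately show "(\<integral>x. \<phi> x * (tgrad \<psi> x \<bullet> b) \<partial>lborel) = - (\<integral>x. (tgrad \<phi> x \<bullet> b) * \<psi> x \<partial>lborel)"
    by (simp add: inner_add_left mult.commute)
qed

lemma test_function_borel_rep:
  assumes \<phi>: "\<phi> \<in> test_functions \<Omega>"
  shows "borel_rep \<Omega> \<phi> \<phi>"
  using borel_measurable_continuous_onI[OF continuous_on_test_function[OF \<phi>]] csupp_subset[OF \<phi>] zero_outside_csupp[of _ \<phi>]
  by (auto simp: borel_rep_def)

lemma compact_support_p_integrable: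
  fixes f :: "'a::euclidean_space \<Rightarrow> 'b::euclidean_space"
  assumes "0 < p" "continuous_on UNIV f" "compact S" "\<And>x. x \<notin> S \<Longrightarrow> f x = 0"
  shows "p_integrable p lborel f"
  unfolding p_integrable_def
proof
  show "f \<in> borel_measurable lborel" using borel_measurable_continuous_onI[OF assms(2)] by simp
  show "integrable lborel (\<lambda>x. norm (f x) powr p)"
  proof (rule compact_support_integrable[OF _ assms(3)])
    show "continuous_on UNIV (\<lambda>x. norm (f x) powr p)"
      by (rule continuous_on_powr'[OF continuous_on_norm[OF assms(2)] continuous_on_const]) (use assms(1) in auto)
  qed (simp add: assms(4))
qed

text \<open>
  The zero extension of a limit of test functions is again a limit of test functions, now on the whole space,
  and the weak formulation passes to the limit.
\<close>

lemma W1p_0_zero_extension: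
  assumes p: "1 < p" and "open \<Omega>" and u: "u \<in> W1p_0 p \<Omega>"
    and U: "borel_rep \<Omega> u U" "p_integrable p lborel U" and G: "p_integrable p lborel G" "\<And>x. x \<notin> \<Omega> \<Longrightarrow> G x = 0"
    and weak: "borel_weak_grad \<Omega> U G"
  shows "borel_weak_grad UNIV U G"
proof -
  have p0: "0 < p" using p by simp
  have \<Omega>: "\<Omega> \<in> sets borel" using \<open>open \<Omega>\<close> by simp
  obtain \<phi> where \<phi>: "\<And>n. \<phi> n \<in> test_functions \<Omega>" "(\<lambda>n. W1p_norm p \<Omega> (\<lambda>x. \<phi> n x - u x)) \<longlonglongrightarrow> 0"
    using u by (auto simp: W1p_0_def)
  have \<phi>U: "\<phi> n \<in> test_functions UNIV" for n by (rule test_functions_mono[OF \<phi>(1)]) simp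
  have \<phi>_weak: "borel_weak_grad UNIV (\<phi> n) (tgrad (\<phi> n))" for n by (rule test_function_borel_weak_grad[OF \<phi>U])
  have \<phi>_p: "p_integrable p lborel (\<phi> n)" for n
    using zero_outside_csupp
    by (intro compact_support_p_integrable[OF p0 continuous_on_test_function[OF \<phi>(1)] compact_csupp[OF \<phi>(1)]]) auto
  have t\<phi>_p: "p_integrable p lborel (tgrad (\<phi> n))" for n
    using tgrad_zero_outside_csupp[OF \<phi>(1)]
    by (intro compact_support_p_integrable[OF p0 continuous_on_tgrad[OF \<phi>(1)] compact_csupp[OF \<phi>(1)]]) auto
  define d where "d n x = \<phi> n x - U x" for n x
  define g where "g n x = tgrad (\<phi> n) x - G x" for n x
  have d_p: "p_integrable p lborel (d n)" for n unfolding d_def by (rule p_integrable_diff[OF p0 \<phi>_p U(2)])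
  have g_p: "p_integrable p lborel (g n)" for n unfolding g_def by (rule p_integrable_diff[OF p0 t\<phi>_p G(1)])
  have d_rep: "borel_rep \<Omega> (\<lambda>x. \<phi> n x - u x) (d n)" for n
    unfolding d_def by (rule borel_rep_diff[OF test_function_borel_rep[OF \<phi>(1)] U(1)])
  have "borel_weak_grad \<Omega> (d n) (g n)" for n
    unfolding d_def g_def by (rule borel_weak_grad_diff[OF borel_weak_grad_mono[OF \<phi>_weak] weak]) simp
  moreover have "g n x = 0" if "x \<notin> \<Omega>" for n x
  proof -
    have "x \<notin> csupp (\<phi> n)" using that csupp_subset[OF \<phi>(1)[of n]] by blast
    then show ?thesis by (simp add: g_def G(2)[OF that] tgrad_zero_outside_csupp[OF \<phi>(1)])
  qed
  ultimately have g_rep: "borel_rep \<Omega> (weak_grad \<Omega> (\<lambda>x. \<phi> n x - u x)) (g n)" for n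
    by (intro weak_grad_borel_rep[OF \<open>open \<Omega>\<close> d_rep]) auto
  let ?I = "\<lambda>n. \<integral>x. norm (d n x) powr p \<partial>lborel" and ?J = "\<lambda>n. \<integral>x. norm (g n x) powr p \<partial>lborel"
  have IJ: "0 \<le> ?I n" "0 \<le> ?J n" for n by (rule integral_powr_nonneg)+
  have "(\<lambda>n. W1p_norm p \<Omega> (\<lambda>x. \<phi> n x - u x) powr p) \<longlonglongrightarrow> 0"
    using \<phi>(2) p0 by (intro tendsto_zero_powrI[of _ _ "\<lambda>_. p"]) (auto simp: W1p_norm_def)
  moreover have "W1p_norm p \<Omega> (\<lambda>x. \<phi> n x - u x) powr p = ?I n + ?J n" for n
    using p0 IJ[of n] unfolding W1p_norm_def
    by (simp add: powr_powr Lp_norm_borel_rep[OF p0 \<Omega> d_rep] Lp_norm_borel_rep[OF p0 \<Omega> g_rep])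
  ultimately have lim: "(\<lambda>n. ?I n + ?J n) \<longlonglongrightarrow> 0" by simp
  have limI: "?I \<longlonglongrightarrow> 0"
    by (rule tendsto_sandwich[OF _ _ tendsto_const lim]) (use IJ in \<open>auto intro!: always_eventually\<close>)
  have limJ: "?J \<longlonglongrightarrow> 0"
    by (rule tendsto_sandwich[OF _ _ tendsto_const lim]) (use IJ in \<open>auto intro!: always_eventually\<close>)
  show ?thesis
    unfolding borel_weak_grad_def
  proof (intro conjI ballI allI)
    show "borel_locally_integrable UNIV U" "borel_locally_integrable UNIV G"
      using p_integrable_imp_borel_locally_integrable[OF p U(2)] p_integrable_imp_borel_locally_integrable[OF p G(1)] .
    fix \<psi> :: "'a \<Rightarrow> real" and b :: 'a assume \<psi>: "\<psi> \<in> test_functions UNIV"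
    have \<psi>c: "continuous_on UNIV \<psi>" "continuous_on UNIV (tgrad \<psi>)"
      using continuous_on_test_function[OF \<psi>] continuous_on_tgrad[OF \<psi>] by auto
    then have [measurable]: "\<psi> \<in> borel_measurable borel" "tgrad \<psi> \<in> borel_measurable borel"
      by (auto intro: borel_measurable_continuous_onI)
    let ?S = "csupp \<psi>"
    have S: "compact ?S" by (rule compact_csupp[OF \<psi>])
    obtain B where B: "0 < B" "\<And>x. norm (\<psi> x) \<le> B"
      using \<psi>c(1) S zero_outside_csupp by (rule compact_support_bounded) (assumption | rule that)+
    have \<psi>le: "\<bar>\<psi> x\<bar> \<le> B * indicator ?S x" for x
      using B(2)[of x] zero_outside_csupp[of x \<psi>] by (cases "x \<in> ?S") auto
    have tb: "continuous_on UNIV (\<lambda>x. tgrad \<psi> x \<bullet> b)" by (intro continuous_intros \<psi>c)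
    obtain B' where B': "0 < B'" "\<And>x. norm (tgrad \<psi> x \<bullet> b) \<le> B'"
      using tb S by (rule compact_support_bounded[where f = "\<lambda>x. tgrad \<psi> x \<bullet> b"])
        (simp add: tgrad_zero_outside_csupp[OF \<psi>], rule that)
    have tle: "\<bar>tgrad \<psi> x \<bullet> b\<bar> \<le> B' * indicator ?S x" for x
      using B'(2)[of x] tgrad_zero_outside_csupp[OF \<psi>, of x] by (cases "x \<in> ?S") auto
    have i: "integrable lborel (\<lambda>x. f x * (tgrad \<psi> x \<bullet> b))" if "p_integrable p lborel f" for f :: "'a \<Rightarrow> real"
      using p_integrable_times_bounded(1)[OF p that S _ _ tle] B'(1) by (simp add: mult.commute)
    have j: "integrable lborel (\<lambda>x. (f x \<bullet> b) * \<psi> x)" if "p_integrable p lborel f" for f :: "'a \<Rightarrow> 'a"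
      using integrable_inner_left[OF p_integrable_times_bounded(1)[OF p that S _ _ \<psi>le], of b] B(1) by (simp add: mult.commute)
    define R where "R = (\<integral>x. U x * (tgrad \<psi> x \<bullet> b) \<partial>lborel) + (\<integral>x. (G x \<bullet> b) * \<psi> x \<partial>lborel)"
    have R: "\<bar>R\<bar> \<le> (\<integral>x. norm ((tgrad \<psi> x \<bullet> b) *\<^sub>R d n x) \<partial>lborel) + norm b * (\<integral>x. norm (\<psi> x *\<^sub>R g n x) \<partial>lborel)" for n
    proof -
      have "(\<integral>x. \<phi> n x * (tgrad \<psi> x \<bullet> b) \<partial>lborel) = - (\<integral>x. (tgrad (\<phi> n) x \<bullet> b) * \<psi> x \<partial>lborel)"
        using \<phi>_weak[of n] \<psi> unfolding borel_weak_grad_def by blast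
      then have "R = - ((\<integral>x. d n x * (tgrad \<psi> x \<bullet> b) \<partial>lborel) + (\<integral>x. (g n x \<bullet> b) * \<psi> x \<partial>lborel))"
        using i[OF U(2)] i[OF \<phi>_p[of n]] j[OF G(1)] j[OF t\<phi>_p[of n]]
        by (simp add: R_def d_def g_def inner_diff_left left_diff_distrib)
      then have "\<bar>R\<bar> \<le> \<bar>\<integral>x. d n x * (tgrad \<psi> x \<bullet> b) \<partial>lborel\<bar> + \<bar>\<integral>x. (g n x \<bullet> b) * \<psi> x \<partial>lborel\<bar>" by simp
      also have "\<bar>\<integral>x. d n x * (tgrad \<psi> x \<bullet> b) \<partial>lborel\<bar> \<le> (\<integral>x. \<bar>d n x * (tgrad \<psi> x \<bullet> b)\<bar> \<partial>lborel)"
        by (rule integral_abs_bound)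
      also have "\<dots> = (\<integral>x. norm ((tgrad \<psi> x \<bullet> b) *\<^sub>R d n x) \<partial>lborel)" by (simp add: mult.commute)
      also have "\<bar>\<integral>x. (g n x \<bullet> b) * \<psi> x \<partial>lborel\<bar> \<le> (\<integral>x. \<bar>(g n x \<bullet> b) * \<psi> x\<bar> \<partial>lborel)"
        by (rule integral_abs_bound)
      also have "\<dots> \<le> (\<integral>x. norm b * norm (\<psi> x *\<^sub>R g n x) \<partial>lborel)"
      proof (rule integral_mono)
        show "integrable lborel (\<lambda>x. \<bar>(g n x \<bullet> b) * \<psi> x\<bar>)" using j[OF g_p[of n]] by (rule integrable_abs)
        show "integrable lborel (\<lambda>x. norm b * norm (\<psi> x *\<^sub>R g n x))"
          using B(1) by (intro integrable_mult_right integrable_norm p_integrable_times_bounded(1)[OF p g_p S _ _ \<psi>le]) auto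
        show "\<bar>(g n x \<bullet> b) * \<psi> x\<bar> \<le> norm b * norm (\<psi> x *\<^sub>R g n x)" for x
          using mult_right_mono[OF Cauchy_Schwarz_ineq2[of "g n x" b] abs_ge_zero[of "\<psi> x"]]
          by (simp add: abs_mult mult_ac)
      qed
      finally show ?thesis by simp
    qed
    have "(\<lambda>n. (\<integral>x. norm ((tgrad \<psi> x \<bullet> b) *\<^sub>R d n x) \<partial>lborel) + norm b * (\<integral>x. norm (\<psi> x *\<^sub>R g n x) \<partial>lborel)) \<longlonglongrightarrow> 0 + norm b * 0"
    proof (intro tendsto_add tendsto_mult tendsto_const)
      show "(\<lambda>n. \<integral>x. norm ((tgrad \<psi> x \<bullet> b) *\<^sub>R d n x) \<partial>lborel) \<longlonglongrightarrow> 0"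
        using B'(1) by (intro L1_tendsto_0_on_compact[OF p d_p limI S _ _ tle]) auto
      show "(\<lambda>n. \<integral>x. norm (\<psi> x *\<^sub>R g n x) \<partial>lborel) \<longlonglongrightarrow> 0"
        using B(1) by (intro L1_tendsto_0_on_compact[OF p g_p limJ S _ _ \<psi>le]) auto
    qed
    then have "\<bar>R\<bar> \<le> 0 + norm b * 0" by (rule LIMSEQ_le_const) (use R in auto)
    then show "(\<integral>x. U x * (tgrad \<psi> x \<bullet> b) \<partial>lborel) = - (\<integral>x. (G x \<bullet> b) * \<psi> x \<partial>lborel)"
      by (simp add: R_def)
  qed
qed

text \<open>
  Both alternatives provide a Sobolev function on the whole space that agrees with \<open>u\<close> on \<open>\<Omega>\<close>. In this form alone
  they enter the limit argument, where it gives control of the increments of \<open>u\<close> up to the boundary of \<open>\<Omega>\<close>.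
\<close>

lemma whole_space_extension:
  fixes u :: "'a::euclidean_space \<Rightarrow> real"
  assumes p: "1 < p" and "open \<Omega>" and u: "u \<in> W1p p \<Omega>" and alt: "u \<in> W1p_0 p \<Omega> \<or> W1p_extension_domain p \<Omega>"
  obtains U G where "p_integrable p lborel U" "p_integrable p lborel G" "borel_weak_grad UNIV U G"
    "AE x in lborel. x \<in> \<Omega> \<longrightarrow> u x = U x" "AE x in lborel. x \<in> \<Omega> \<longrightarrow> weak_grad \<Omega> u x = G x"
proof -
  have \<Omega>: "\<Omega> \<in> sets borel" using \<open>open \<Omega>\<close> by simp
  obtain U\<^sub>0 G\<^sub>0 where UG: "borel_rep \<Omega> u U\<^sub>0" "p_integrable p lborel U\<^sub>0" "borel_rep \<Omega> (weak_grad \<Omega> u) G\<^sub>0" "p_integrable p lborel G\<^sub>0"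
    "borel_weak_grad \<Omega> U\<^sub>0 G\<^sub>0"
    by (rule W1p_borel_rep[OF \<open>open \<Omega>\<close> u])
  show thesis
    using alt
  proof
    assume "u \<in> W1p_0 p \<Omega>"
    then have "borel_weak_grad UNIV U\<^sub>0 G\<^sub>0"
      by (rule W1p_0_zero_extension[OF p \<open>open \<Omega>\<close> _ UG(1,2,4) borel_repD(2)[OF UG(3)] UG(5)])
    then show thesis
      by (rule that[OF UG(2,4) _ borel_repD(3)[OF UG(1)] borel_repD(3)[OF UG(3)]])
  next
    assume "W1p_extension_domain p \<Omega>"
    then obtain E :: "('a \<Rightarrow> real) \<Rightarrow> ('a \<Rightarrow> real)" where E: "E u \<in> W1p p UNIV" "AE x in lebesgue_on \<Omega>. E u x = u x"
      using u unfolding W1p_extension_domain_def by blast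
    obtain U G where U: "borel_rep UNIV (E u) U" "p_integrable p lborel U" and G: "p_integrable p lborel G"
      "borel_weak_grad UNIV U G"
      by (rule W1p_borel_rep[OF open_UNIV E(1)])
    have "AE x in lebesgue. x \<in> \<Omega> \<longrightarrow> E u x = u x"
      using E(2) \<Omega> by (subst (asm) AE_restrict_space_iff) auto
    then have ae: "AE x in lborel. x \<in> \<Omega> \<longrightarrow> E u x = u x" by (simp add: AE_completion_iff)
    then have uU: "AE x in lborel. x \<in> \<Omega> \<longrightarrow> u x = U x"
      using borel_repD(3)[OF U(1)] by eventually_elim auto
    let ?U = "\<lambda>x. indicator \<Omega> x *\<^sub>R U x" and ?G = "\<lambda>x. indicator \<Omega> x *\<^sub>R G x"
    have [measurable]: "U \<in> borel_measurable borel" "G \<in> borel_measurable borel" "\<Omega> \<in> sets borel"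
      using U(2) G(1) \<Omega> by (auto simp: p_integrable_def)
    have restr: "borel_rep \<Omega> u ?U"
      using uU by (auto simp: borel_rep_def elim: eventually_mono)
    have "borel_weak_grad \<Omega> ?U ?G"
    proof -
      have UGw: "borel_weak_grad \<Omega> U G" by (rule borel_weak_grad_mono[OF G(2)]) simp
      have l: "borel_locally_integrable \<Omega> (\<lambda>x. indicator \<Omega> x *\<^sub>R f x)" if "borel_locally_integrable \<Omega> f" for f :: "'a \<Rightarrow> 'b::euclidean_space"
      proof -
        have [measurable]: "f \<in> borel_measurable borel" using that by (simp add: borel_locally_integrable_def)
        have eq: "(\<lambda>x. indicat_real K x *\<^sub>R indicat_real \<Omega> x *\<^sub>R f x) = (\<lambda>x. indicat_real K x *\<^sub>R f x)" if "K \<subseteq> \<Omega>" for K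
          using that by (auto simp: indicator_def fun_eq_iff)
        show ?thesis
          unfolding borel_locally_integrable_def
        proof (intro conjI allI impI)
          fix K assume "compact K \<and> K \<subseteq> \<Omega>"
          then show "integrable lborel (\<lambda>x. indicat_real K x *\<^sub>R indicat_real \<Omega> x *\<^sub>R f x)"
            using that eq[of K] by (simp add: borel_locally_integrable_def del: scaleR_scaleR)
        qed measurable
      qed
      have e: "?U x * (tgrad \<psi> x \<bullet> b) = U x * (tgrad \<psi> x \<bullet> b)" "(?G x \<bullet> b) * \<psi> x = (G x \<bullet> b) * \<psi> x"
        if "\<psi> \<in> test_functions \<Omega>" for \<psi> b x
      proof -
        have "tgrad \<psi> x = 0 \<and> \<psi> x = 0" if "x \<notin> \<Omega>"
        proof -
          have "x \<notin> csupp \<psi>" using csupp_subset[OF \<open>\<psi> \<in> test_functions \<Omega>\<close>] that by blast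
          then show ?thesis
            using tgrad_zero_outside_csupp[OF \<open>\<psi> \<in> test_functions \<Omega>\<close>] zero_outside_csupp by blast
        qed
        then show "?U x * (tgrad \<psi> x \<bullet> b) = U x * (tgrad \<psi> x \<bullet> b)" "(?G x \<bullet> b) * \<psi> x = (G x \<bullet> b) * \<psi> x"
          by (cases "x \<in> \<Omega>"; simp)+
      qed
      show ?thesis
        unfolding borel_weak_grad_def
      proof (intro conjI ballI allI)
        show "borel_locally_integrable \<Omega> ?U" "borel_locally_integrable \<Omega> ?G"
          using UGw l[of U] l[of G] unfolding borel_weak_grad_def by blast+
        fix \<psi> b assume \<psi>: "\<psi> \<in> test_functions \<Omega>"
        show "(\<integral>x. ?U x * (tgrad \<psi> x \<bullet> b) \<partial>lborel) = - (\<integral>x. (?G x \<bullet> b) * \<psi> x \<partial>lborel)"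
          unfolding e[OF \<psi>] using UGw \<psi> by (simp add: borel_weak_grad_def)
      qed
    qed
    then have "borel_rep \<Omega> (weak_grad \<Omega> u) ?G" by (rule weak_grad_borel_rep[OF \<open>open \<Omega>\<close> restr]) simp
    from borel_repD(3)[OF this] have "AE x in lborel. x \<in> \<Omega> \<longrightarrow> weak_grad \<Omega> u x = G x"
      by eventually_elim auto
    then show thesis by (rule that[OF U(2) G uU])
  qed
qed

section \<open>The nonlocal form in increments\<close>

lemma lborel_minus: "distr lborel borel (\<lambda>y. x - y) = (lborel :: 'a::euclidean_space measure)"
  using lborel_affine[of "-1" x] by (simp add: density_1)

lemma AE_lborel_null_set:
  assumes "AE x in lborel. P x"
  obtains N where "N \<in> null_sets lborel" "{x. \<not> P x} \<subseteq> N"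
  using assms by (auto simp: eventually_ae_filter)

lemma AE_lborel_pair:
  fixes P :: "'a::euclidean_space \<Rightarrow> bool"
  assumes "AE x in lborel. P x"
  shows "AE z in lborel \<Otimes>\<^sub>M (lborel :: 'a measure). P (fst z)"
    and "AE z in (lborel :: 'a measure) \<Otimes>\<^sub>M lborel. P (snd z)"
    and "AE z in lborel \<Otimes>\<^sub>M lborel. P (fst z - snd z)"
proof -
  obtain N where N: "N \<in> null_sets lborel" "{x. \<not> P x} \<subseteq> N"
    by (rule AE_lborel_null_set[OF assms])
  then have [measurable]: "N \<in> sets borel" and ae: "AE x in lborel. x \<notin> N"
    by (auto intro: AE_not_in)
  have P: "x \<notin> N \<Longrightarrow> P x" for x using N(2) by blast
  have "AE z in lborel \<Otimes>\<^sub>M (lborel :: 'a measure). fst z \<notin> N"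
    by (rule lborel_pair.AE_pair_measure, measurable) (use ae in auto)
  then show "AE z in lborel \<Otimes>\<^sub>M (lborel :: 'a measure). P (fst z)" by eventually_elim (rule P)
  have "AE z in (lborel :: 'a measure) \<Otimes>\<^sub>M lborel. snd z \<notin> N"
    by (rule lborel_pair.AE_pair_measure, measurable) (use ae in auto)
  then show "AE z in (lborel :: 'a measure) \<Otimes>\<^sub>M lborel. P (snd z)" by eventually_elim (rule P)
  have "AE y in lborel. x - y \<notin> N" for x
  proof -
    have "AE y in distr lborel borel (\<lambda>y. x - y). y \<notin> N" unfolding lborel_minus by (rule ae)
    then show ?thesis by (subst (asm) AE_distr_iff) auto
  qed
  note minus = this
  have "AE z in lborel \<Otimes>\<^sub>M lborel. fst z - snd z \<notin> N"
    by (rule lborel_pair.AE_pair_measure, measurable) (use minus in auto)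
  then show "AE z in lborel \<Otimes>\<^sub>M lborel. P (fst z - snd z)" by eventually_elim (rule P)
qed

text \<open>By Fubini's theorem, since \<open>h \<mapsto> x - h\<close> preserves Lebesgue measure for each fixed \<open>x\<close>.\<close>

lemma distr_increment:
  "distr (lborel \<Otimes>\<^sub>M lborel) (lborel \<Otimes>\<^sub>M lborel) (\<lambda>(h, x). (x, x - h)) =
    (lborel \<Otimes>\<^sub>M lborel :: ('a::euclidean_space \<times> 'a) measure)"
proof (rule measure_eqI)
  let ?L = "lborel \<Otimes>\<^sub>M lborel :: ('a \<times> 'a) measure"
  fix A assume "A \<in> sets (distr ?L ?L (\<lambda>(h, x). (x, x - h)))"
  then have A [measurable]: "A \<in> sets ?L" by simp
  have S [measurable]: "(\<lambda>(h, x). (x, x - h)) \<in> ?L \<rightarrow>\<^sub>M ?L" by measurable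
  have "emeasure (distr ?L ?L (\<lambda>(h, x). (x, x - h))) A = (\<integral>\<^sup>+ z. indicator A z \<partial>distr ?L ?L (\<lambda>(h, x). (x, x - h)))"
    by (rule nn_integral_indicator[symmetric]) (unfold sets_distr, rule A)
  also have "\<dots> = (\<integral>\<^sup>+ z. indicator A ((\<lambda>(h, x). (x, x - h)) z) \<partial>?L)"
    by (rule nn_integral_distr[OF S]) measurable
  also have "\<dots> = (\<integral>\<^sup>+ h. \<integral>\<^sup>+ x. indicator A (x, x - h) \<partial>lborel \<partial>lborel)"
    by (subst lborel.nn_integral_fst[symmetric]) auto
  also have "\<dots> = (\<integral>\<^sup>+ x. \<integral>\<^sup>+ h. indicator A (x, x - h) \<partial>lborel \<partial>lborel)"
    by (rule lborel_pair.Fubini'[symmetric]) measurable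
  also have "\<dots> = (\<integral>\<^sup>+ x. \<integral>\<^sup>+ y. indicator A (x, y) \<partial>lborel \<partial>lborel)"
  proof (rule nn_integral_cong)
    fix x :: 'a
    have "Pair x \<in> lborel \<rightarrow>\<^sub>M ?L" by (rule measurable_Pair1') simp
    then have m: "(\<lambda>y. indicator A (x, y) :: ennreal) \<in> borel_measurable lborel"
      by (rule measurable_compose[OF _ borel_measurable_indicator[OF A]])
    have "(\<integral>\<^sup>+ y. indicator A (x, y) \<partial>distr lborel borel (\<lambda>h. x - h)) = (\<integral>\<^sup>+ h. indicator A (x, x - h) \<partial>lborel)"
    proof (rule nn_integral_distr)
      show "(\<lambda>h. x - h) \<in> lborel \<rightarrow>\<^sub>M borel" by measurable
      show "(\<lambda>y. indicator A (x, y) :: ennreal) \<in> borel_measurable (distr lborel borel (\<lambda>h. x - h))"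
        unfolding lborel_minus by (rule m)
    qed
    then show "(\<integral>\<^sup>+ h. indicator A (x, x - h) \<partial>lborel) = (\<integral>\<^sup>+ y. indicator A (x, y) \<partial>lborel)"
      unfolding lborel_minus by (rule sym)
  qed
  also have "\<dots> = emeasure ?L A"
    using A by (subst lborel.nn_integral_fst) auto
  finally show "emeasure (distr ?L ?L (\<lambda>(h, x). (x, x - h))) A = emeasure ?L A" .
qed simp

lemma sigma_finite_density_lborel:
  fixes k :: "'a::euclidean_space \<Rightarrow> real"
  assumes "k \<in> borel_measurable borel"
  shows "sigma_finite_measure (density lborel (\<lambda>h. ennreal (k h)))"
  using assms by (subst sigma_finite_measure.sigma_finite_iff_density_finite[OF lborel.sigma_finite_measure_axioms]) auto

lemma pair_density_lborel:
  fixes k :: "'a::euclidean_space \<Rightarrow> real"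
  assumes [measurable]: "k \<in> borel_measurable borel"
  shows "density lborel (\<lambda>h. ennreal (k h)) \<Otimes>\<^sub>M (lborel :: 'b::euclidean_space measure) =
    density (lborel \<Otimes>\<^sub>M lborel) (\<lambda>z. ennreal (k (fst z)))"
proof -
  have "density lborel (\<lambda>h. ennreal (k h)) \<Otimes>\<^sub>M density (lborel :: 'b measure) (\<lambda>_. 1) =
      density (lborel \<Otimes>\<^sub>M lborel) (\<lambda>(h, x). ennreal (k h) * 1)"
    by (rule pair_measure_density) (auto simp: density_1 lborel.sigma_finite_measure_axioms)
  then show ?thesis by (simp add: density_1 split_beta')
qed

text \<open>
  In the coordinates \<open>h = x - y\<close> and \<open>x\<close> the kernel becomes part of the measure.
\<close>

lemma nonlocal_form_eq_increment_pairing: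
  fixes u v U W :: "'a::euclidean_space \<Rightarrow> real" and k :: "'a \<Rightarrow> real" and p :: real
  assumes \<Omega> [measurable]: "\<Omega> \<in> sets borel"
    and U [measurable]: "U \<in> borel_measurable borel" and uU: "AE x in lborel. x \<in> \<Omega> \<longrightarrow> u x = U x"
    and W [measurable]: "W \<in> borel_measurable borel" and vW: "AE x in lborel. x \<in> \<Omega> \<longrightarrow> v x = W x"
    and k [measurable]: "k \<in> borel_measurable borel" and k0: "\<And>h. 0 \<le> k h" and \<nu>k: "AE h in lborel. \<nu> h = k h"
  defines "I \<equiv> \<lambda>z. (case z of (h, x) \<Rightarrow> pflux p (U x - U (x - h))) * local_increment \<Omega> W z"
  shows "nonlocal_form p \<nu> \<Omega> u v = (\<integral>z. I z \<partial>(density lborel (\<lambda>h. ennreal (k h)) \<Otimes>\<^sub>M lborel))"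
    and "integrable (lebesgue_on (\<Omega> \<times> \<Omega>)) (nonlocal_integrand p \<nu> u v) \<longleftrightarrow>
      integrable (density lborel (\<lambda>h. ennreal (k h)) \<Otimes>\<^sub>M lborel) I"
proof -
  let ?L = "lborel \<Otimes>\<^sub>M lborel :: ('a \<times> 'a) measure"
  let ?S = "\<lambda>(h, x). (x, x - h) :: 'a \<times> 'a"
  define g where "g z = pflux p (U (fst z) - U (snd z)) * (W (fst z) - W (snd z)) * k (fst z - snd z)" for z
  have gm: "g \<in> borel_measurable ?L" unfolding g_def by measurable
  then have gm': "g \<in> borel_measurable borel" by (simp add: lborel_prod)
  have ae': "AE z in ?L. z \<in> \<Omega> \<times> \<Omega> \<longrightarrow> nonlocal_integrand p \<nu> u v z = g z"
    using AE_lborel_pair(1)[OF uU] AE_lborel_pair(2)[OF uU] AE_lborel_pair(1)[OF vW] AE_lborel_pair(2)[OF vW]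
      AE_lborel_pair(3)[OF \<nu>k]
    by eventually_elim (auto simp: nonlocal_integrand_def g_def pflux_def)
  have ae: "AE z in lborel. z \<in> \<Omega> \<times> \<Omega> \<longrightarrow> nonlocal_integrand p \<nu> u v z = g z"
    using ae' unfolding lborel_prod .
  have \<Omega>2: "\<Omega> \<times> \<Omega> \<in> sets borel" using \<Omega> by (intro borel_Times)
  let ?f = "\<lambda>z. indicator (\<Omega> \<times> \<Omega>) z *\<^sub>R g z"
  have [measurable]: "g \<in> borel_measurable ?L" by (rule gm)
  have fm: "?f \<in> borel_measurable ?L"
    using \<Omega>2 gm' by (simp add: lborel_prod)
  have S: "?S \<in> ?L \<rightarrow>\<^sub>M ?L" by measurable
  have fS: "?f (?S z) = k (fst z) *\<^sub>R I z" for z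
    by (cases z) (simp add: I_def g_def local_increment_def indicator_times mult_ac)
  have Im: "I \<in> borel_measurable ?L"
    unfolding I_def local_increment_def by measurable
  have km: "(\<lambda>z. k (fst z)) \<in> borel_measurable ?L" by measurable
  have "nonlocal_form p \<nu> \<Omega> u v = (\<integral>z. ?f z \<partial>lborel)"
    unfolding nonlocal_form_def by (rule lebesgue_on_transfer(3)[OF \<Omega>2 gm' ae])
  also have "\<dots> = (\<integral>z. ?f z \<partial>?L)" by (simp add: lborel_prod)
  also have "\<dots> = (\<integral>z. ?f z \<partial>distr ?L ?L ?S)" by (simp add: distr_increment)
  also have "\<dots> = (\<integral>z. ?f (?S z) \<partial>?L)" by (rule integral_distr[OF S fm])
  also have "\<dots> = (\<integral>z. k (fst z) *\<^sub>R I z \<partial>?L)" by (simp only: fS)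
  also have "\<dots> = (\<integral>z. I z \<partial>density ?L (\<lambda>z. ennreal (k (fst z))))"
    by (rule integral_density[symmetric, OF Im km]) (simp add: k0)
  finally show "nonlocal_form p \<nu> \<Omega> u v = (\<integral>z. I z \<partial>(density lborel (\<lambda>h. ennreal (k h)) \<Otimes>\<^sub>M lborel))"
    by (simp add: pair_density_lborel[OF k])
  have "integrable (lebesgue_on (\<Omega> \<times> \<Omega>)) (nonlocal_integrand p \<nu> u v) \<longleftrightarrow> integrable lborel ?f"
    by (rule lebesgue_on_transfer(2)[OF \<Omega>2 gm' ae])
  also have "\<dots> \<longleftrightarrow> integrable ?L ?f" by (simp only: lborel_prod)
  also have "\<dots> \<longleftrightarrow> integrable (distr ?L ?L ?S) ?f" by (simp only: distr_increment)
  also have "\<dots> \<longleftrightarrow> integrable ?L (\<lambda>z. ?f (?S z))" by (rule integrable_distr_eq[OF S fm])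
  also have "\<dots> \<longleftrightarrow> integrable ?L (\<lambda>z. k (fst z) *\<^sub>R I z)" by (simp only: fS)
  also have "\<dots> \<longleftrightarrow> integrable (density ?L (\<lambda>z. ennreal (k (fst z)))) I"
    by (rule integrable_density[symmetric, OF Im km]) (simp add: k0)
  finally show "integrable (lebesgue_on (\<Omega> \<times> \<Omega>)) (nonlocal_integrand p \<nu> u v) \<longleftrightarrow>
      integrable (density lborel (\<lambda>h. ennreal (k h)) \<Otimes>\<^sub>M lborel) I"
    by (simp add: pair_density_lborel[OF k])
qed

lemma pflux_times_local_increment:
  "(case z of (h, x) \<Rightarrow> pflux p (W x - W (x - h))) * local_increment \<Omega> W z = norm (local_increment \<Omega> W z) powr p"
proof -
  obtain h x where z: "z = (h, x)" by (cases z)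
  have *: "\<bar>t\<bar> powr (p - 2) * t * t = \<bar>t\<bar> powr p" for t :: real
  proof -
    have "\<bar>t\<bar> powr (p - 2) * t * t = \<bar>t\<bar> powr (p - 2) * \<bar>t\<bar> * \<bar>t\<bar>" by (simp add: mult.assoc abs_mult_self_eq)
    also have "\<dots> = \<bar>t\<bar> powr p"
      using powr_mult_self[of "\<bar>t\<bar>" "p - 2"] powr_mult_self[of "\<bar>t\<bar>" "p - 1"] by simp
    finally show ?thesis .
  qed
  show ?thesis by (simp add: z local_increment_def pflux_def indicator_def *)
qed

section \<open>The kernels as measures\<close>

lemma kernel_family_borel_rep:
  fixes \<nu> :: "real \<Rightarrow> 'a::euclidean_space \<Rightarrow> real"
  assumes p: "1 < p" and fam: "kernel_family p \<nu>" and \<epsilon>: "0 < \<epsilon>"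
  obtains k where "k \<in> borel_measurable borel" "\<forall>h. 0 \<le> k h" "AE h in lborel. \<nu> \<epsilon> h = k h"
    "has_bochner_integral (density lborel (\<lambda>h. ennreal (k h))) (\<lambda>h. min 1 (norm h powr p)) 1"
    "\<forall>\<delta>>0. measure (density lborel (\<lambda>h. ennreal (k h))) {h. \<delta> < norm h} = (\<integral>h. \<nu> \<epsilon> h \<partial>lebesgue_on {h. norm h > \<delta>})"
    "\<forall>a. distr (density lborel (\<lambda>h. ennreal (k h))) borel (reflect a) = density lborel (\<lambda>h. ennreal (k h))"
proof -
  have \<nu>m: "\<nu> \<epsilon> \<in> borel_measurable (lebesgue_on (- {0}))" and \<nu>0: "\<And>h. h \<noteq> 0 \<Longrightarrow> 0 \<le> \<nu> \<epsilon> h"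
    and radial: "\<And>h l. h \<noteq> 0 \<Longrightarrow> l \<noteq> 0 \<Longrightarrow> norm h = norm l \<Longrightarrow> \<nu> \<epsilon> h = \<nu> \<epsilon> l"
    and mass: "has_bochner_integral (lebesgue_on (- {0})) (\<lambda>h. min 1 (norm h powr p) * \<nu> \<epsilon> h) 1"
    using fam \<epsilon> unfolding kernel_family_def by blast+
  have "- {0::'a} \<in> sets borel" by simp
  then obtain k\<^sub>0 where k\<^sub>0: "k\<^sub>0 \<in> borel_measurable borel" "AE h in lborel. h \<in> - {0} \<longrightarrow> \<nu> \<epsilon> h = k\<^sub>0 h"
    using \<nu>m by (rule borel_representative)
  define k where "k h = max 0 (k\<^sub>0 h)" for h
  have k [measurable]: "k \<in> borel_measurable borel" unfolding k_def using k\<^sub>0(1) by measurable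
  have k_nonneg: "0 \<le> k h" for h by (simp add: k_def)
  have nz: "AE h in lborel. (h::'a) \<noteq> 0" by (rule AE_lborel_singleton)
  have \<nu>k: "AE h in lborel. \<nu> \<epsilon> h = k h"
    using k\<^sub>0(2) nz
  proof eventually_elim
    case (elim h)
    then show ?case using \<nu>0[of h] by (simp add: k_def)
  qed
  let ?\<mu> = "density lborel (\<lambda>h. ennreal (k h))"
  show thesis
  proof (rule that[OF k _ \<nu>k])
    show "\<forall>h. 0 \<le> k h" using k_nonneg by simp
    have eq: "indicator (- {0}) h *\<^sub>R (min 1 (norm h powr p) * k h) = k h *\<^sub>R min 1 (norm h powr p)" for h
      by (cases "h = 0") auto
    have ae: "AE h in lborel. h \<in> - {0} \<longrightarrow> min 1 (norm h powr p) * \<nu> \<epsilon> h = min 1 (norm h powr p) * k h"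
      using \<nu>k by eventually_elim simp
    have tr: "integrable (lebesgue_on (- {0})) (\<lambda>h. min 1 (norm h powr p) * \<nu> \<epsilon> h) \<longleftrightarrow> integrable lborel (\<lambda>h. k h *\<^sub>R min 1 (norm h powr p))"
      "(\<integral>h. min 1 (norm h powr p) * \<nu> \<epsilon> h \<partial>lebesgue_on (- {0})) = (\<integral>h. k h *\<^sub>R min 1 (norm h powr p) \<partial>lborel)"
      using lebesgue_on_transfer(2,3)[OF _ _ ae] unfolding eq by auto
    show "has_bochner_integral ?\<mu> (\<lambda>h. min 1 (norm h powr p)) 1"
      using mass tr k_nonneg by (simp add: has_bochner_integral_iff integrable_density integral_density)
    show "\<forall>\<delta>>0. measure ?\<mu> {h. \<delta> < norm h} = (\<integral>h. \<nu> \<epsilon> h \<partial>lebesgue_on {h. norm h > \<delta>})"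
    proof (intro allI impI)
      fix \<delta> :: real assume "0 < \<delta>"
      have far [measurable]: "{h::'a. \<delta> < norm h} \<in> sets borel" by measurable
      have "(\<integral>h. \<nu> \<epsilon> h \<partial>lebesgue_on {h. norm h > \<delta>}) = (\<integral>h. indicator {h. norm h > \<delta>} h *\<^sub>R k h \<partial>lborel)"
        by (rule lebesgue_on_transfer(3)[OF far k]) (use \<nu>k in \<open>auto elim: eventually_mono\<close>)
      also have "\<dots> = (\<integral>h. indicat_real {h. \<delta> < norm h} h \<partial>?\<mu>)"
        using k_nonneg by (subst integral_density) (auto simp: mult.commute)
      also have "\<dots> = measure ?\<mu> {h. \<delta> < norm h}" by simp
      finally show "measure ?\<mu> {h. \<delta> < norm h} = (\<integral>h. \<nu> \<epsilon> h \<partial>lebesgue_on {h. norm h > \<delta>})" by simp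
    qed
    show "\<forall>a. distr ?\<mu> borel (reflect a) = ?\<mu>"
    proof
      fix a :: 'a
      \<comment> \<open>The representative is radial only almost everywhere, which suffices for a fixed reflection.\<close>
      obtain N where N: "N \<in> null_sets lborel" "{h. \<not> \<nu> \<epsilon> h = k h} \<subseteq> N"
        by (rule AE_lborel_null_set[OF \<nu>k])
      have [measurable]: "N \<in> sets borel" using N(1) by auto
      have "AE h in distr lborel borel (reflect a). h \<notin> N" using N(1) by (simp add: lborel_reflect AE_not_in)
      then have "AE h in lborel. reflect a h \<notin> N" by (subst (asm) AE_distr_iff) auto
      then have ae: "AE h in lborel. k (reflect a h) = k h"
        using nz \<nu>k
      proof eventually_elim
        case (elim h)
        have "reflect a h \<noteq> 0" using elim(2) norm_reflect[of a h] by (metis norm_eq_zero)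
        then have "\<nu> \<epsilon> (reflect a h) = \<nu> \<epsilon> h" using elim(2) by (intro radial) auto
        moreover have "\<nu> \<epsilon> (reflect a h) = k (reflect a h)" using elim(1) N(2) by blast
        ultimately show ?case using elim(3) by simp
      qed
      have "distr ?\<mu> borel (reflect a) = distr (density lborel (\<lambda>h. ennreal (k (reflect a (reflect a h))))) borel (reflect a)"
        by simp
      also have "\<dots> = density (distr lborel borel (reflect a)) (\<lambda>h. ennreal (k (reflect a h)))"
        by (rule density_distr[symmetric]) measurable
      also have "\<dots> = ?\<mu>"
        unfolding lborel_reflect using ae by (intro density_cong) auto
      finally show "distr ?\<mu> borel (reflect a) = ?\<mu>" .
    qed
  qed
qed

section \<open>Convergence of the forms\<close>

theorem theorem2p17:
  fixes \<Omega> :: "'a::euclidean_space set"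
    and p :: real
    and \<nu> :: "real \<Rightarrow> 'a \<Rightarrow> real"
    and u v :: "'a \<Rightarrow> real"
    and v\<^sub>\<epsilon> :: "real \<Rightarrow> 'a \<Rightarrow> real"
    and e :: 'a
  assumes "1 < p"
    and "e \<in> Basis"
    and "kernel_family p \<nu>"
    and "open \<Omega>"
    and "u \<in> W1p p \<Omega>" and "v \<in> W1p p \<Omega>"
    and "\<And>\<epsilon>. \<epsilon> > 0 \<Longrightarrow> v\<^sub>\<epsilon> \<epsilon> \<in> Wp_nonlocal p (\<nu> \<epsilon>) \<Omega>"
    and "tendsto_Lp_loc p \<Omega> v\<^sub>\<epsilon> v (at_right 0)"
    and "bdd_above ((\<lambda>\<epsilon>. Lp_norm p \<Omega> (v\<^sub>\<epsilon> \<epsilon>) powr p + nonlocal_form p (\<nu> \<epsilon>) \<Omega> (v\<^sub>\<epsilon> \<epsilon>) (v\<^sub>\<epsilon> \<epsilon>)) ` {0<..})"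
    and "u \<in> W1p_0 p \<Omega> \<or> W1p_extension_domain p \<Omega>"
  shows "((\<lambda>\<epsilon>. nonlocal_form p (\<nu> \<epsilon>) \<Omega> u (v\<^sub>\<epsilon> \<epsilon>)) \<longlongrightarrow> K_const e p * local_form p \<Omega> u v) (at_right 0)"
  unfolding tendsto_at_iff_sequentially
proof (intro allI impI)
  fix X :: "nat \<Rightarrow> real"
  assume "\<forall>i. X i \<in> {0<..} - {0}" and X0: "X \<longlonglongrightarrow> 0"
  then have X: "0 < X n" for n by auto
  have p0: "0 < p" using assms(1) by simp
  have \<Omega>: "\<Omega> \<in> sets borel" using assms(4) by simp
  obtain U G where U: "p_integrable p lborel U" and G: "p_integrable p lborel G" and UG: "borel_weak_grad UNIV U G"
    and uU: "AE x in lborel. x \<in> \<Omega> \<longrightarrow> u x = U x" and uG: "AE x in lborel. x \<in> \<Omega> \<longrightarrow> weak_grad \<Omega> u x = G x"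
    by (rule whole_space_extension[OF assms(1,4,5,10)])
  obtain w\<^sub>0 V where w\<^sub>0: "borel_rep \<Omega> v w\<^sub>0" "p_integrable p lborel w\<^sub>0" and V: "borel_rep \<Omega> (weak_grad \<Omega> v) V" "p_integrable p lborel V"
    and wV: "borel_weak_grad \<Omega> w\<^sub>0 V"
    by (rule W1p_borel_rep[OF assms(4,6)])
  have "\<exists>w. borel_rep \<Omega> (v\<^sub>\<epsilon> (X n)) w \<and> p_integrable p lborel w" for n
    using assms(7)[OF X[of n]] by (auto simp: Wp_nonlocal_def intro: Lp_space_borel_rep[OF \<Omega>])
  then obtain w where w: "\<And>n. borel_rep \<Omega> (v\<^sub>\<epsilon> (X n)) (w n)" "\<And>n. p_integrable p lborel (w n)" by metis
  define R where "R n k \<longleftrightarrow> k \<in> borel_measurable borel \<and> (\<forall>h. 0 \<le> k h) \<and> (AE h in lborel. \<nu> (X n) h = k h) \<and>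
    has_bochner_integral (density lborel (\<lambda>h. ennreal (k h))) (\<lambda>h. min 1 (norm h powr p)) 1 \<and>
    (\<forall>\<delta>>0. measure (density lborel (\<lambda>h. ennreal (k h))) {h. \<delta> < norm h} = (\<integral>h. \<nu> (X n) h \<partial>lebesgue_on {h. norm h > \<delta>})) \<and>
    (\<forall>a. distr (density lborel (\<lambda>h. ennreal (k h))) borel (reflect a) = density lborel (\<lambda>h. ennreal (k h)))" for n k
  have "\<exists>k. R n k" for n
    unfolding R_def by (rule kernel_family_borel_rep[OF assms(1,3) X[of n]]) blast
  then obtain k where R: "\<And>n. R n (k n)" by metis
  have k: "\<And>n. k n \<in> borel_measurable borel" "\<And>n h. 0 \<le> k n h" "\<And>n. AE h in lborel. \<nu> (X n) h = k n h"
    "\<And>n. has_bochner_integral (density lborel (\<lambda>h. ennreal (k n h))) (\<lambda>h. min 1 (norm h powr p)) 1"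
    "\<And>n \<delta>. 0 < \<delta> \<Longrightarrow> measure (density lborel (\<lambda>h. ennreal (k n h))) {h. \<delta> < norm h} = (\<integral>h. \<nu> (X n) h \<partial>lebesgue_on {h. norm h > \<delta>})"
    "\<And>n a. distr (density lborel (\<lambda>h. ennreal (k n h))) borel (reflect a) = density lborel (\<lambda>h. ennreal (k n h))"
    using R unfolding R_def by blast+
  define \<mu> where "\<mu> n = density lborel (\<lambda>h. ennreal (k n h))" for n
  obtain M where M: "\<And>\<epsilon>. 0 < \<epsilon> \<Longrightarrow> Lp_norm p \<Omega> (v\<^sub>\<epsilon> \<epsilon>) powr p + nonlocal_form p (\<nu> \<epsilon>) \<Omega> (v\<^sub>\<epsilon> \<epsilon>) (v\<^sub>\<epsilon> \<epsilon>) \<le> M"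
    using assms(9) by (auto simp: bdd_above_def)
  have Um: "U \<in> borel_measurable borel" using U by (simp add: p_integrable_def)
  have wm: "w n \<in> borel_measurable borel" for n using w(2)[of n] by (simp add: p_integrable_def)
  have form: "nonlocal_form p (\<nu> (X n)) \<Omega> f (v\<^sub>\<epsilon> (X n)) =
      (\<integral>z. (case z of (h, x) \<Rightarrow> pflux p (F x - F (x - h))) * local_increment \<Omega> (w n) z \<partial>(\<mu> n \<Otimes>\<^sub>M lborel))"
    and form_integrable: "integrable (lebesgue_on (\<Omega> \<times> \<Omega>)) (nonlocal_integrand p (\<nu> (X n)) f (v\<^sub>\<epsilon> (X n))) \<longleftrightarrow>
      integrable (\<mu> n \<Otimes>\<^sub>M lborel) (\<lambda>z. (case z of (h, x) \<Rightarrow> pflux p (F x - F (x - h))) * local_increment \<Omega> (w n) z)"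
    if "F \<in> borel_measurable borel" "AE x in lborel. x \<in> \<Omega> \<longrightarrow> f x = F x" for n f F
    unfolding \<mu>_def
    by (rule nonlocal_form_eq_increment_pairing[OF \<Omega> that wm[of n] borel_repD(3)[OF w(1)[of n]] k(1)[of n] k(2)[of n] k(3)[of n]])+
  have T_meas: "local_increment \<Omega> (w n) \<in> borel_measurable (\<mu> n \<Otimes>\<^sub>M lborel)" for n
  proof -
    have [measurable]: "\<Omega> \<in> sets borel" "w n \<in> borel_measurable borel" using \<Omega> wm .
    have [measurable_cong]: "sets (\<mu> n) = sets borel" by (simp add: \<mu>_def)
    show ?thesis unfolding local_increment_def \<mu>_def by measurable
  qed
  have Ti: "p_integrable p (\<mu> n \<Otimes>\<^sub>M lborel) (local_increment \<Omega> (w n))"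
    and energy: "(\<integral>z. norm (local_increment \<Omega> (w n) z) powr p \<partial>(\<mu> n \<Otimes>\<^sub>M lborel)) = nonlocal_form p (\<nu> (X n)) \<Omega> (v\<^sub>\<epsilon> (X n)) (v\<^sub>\<epsilon> (X n))" for n
    using form[OF wm borel_repD(3)[OF w(1)], of n n] form_integrable[OF wm borel_repD(3)[OF w(1)], of n n]
      assms(7)[OF X[of n]] T_meas[of n]
    unfolding pflux_times_local_increment by (auto simp: p_integrable_def Wp_nonlocal_def)
  have bounds: "(\<integral>x. norm (w n x) powr p \<partial>lborel) \<le> M" "(\<integral>z. norm (local_increment \<Omega> (w n) z) powr p \<partial>(\<mu> n \<Otimes>\<^sub>M lborel)) \<le> M" for n
    using M[OF X[of n]] integral_powr_nonneg[of lborel "w n" p] integral_powr_nonneg[of "\<mu> n \<Otimes>\<^sub>M lborel" "local_increment \<Omega> (w n)" p]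
    unfolding energy[symmetric] Lp_norm_borel_rep[OF p0 \<Omega> w(1)] by linarith+
  have loc: "(\<lambda>n. \<integral>x. indicator L x * norm (w n x - w\<^sub>0 x) powr p \<partial>lborel) \<longlonglongrightarrow> 0" if L: "compact L" "L \<subseteq> \<Omega>" for L
  proof -
    have "((\<lambda>\<epsilon>. Lp_norm p L (\<lambda>x. v\<^sub>\<epsilon> \<epsilon> x - v x)) \<longlongrightarrow> 0) (at_right 0)"
      using assms(8) L unfolding tendsto_Lp_loc_def by blast
    then have "(\<lambda>n. Lp_norm p L (\<lambda>x. v\<^sub>\<epsilon> (X n) x - v x)) \<longlonglongrightarrow> 0"
      unfolding tendsto_at_iff_sequentially using X X0 by (auto simp: comp_def)
    then have "(\<lambda>n. Lp_norm p L (\<lambda>x. v\<^sub>\<epsilon> (X n) x - v x) powr p) \<longlonglongrightarrow> 0"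
      using p0 by (intro tendsto_zero_powrI[of _ _ "\<lambda>_. p"]) (auto simp: Lp_norm_def)
    moreover have "Lp_norm p L (\<lambda>x. v\<^sub>\<epsilon> (X n) x - v x) powr p = (\<integral>x. indicator L x * norm (w n x - w\<^sub>0 x) powr p \<partial>lborel)" for n
    proof (rule Lp_norm_transfer[OF p0])
      show "L \<in> sets borel" using L by (simp add: borel_compact)
      show "(\<lambda>x. w n x - w\<^sub>0 x) \<in> borel_measurable borel" using wm borel_repD(1)[OF w\<^sub>0(1)] by measurable
      show "AE x in lborel. x \<in> L \<longrightarrow> v\<^sub>\<epsilon> (X n) x - v x = w n x - w\<^sub>0 x"
        using borel_repD(3)[OF w(1)[of n]] borel_repD(3)[OF w\<^sub>0(1)] by eventually_elim (use L in auto)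
    qed
    ultimately show ?thesis by simp
  qed
  have conc: "(\<lambda>n. measure (\<mu> n) {h. \<delta> < norm h}) \<longlonglongrightarrow> 0" if "0 < \<delta>" for \<delta>
  proof -
    have "((\<lambda>\<epsilon>. \<integral>h. \<nu> \<epsilon> h \<partial>lebesgue_on {h. norm h > \<delta>}) \<longlongrightarrow> 0) (at_right 0)"
      using assms(3) that unfolding kernel_family_def by blast
    then have "(\<lambda>n. \<integral>h. \<nu> (X n) h \<partial>lebesgue_on {h. norm h > \<delta>}) \<longlonglongrightarrow> 0"
      unfolding tendsto_at_iff_sequentially using X X0 by (auto simp: comp_def)
    then show ?thesis using k(5)[OF that] by (simp add: \<mu>_def)
  qed
  interpret bounded_energy_sequence p \<mu> \<Omega> w w\<^sub>0 V M e
  proof (intro bounded_energy_sequence.intro kernel_sequence.intro bounded_energy_sequence_axioms.intro)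
    show "1 < p" "open \<Omega>" by (fact assms)+
    show "sets (\<mu> n) = sets borel" for n by (simp add: \<mu>_def)
    show "sigma_finite_measure (\<mu> n)" for n unfolding \<mu>_def by (rule sigma_finite_density_lborel[OF k(1)])
    show "has_bochner_integral (\<mu> n) (\<lambda>h. min 1 (norm h powr p)) 1" for n unfolding \<mu>_def by (rule k(4))
    show "(\<lambda>n. measure (\<mu> n) {h. \<delta> < norm h}) \<longlonglongrightarrow> 0" if "0 < \<delta>" for \<delta> by (rule conc[OF that])
    show "distr (\<mu> n) borel (reflect a) = \<mu> n" for n a unfolding \<mu>_def by (rule k(6))
    show "(\<lambda>n. \<integral>x. indicator L x * norm (w n x - w\<^sub>0 x) powr p \<partial>lborel) \<longlonglongrightarrow> 0" if "compact L" "L \<subseteq> \<Omega>" for L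
      by (rule loc[OF that])
    show "V x = 0" if "x \<notin> \<Omega>" for x by (rule borel_repD(2)[OF V(1) that])
    show "norm e = 1" using assms(2) by simp
  qed (rule w(2) bounds Ti w\<^sub>0(2) V(2) wV)+
  have "(\<lambda>n. nonlocal_form p (\<nu> (X n)) \<Omega> u (v\<^sub>\<epsilon> (X n))) \<longlonglongrightarrow> K_const e p * (\<integral>x. pflux p (G x) \<bullet> V x \<partial>lborel)"
    using increment_pairing_tendsto[OF U G UG] unfolding form[OF Um uU] .
  moreover have "local_form p \<Omega> u v = (\<integral>x. pflux p (G x) \<bullet> V x \<partial>lborel)"
  proof -
    have [measurable]: "G \<in> borel_measurable borel" "V \<in> borel_measurable borel"
      using G V(2) by (auto simp: p_integrable_def)
    have "local_form p \<Omega> u v = (\<integral>x. indicator \<Omega> x *\<^sub>R (pflux p (G x) \<bullet> V x) \<partial>lborel)"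
      unfolding local_form_def
    proof (rule lebesgue_on_transfer(3)[OF \<Omega>])
      show "AE x in lborel. x \<in> \<Omega> \<longrightarrow> norm (weak_grad \<Omega> u x) powr (p - 2) * (weak_grad \<Omega> u x \<bullet> weak_grad \<Omega> v x) = pflux p (G x) \<bullet> V x"
        using uG borel_repD(3)[OF V(1)] by eventually_elim (auto simp: pflux_def)
    qed measurable
    also have "(\<lambda>x. indicator \<Omega> x *\<^sub>R (pflux p (G x) \<bullet> V x)) = (\<lambda>x. pflux p (G x) \<bullet> V x)"
      using borel_repD(2)[OF V(1)] by (auto simp: indicator_def fun_eq_iff)
    finally show ?thesis .
  qed
  ultimately show "((\<lambda>\<epsilon>. nonlocal_form p (\<nu> \<epsilon>) \<Omega> u (v\<^sub>\<epsilon> \<epsilon>)) \<circ> X) \<longlonglongrightarrow> K_const e p * local_form p \<Omega> u v"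
    by (simp add: comp_def)
qed

end
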